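(* Let $m\ge 1$ be an integer, let $0=x_0<x_1<\cdots<x_m<x_{m+1}=1$, let $f:(0,1)\times\mathbb{R}\to\mathbb{R}$ be a Carathéodory function, and let $\imath_1,\dots,\imath_m:\mathbb{R}\to\mathbb{R}$ be continuous. Assume: (i) there are $a_1,\dots,a_{m+1}\in\mathbb{R}$ such that $f(x,t)=\sum_{j=1}^{m+1}a_j\,\chi_j(x)\,t+g(x,t)$, where $\chi_j$ is the characteristic function of $(x_{j-1},x_j)$ and $g$ satisfies $|g(x,t)|\le C(|t|^{r-1}+1)$ for a.e. $x\in(0,1)$ and all $t\in\mathbb{R}$, for some $r\in(1,2)$ and some constant $C>0$; (ii) there are constants $\mu>2$, $c>0$ and $C'>0$ such that $t\,\imath_j(t)\ge c|t|^\mu-C'$ for all $t\in\mathbb{R}$ and $j=1,\dots,m$; (iii) for each $j=1,\dots,m+1$, $a_j\notin\sigma_j:=\left\{\frac{k^2\pi^2}{(x_j-x_{j-1})^2}: k=1,2,\dots\right\}$. Then the impulsive problem $$-u''=f(x,u)\ \text{ for } x\in(0,1)\setminus\{x_1,\dots,x_m\},\quad u(0)=u(1)=0,\quad u(x_j^+)=u(x_j^-),\quad u'(x_j^+)=u'(x_j^-)-\imath_j(u(x_j)),\quad j=1,\dots,m,$$ has a (weak) solution.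
   Context: $u(x_j^\pm)$ and $u'(x_j^\pm)$ denote one-sided limits at $x_j$ from the right ($+$) and left ($-$). A Carathéodory function is measurable in $x$ for every $t$ and continuous in $t$ for a.e. $x$. A weak solution of the impulsive problem is a function $u\in H^1_0(0,1)$ such that $$\int_0^1u'v'=\int_0^1f(x,u)\,v+\sum_{j=1}^m\imath_j(u(x_j))\,v(x_j)\quad\text{for all }v\in H^1_0(0,1),$$ and solutions are understood in this sense. *)

theory Defs
  imports "HOL-Analysis.Analysis"
begin

abbreviation unit_leb :: "real measure" where
  "unit_leb \<equiv> lebesgue_on {0<..<1}"

definition L2_fun :: "(real \<Rightarrow> real) \<Rightarrow> bool" where
  "L2_fun u \<longleftrightarrow> u \<in> borel_measurable unit_leb \<and> integrable unit_leb (\<lambda>y. (u y)\<^sup>2)"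

definition test_function :: "(real \<Rightarrow> real) \<Rightarrow> bool" where
  "test_function \<phi> \<longleftrightarrow>
     (\<forall>k y. (deriv ^^ k) \<phi> field_differentiable at y) \<and>
     (\<exists>K. compact K \<and> K \<subseteq> {0<..<1} \<and> (\<forall>y. y \<notin> K \<longrightarrow> \<phi> y = 0))"

text \<open>
  \<open>has_weak_deriv u u'\<close>: \<open>u\<close> lies in the Sobolev space $H^1(0,1)$ and \<open>u'\<close> is (a representative
  of) its weak derivative, which is unique up to a null set.
\<close>
definition has_weak_deriv :: "(real \<Rightarrow> real) \<Rightarrow> (real \<Rightarrow> real) \<Rightarrow> bool" where
  "has_weak_deriv u u' \<longleftrightarrow> L2_fun u \<and> L2_fun u' \<and>
     (\<forall>\<phi>. test_function \<phi> \<longrightarrow>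
        (\<integral>y. u y * deriv \<phi> y \<partial>unit_leb) = - (\<integral>y. u' y * \<phi> y \<partial>unit_leb))"

text \<open>
  $H^1_0(0,1)$, the closure of $C_c^\infty(0,1)$ in $H^1(0,1)$. Each class is represented by its
  representative that is continuous on the closed interval, so that the point values $u(x_j)$ make
  sense; values outside $[0,1]$ are irrelevant.
\<close>
definition H1_0 :: "(real \<Rightarrow> real) set" where
  "H1_0 = {u. continuous_on {0..1} u \<and>
     (\<exists>u'. has_weak_deriv u u' \<and>
       (\<exists>\<phi>. (\<forall>n. test_function (\<phi> n)) \<and>
          (\<lambda>n::nat. (\<integral>y. (u y - \<phi> n y)\<^sup>2 \<partial>unit_leb)
               + (\<integral>y. (u' y - deriv (\<phi> n) y)\<^sup>2 \<partial>unit_leb)) \<longlonglongrightarrow> 0))}"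

definition caratheodory :: "(real \<Rightarrow> real \<Rightarrow> real) \<Rightarrow> bool" where
  "caratheodory f \<longleftrightarrow>
     (\<forall>t. (\<lambda>y. f y t) \<in> borel_measurable unit_leb) \<and>
     (AE y in unit_leb. continuous_on UNIV (f y))"

definition dirichlet_spectrum :: "(nat \<Rightarrow> real) \<Rightarrow> nat \<Rightarrow> real set" where
  "dirichlet_spectrum x j = {(real k)\<^sup>2 * pi\<^sup>2 / (x j - x (j - 1))\<^sup>2 | k::nat. k \<ge> 1}"

text \<open>
  Since Bochner integrals of non-integrable functions are \<open>0\<close> by convention, integrability of
  \<open>f y (u y) * v y\<close> is demanded explicitly. The product \<open>u' y * v' y\<close> of two square-integrable
  functions needs no such clause. The choice of \<open>u'\<close> is immaterial, being unique a.e.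
\<close>
definition weak_solution ::
  "nat \<Rightarrow> (nat \<Rightarrow> real) \<Rightarrow> (real \<Rightarrow> real \<Rightarrow> real) \<Rightarrow> (nat \<Rightarrow> real \<Rightarrow> real) \<Rightarrow> (real \<Rightarrow> real) \<Rightarrow> bool" where
  "weak_solution m x f \<iota> u \<longleftrightarrow> u \<in> H1_0 \<and>
     (\<exists>u'. has_weak_deriv u u' \<and>
       (\<forall>v v'. v \<in> H1_0 \<longrightarrow> has_weak_deriv v v' \<longrightarrow>
          integrable unit_leb (\<lambda>y. f y (u y) * v y) \<and>
          (\<integral>y. u' y * v' y \<partial>unit_leb) =
            (\<integral>y. f y (u y) * v y \<partial>unit_leb) + (\<Sum>j=1..m. \<iota> j (u (x j)) * v (x j))))"

end

theory Submission
  imports Defs "HOL-Computational_Algebra.Polynomial" "HOL-Complex_Analysis.Great_Picard"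
begin

text \<open>
  The solution is found by shooting: solve the initial value problem with \<open>u(0) = 0\<close>, \<open>u'(0) = p\<close>
  and adjust \<open>p\<close> so that \<open>u(1) = 0\<close>. Since \<open>f\<close> is merely continuous in its second argument, solutions
  of the initial value problem need not be unique. With a delay \<open>d > 0\<close> in the argument of the
  nonlinearities (Tonelli) they are unique and depend continuously on \<open>p\<close>.

  Write \<open>Q\<^sub>j\<close> for the velocity just after the node \<open>x\<^sub>j\<close>. For large \<open>\<bar>p\<bar>\<close> and small \<open>d\<close> one has
  \<open>u(x\<^sub>j) = o(Q\<^sub>j)\<close>: on the next interval the sublinear part of \<open>f\<close> is negligible, so \<open>u\<close> is close to
  \<open>Q\<^sub>j S\<close>, where \<open>S'' = - a S\<close>, \<open>S = 0\<close> and \<open>S' = 1\<close> at \<open>x\<^sub>j\<close>. Nonresonance says that \<open>S\<close> does not vanish at \<open>x\<^bsub>j+1\<^esub>\<close>,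
  hence \<open>\<bar>u(x\<^bsub>j+1\<^esub>)\<bar>\<close> is of the order of \<open>\<bar>Q\<^sub>j\<bar>\<close>, and the superlinear impulse makes \<open>Q\<^bsub>j+1\<^esub>\<close> much larger than
  \<open>Q\<^sub>j\<close>, with sign opposite to that of \<open>u(x\<^bsub>j+1\<^esub>)\<close>. So the sign of \<open>u(1)\<close> is determined by the sign of \<open>p\<close>
  and changes with it. The intermediate value theorem yields a bounded family of slopes \<open>p\<close> with
  \<open>u(1) = 0\<close>, and by the Arzela-Ascoli theorem one can pass to the limit \<open>d \<rightarrow> 0\<close>.
\<close>

subsection \<open>Indefinite integrals\<close>

text \<open>The interval of slopes on which \<open>u(1)\<close> changes sign must not depend on the
  delay, since otherwise the selected slopes could escape to infinity as d tends to 0. The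
  asymptotic estimates are therefore made along the product of the filters d -> 0+ and |p| ->
  infinity, which yields one R for all small d. For |p| <= R, linear growth of f between the nodes
  and continuity of the finitely many impulses bound position and velocity uniformly in d; this
  gives the equicontinuity used in the limit.

  A second obstacle is that \<open>H1_0\<close> is defined as a closure. Membership of the solution
  requires explicit test functions although its velocity jumps at the nodes: bounded smooth
  approximations of the velocity are corrected to mean zero, which is possible in the limit because
  u(1) = 0, and then integrated. Conversely, a general v is known only as a limit of test functions,
  so the weak identity is proved for test functions and extended by density; the values at the nodes
  need uniform convergence there.

  The almost-everywhere hypotheses on f are turned into pointwise ones by altering f on a null set,
  which the weak formulation does not see.\<close>

lemma bounded_measurable_integrable:
  fixes f :: "real \<Rightarrow> real"
  assumes "f \<in> borel_measurable (lebesgue_on {a..b})" "\<And>y. y \<in> {a..b} \<Longrightarrow> \<bar>f y\<bar> \<le> B"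
  shows "f integrable_on {a..b}"
  using measurable_bounded_by_integrable_imp_integrable_real[OF assms(1) integrable_const_ivl[of B] assms(2)]
  by auto

lemma abs_integral_le:
  fixes f :: "real \<Rightarrow> real"
  assumes "f integrable_on {a..b}" "a \<le> b" "\<And>y. y \<in> {a..b} \<Longrightarrow> \<bar>f y\<bar> \<le> B"
  shows "\<bar>integral {a..b} f\<bar> \<le> B * (b - a)"
  using integral_norm_bound_integral[OF assms(1) integrable_const_ivl[of B]] assms(2,3)
  by (auto simp: mult.commute)

lemma integral_diff_endpoints:
  fixes f :: "real \<Rightarrow> real"
  assumes "f integrable_on {a..b}" "a \<le> s" "s \<le> t" "t \<le> b"
  shows "integral {a..t} f - integral {a..s} f = integral {s..t} f"
proof -
  have "f integrable_on {a..t}" using assms by (auto intro: integrable_subinterval_real)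
  then show ?thesis using Henstock_Kurzweil_Integration.integral_combine[of a s t f] assms by simp
qed

text \<open>The quadratic bound makes all difference quotients tend to 0, so \<open>D\<close> has
  derivative 0 on [0,1]. This replaces the product rule where one factor is the integral of a merely
  measurable function and need not be differentiable everywhere.\<close>

lemma quadratic_modulus_imp_constant:
  fixes D :: "real \<Rightarrow> real"
  assumes "\<And>s t. 0 \<le> s \<Longrightarrow> s \<le> t \<Longrightarrow> t \<le> 1 \<Longrightarrow> \<bar>D t - D s\<bar> \<le> K * (t - s)\<^sup>2"
  shows "D 1 = D 0"
proof -
  have K: "\<bar>D t - D s\<bar> \<le> K * (t - s)\<^sup>2" if "s \<in> {0..1}" "t \<in> {0..1}" for s t
    using assms[of s t] assms[of t s] that
    by (cases "s \<le> t") (auto simp: abs_minus_commute power2_commute)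
  have "(D has_field_derivative 0) (at s within {0..1})" if s: "s \<in> {0..1}" for s
    unfolding has_field_derivative_iff
  proof (rule Lim_null_comparison)
    show "\<forall>\<^sub>F t in at s within {0..1}. norm ((D t - D s) / (t - s)) \<le> K * \<bar>t - s\<bar>"
      unfolding eventually_at_filter
    proof (rule always_eventually, intro allI impI)
      fix t assume t: "t \<noteq> s" "t \<in> {0..1}"
      have "\<bar>D t - D s\<bar> \<le> (K * \<bar>t - s\<bar>) * \<bar>t - s\<bar>"
        using K[OF s t(2)] by (simp add: power2_eq_square mult.assoc flip: abs_mult)
      then show "norm ((D t - D s) / (t - s)) \<le> K * \<bar>t - s\<bar>"
        using t by (simp add: abs_divide pos_divide_le_eq)
    qed
    have "((\<lambda>t. K * \<bar>t - s\<bar>) \<longlongrightarrow> K * \<bar>s - s\<bar>) (at s within {0..1})"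
      by (intro tendsto_intros)
    then show "((\<lambda>t. K * \<bar>t - s\<bar>) \<longlongrightarrow> 0) (at s within {0..1})" by simp
  qed
  then obtain c where "\<forall>s\<in>{0..1}. D s = c"
    using has_field_derivative_zero_constant[of "{0..1}" D] by auto
  then show ?thesis by simp
qed

lemma lebesgue_measurable_continuous:
  fixes f :: "real \<Rightarrow> real"
  shows "continuous_on {a..b} f \<Longrightarrow> f \<in> borel_measurable (lebesgue_on {a..b})"
  by (rule continuous_imp_measurable_on_sets_lebesgue) auto

lemma bounded_on_Icc:
  fixes f :: "real \<Rightarrow> real"
  assumes "continuous_on {a..b} f"
  obtains B where "B \<ge> 0" "\<And>y. y \<in> {a..b} \<Longrightarrow> \<bar>f y\<bar> \<le> B"
proof -
  obtain B where "\<forall>y\<in>f ` {a..b}. norm y \<le> B"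
    using compact_imp_bounded[OF compact_continuous_image[OF assms compact_Icc]]
    unfolding bounded_iff by blast
  then have "\<bar>f y\<bar> \<le> max 0 B" if "y \<in> {a..b}" for y
    using that by (metis image_eqI max.coboundedI2 real_norm_def)
  then show ?thesis using that[of "max 0 B"] by auto
qed

text \<open>With u the integral of V, the function u \<phi> minus the integral of
  \<open>V \<phi> + u \<phi>'\<close> is constant: on [s,t], freezing \<phi> at t and u at s changes
  the integrand by O(t - s), hence the increment by O((t - s)^2).\<close>

lemma integral_by_parts_indefinite:
  fixes V \<phi> \<phi>' :: "real \<Rightarrow> real"
  assumes V: "V \<in> borel_measurable (lebesgue_on {0..1})" "\<And>y. y \<in> {0..1} \<Longrightarrow> \<bar>V y\<bar> \<le> B"
    and \<phi>: "\<And>y. (\<phi> has_real_derivative \<phi>' y) (at y)" "continuous_on {0..1} \<phi>'"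
  shows "integral {0..1} (\<lambda>y. integral {0..y} V * \<phi>' y)
       = integral {0..1} V * \<phi> 1 - integral {0..1} (\<lambda>y. V y * \<phi> y)"
proof -
  let ?u = "\<lambda>y. integral {0..y} V"
  have Vint: "V integrable_on {0..1}" by (rule bounded_measurable_integrable[OF V])
  have "B \<ge> 0" using V(2)[of 0] by simp
  have u_cont: "continuous_on {0..1} ?u" by (rule indefinite_integral_continuous_1[OF Vint])
  have \<phi>_cont: "continuous_on {0..1} \<phi>"
    using \<phi>(1) by (meson DERIV_isCont continuous_at_imp_continuous_on)
  obtain P where P: "P \<ge> 0" "\<And>y. y \<in> {0..1} \<Longrightarrow> \<bar>\<phi> y\<bar> \<le> P" using bounded_on_Icc[OF \<phi>_cont] by blast
  obtain L where L: "L \<ge> 0" "\<And>y. y \<in> {0..1} \<Longrightarrow> \<bar>\<phi>' y\<bar> \<le> L" using bounded_on_Icc[OF \<phi>(2)] by blast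
  have i1: "(\<lambda>y. V y * \<phi> y) integrable_on {0..1}"
  proof (rule bounded_measurable_integrable)
    show "(\<lambda>y. V y * \<phi> y) \<in> borel_measurable (lebesgue_on {0..1})"
      using V(1) lebesgue_measurable_continuous[OF \<phi>_cont] by measurable
    show "\<bar>V y * \<phi> y\<bar> \<le> B * P" if "y \<in> {0..1}" for y
      unfolding abs_mult using V(2)[OF that] P(2)[OF that] \<open>B \<ge> 0\<close> by (intro mult_mono) auto
  qed
  have i2: "(\<lambda>y. ?u y * \<phi>' y) integrable_on {0..1}"
    by (intro integrable_continuous_real continuous_on_mult u_cont \<phi>(2))
  define h where "h y = V y * \<phi> y + ?u y * \<phi>' y" for y
  have hint: "h integrable_on {0..1}" unfolding h_def by (rule integrable_add[OF i1 i2])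
  define D where "D y = ?u y * \<phi> y - integral {0..y} h" for y
  have "D 1 = D 0"
  proof (rule quadratic_modulus_imp_constant)
    fix s t :: real assume st: "0 \<le> s" "s \<le> t" "t \<le> 1"
    then have sub: "{s..t} \<subseteq> {0..1}" by auto
    have int: "V integrable_on {s..t}" "h integrable_on {s..t}" "\<phi>' integrable_on {s..t}"
      using Vint hint integrable_continuous_real[OF \<phi>(2)] sub by (auto intro: integrable_subinterval_real)
    have ut: "?u t - ?u s = integral {s..t} V" using integral_diff_endpoints[OF Vint] st by simp
    have \<phi>ts: "(\<phi>' has_integral (\<phi> t - \<phi> s)) {s..t}"
      by (rule fundamental_theorem_of_calculus)
         (use \<phi>(1) st in \<open>auto simp flip: has_real_derivative_iff_has_vector_derivative intro: DERIV_subset\<close>)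
    have lipu: "\<bar>?u y - ?u s\<bar> \<le> B * (t - s)" if "y \<in> {s..t}" for y
    proof -
      have "\<bar>integral {s..y} V\<bar> \<le> B * (y - s)"
        using that st Vint by (intro abs_integral_le V(2)) (auto intro: integrable_subinterval_real)
      also have "\<dots> \<le> B * (t - s)" using that \<open>B \<ge> 0\<close> by (intro mult_left_mono) auto
      finally show ?thesis using integral_diff_endpoints[OF Vint, of s y] that st by simp
    qed
    have lip\<phi>: "\<bar>\<phi> t - \<phi> y\<bar> \<le> L * (t - s)" if "y \<in> {s..t}" for y
    proof -
      have "(\<phi>' has_integral (\<phi> t - \<phi> y)) {y..t}"
        by (rule fundamental_theorem_of_calculus)
           (use \<phi>(1) that in \<open>auto simp flip: has_real_derivative_iff_has_vector_derivative intro: DERIV_subset\<close>)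
      then have "\<phi> t - \<phi> y = integral {y..t} \<phi>'" "\<phi>' integrable_on {y..t}" by (auto simp: integral_unique)
      then have "\<bar>\<phi> t - \<phi> y\<bar> \<le> L * (t - y)"
        using that st by (auto intro!: abs_integral_le L(2))
      also have "\<dots> \<le> L * (t - s)" using that L(1) by (intro mult_left_mono) auto
      finally show ?thesis .
    qed
    have "((\<lambda>y. V y * \<phi> t + ?u s * \<phi>' y - h y) has_integral
        integral {s..t} V * \<phi> t + ?u s * (\<phi> t - \<phi> s) - integral {s..t} h) {s..t}"
      using int by (intro has_integral_diff has_integral_add has_integral_mult_left has_integral_mult_right \<phi>ts integrable_integral)
    moreover have "D t - D s = integral {s..t} V * \<phi> t + ?u s * (\<phi> t - \<phi> s) - integral {s..t} h"
      unfolding D_def ut[symmetric] using integral_diff_endpoints[OF hint st(1,2,3)] by (simp add: algebra_simps)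
    ultimately have "D t - D s = integral {s..t} (\<lambda>y. V y * \<phi> t + ?u s * \<phi>' y - h y)"
      "(\<lambda>y. V y * \<phi> t + ?u s * \<phi>' y - h y) integrable_on {s..t}" by (auto simp: integral_unique)
    moreover have "\<bar>V y * \<phi> t + ?u s * \<phi>' y - h y\<bar> \<le> 2 * B * L * (t - s)" if "y \<in> {s..t}" for y
    proof -
      have "V y * \<phi> t + ?u s * \<phi>' y - h y = V y * (\<phi> t - \<phi> y) - (?u y - ?u s) * \<phi>' y"
        unfolding h_def by (simp add: algebra_simps)
      moreover have "\<bar>V y * (\<phi> t - \<phi> y)\<bar> \<le> B * (L * (t - s))"
        unfolding abs_mult using V(2)[of y] lip\<phi>[OF that] \<open>B \<ge> 0\<close> that sub by (intro mult_mono) auto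
      moreover have "\<bar>(?u y - ?u s) * \<phi>' y\<bar> \<le> (B * (t - s)) * L"
        unfolding abs_mult using L(2)[of y] lipu[OF that] \<open>B \<ge> 0\<close> that sub st by (intro mult_mono) auto
      ultimately show ?thesis by (simp add: algebra_simps)
    qed
    ultimately have "\<bar>D t - D s\<bar> \<le> 2 * B * L * (t - s) * (t - s)"
      using abs_integral_le[of "\<lambda>y. V y * \<phi> t + ?u s * \<phi>' y - h y" s t] st by metis
    then show "\<bar>D t - D s\<bar> \<le> (2 * B * L) * (t - s)\<^sup>2" by (simp add: power2_eq_square mult.assoc)
  qed
  then have "integral {0..1} V * \<phi> 1 = integral {0..1} h" by (simp add: D_def)
  also have "\<dots> = integral {0..1} (\<lambda>y. V y * \<phi> y) + integral {0..1} (\<lambda>y. ?u y * \<phi>' y)"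
    unfolding h_def by (rule integral_add[OF i1 i2])
  finally show ?thesis by simp
qed

subsection \<open>Smooth cut-off functions\<close>

text \<open>The classical smooth function exp(-1/s), extended by 0, is \<open>flat 1\<close>. The
  polynomial factor in 1/s is carried along because every derivative of it has this form.\<close>

definition flat :: "real poly \<Rightarrow> real \<Rightarrow> real" where
  "flat p s = (if s > 0 then poly p (1 / s) * exp (- (1 / s)) else 0)"

lemma flat_tendsto_0: "(flat p \<longlongrightarrow> 0) (at_right 0)"
proof -
  have "((\<lambda>z. poly p z * exp (- z)) \<longlongrightarrow> 0) at_top"
  proof -
    have "((\<lambda>z. \<Sum>i\<le>degree p. coeff p i * (z ^ i / exp z)) \<longlongrightarrow> (\<Sum>i\<le>degree p. coeff p i * 0)) at_top"
      by (intro tendsto_sum tendsto_mult tendsto_const tendsto_power_div_exp_0)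
    then show ?thesis
      by (simp add: poly_altdef sum_distrib_right exp_minus divide_inverse mult.assoc)
  qed
  moreover have "filterlim (\<lambda>s::real. 1 / s) at_top (at_right 0)"
    using filterlim_inverse_at_top_right by (simp add: inverse_eq_divide)
  ultimately have "((\<lambda>s. poly p (1/s) * exp (- (1/s))) \<longlongrightarrow> 0) (at_right 0)"
    by (rule filterlim_compose)
  moreover have "\<forall>\<^sub>F s in at_right 0. poly p (1/s) * exp (- (1/s)) = flat p s"
    unfolding eventually_at_right_field flat_def by (intro exI[of _ 1]) auto
  ultimately show ?thesis by (rule Lim_transform_eventually)
qed

text \<open>With z = 1/s one has dz/ds = - z^2, and p(z) exp(-z) has z-derivative (p' - p)(z)
  exp(-z); the product gives the polynomial z^2 (p - p'). At s = 0 the right difference quotient is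
  again of the form \<open>flat\<close>, with polynomial z p, and tends to 0.\<close>

lemma flat_deriv:
  "(flat p has_real_derivative flat (monom 1 2 * (p - pderiv p)) s) (at s)"
proof -
  consider "s > 0" | "s < 0" | "s = 0" by linarith
  then show ?thesis
  proof cases
    case 1
    have "((\<lambda>s. poly p (1 / s) * exp (- (1 / s))) has_real_derivative
       flat (monom 1 2 * (p - pderiv p)) s) (at s)"
      using 1 by (auto intro!: derivative_eq_intros DERIV_chain2[OF poly_DERIV]
          simp: flat_def poly_monom field_simps power2_eq_square)
    then show ?thesis
      by (rule has_field_derivative_transform_within_open[of _ _ _ "{0<..}"])
         (use 1 in \<open>auto simp: flat_def\<close>)
  next
    case 2
    have "((\<lambda>s. 0) has_real_derivative flat (monom 1 2 * (p - pderiv p)) s) (at s)"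
      using 2 by (auto simp: flat_def)
    then show ?thesis
      by (rule has_field_derivative_transform_within_open[of _ _ _ "{..<0}"])
         (use 2 in \<open>auto simp: flat_def\<close>)
  next
    case 3
    have r: "((\<lambda>y. flat p y / y) \<longlongrightarrow> 0) (at_right 0)"
    proof (rule Lim_transform_eventually[OF flat_tendsto_0[of "monom 1 1 * p"]])
      show "\<forall>\<^sub>F y in at_right 0. flat (monom 1 1 * p) y = flat p y / y"
        unfolding eventually_at_right_field flat_def
        by (intro exI[of _ 1]) (auto simp: poly_monom)
    qed
    have l: "((\<lambda>y. flat p y / y) \<longlongrightarrow> 0) (at_left 0)"
    proof (rule Lim_transform_eventually[OF tendsto_const])
      show "\<forall>\<^sub>F y in at_left 0. 0 = flat p y / y"
        unfolding eventually_at_left_field flat_def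
        by (intro exI[of _ "-1"]) auto
    qed
    have "((\<lambda>y. flat p y / y) \<longlongrightarrow> 0) (at 0)"
      using r l by (simp add: filterlim_at_split)
    then show ?thesis
      unfolding 3 has_field_derivative_iff by (simp add: flat_def)
  qed
qed

text \<open>\<open>test_function\<close> demands that all iterates of \<open>deriv\<close> be
  differentiable. A class generated by closure rules and stable under differentiation settles this
  by one induction, and it still contains the polynomials and the cut-off functions.\<close>

inductive elementary_smooth :: "(real \<Rightarrow> real) \<Rightarrow> bool" where
  es_const: "elementary_smooth (\<lambda>y. c)"
| es_id: "elementary_smooth (\<lambda>y. y)"
| es_flat: "elementary_smooth (\<lambda>y. flat p (c * y + d))"
| es_add: "elementary_smooth f \<Longrightarrow> elementary_smooth g \<Longrightarrow> elementary_smooth (\<lambda>y. f y + g y)"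
| es_mult: "elementary_smooth f \<Longrightarrow> elementary_smooth g \<Longrightarrow> elementary_smooth (\<lambda>y. f y * g y)"

lemma elementary_smooth_deriv:
  "elementary_smooth f \<Longrightarrow> \<exists>f'. elementary_smooth f' \<and> (\<forall>y. (f has_real_derivative f' y) (at y))"
proof (induction rule: elementary_smooth.induct)
  case (es_const c)
  show ?case by (rule exI[of _ "\<lambda>y. 0"]) (auto intro: elementary_smooth.intros)
next
  case es_id
  show ?case by (rule exI[of _ "\<lambda>y. 1"]) (auto intro: elementary_smooth.intros)
next
  case (es_flat p c d)
  have "((\<lambda>y. flat p (c * y + d)) has_real_derivative
      flat (monom 1 2 * (p - pderiv p)) (c * y + d) * c) (at y)" for y
    by (rule DERIV_chain2[OF flat_deriv]) (auto intro!: derivative_eq_intros)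
  then show ?case
    by (intro exI[of _ "\<lambda>y. flat (monom 1 2 * (p - pderiv p)) (c * y + d) * c"])
       (auto intro: elementary_smooth.intros)
next
  case (es_add f g)
  then obtain f' g' where "elementary_smooth f'" "elementary_smooth g'"
    "\<And>y. (f has_real_derivative f' y) (at y)" "\<And>y. (g has_real_derivative g' y) (at y)" by blast
  then show ?case
    by (intro exI[of _ "\<lambda>y. f' y + g' y"])
       (auto intro: elementary_smooth.intros intro!: derivative_eq_intros)
next
  case (es_mult f g)
  then obtain f' g' where *: "elementary_smooth f'" "elementary_smooth g'"
    "\<And>y. (f has_real_derivative f' y) (at y)" "\<And>y. (g has_real_derivative g' y) (at y)" by blast
  have "elementary_smooth (\<lambda>y. f' y * g y + g' y * f y)"
    using * es_mult.hyps by (auto intro: elementary_smooth.intros)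
  then show ?case
    using * by (intro exI[of _ "\<lambda>y. f' y * g y + g' y * f y"]) (auto intro: DERIV_mult)
qed

lemma elementary_smooth_higher_deriv:
  "elementary_smooth f \<Longrightarrow> elementary_smooth ((deriv ^^ k) f)"
proof (induction k)
  case (Suc k)
  then obtain f' where "elementary_smooth f'" "\<And>y. ((deriv ^^ k) f has_real_derivative f' y) (at y)"
    using elementary_smooth_deriv by blast
  moreover from this have "(deriv ^^ Suc k) f = f'" by (auto intro!: ext DERIV_imp_deriv)
  ultimately show ?case by simp
qed simp

lemma elementary_smooth_differentiable:
  assumes "elementary_smooth f" shows "(deriv ^^ k) f field_differentiable at y"
  using elementary_smooth_deriv[OF elementary_smooth_higher_deriv[OF assms, of k]]
  by (auto simp: field_differentiable_def)

lemma elementary_smooth_polynomial: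
  assumes "real_polynomial_function f" shows "elementary_smooth f"
  using assms
proof (induction rule: real_polynomial_function.induct)
  case (linear f)
  then have "f = (\<lambda>y. f 1 * y)"
    by (metis linear_simps(5) bounded_linear.linear mult.commute mult.right_neutral real_scaleR_def)
  moreover have "elementary_smooth (\<lambda>y. f 1 * y)" by (intro elementary_smooth.intros)
  ultimately show ?case by metis
qed (auto intro: elementary_smooth.intros)

lemma elementary_smooth_test_function:
  assumes "elementary_smooth f" "0 < a" "b < 1" "\<And>y. y \<notin> {a..b} \<Longrightarrow> f y = 0"
  shows "test_function f"
  unfolding test_function_def
  using assms elementary_smooth_differentiable[OF assms(1)] by (auto intro!: exI[of _ "{a..b}"])

text \<open>The margin \<open>1/n\<close> keeps the support of the cut-off function inside the open interval.\<close>
definition cutoff :: "real \<Rightarrow> real \<Rightarrow> nat \<Rightarrow> real \<Rightarrow> real" where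
  "cutoff a b n y = flat 1 (real n * y + (- real n * a - 1)) * flat 1 (- real n * y + (real n * b - 1))"

lemma elementary_smooth_cutoff: "elementary_smooth (cutoff a b n)"
  unfolding cutoff_def by (intro elementary_smooth.intros)

lemma cutoff_bounds: "0 \<le> cutoff a b n y" "cutoff a b n y \<le> 1"
  unfolding cutoff_def flat_def by (auto simp: mult_le_one)

lemma cutoff_support:
  assumes "y \<notin> {a + 1 / real n .. b - 1 / real n}" shows "cutoff a b n y = 0"
proof (cases "n = 0")
  case True then show ?thesis by (simp add: cutoff_def flat_def)
next
  case False
  then show ?thesis using assms by (auto simp: cutoff_def flat_def field_simps)
qed

lemma cutoff_eq_0:
  assumes "y \<notin> {a<..<b}" shows "cutoff a b n y = 0"
proof -
  have "y < a + 1 / real n \<or> y > b - 1 / real n" if "n > 0"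
    using that assms by (smt (verit) greaterThanLessThan_iff of_nat_0_less_iff zero_less_divide_1_iff)
  moreover have "cutoff a b 0 y = 0" by (simp add: cutoff_def flat_def)
  ultimately show ?thesis using cutoff_support[of y a n b] by (cases "n = 0") auto
qed

lemma cutoff_pos:
  assumes "a < b" "n > 2 / (b - a)" shows "cutoff a b n ((a + b) / 2) > 0"
proof -
  have "real n * (b - a) > 2" using assms by (simp add: field_simps)
  then show ?thesis by (auto simp: cutoff_def flat_def field_simps intro!: mult_pos_pos)
qed

text \<open>Inside the interval each factor is eventually exp(-1/(n e - 1)), with e > 0 the distance
  to an endpoint, and tends to 1. Outside, all the functions vanish.\<close>

lemma cutoff_tendsto: "(\<lambda>n. cutoff a b n y) \<longlonglongrightarrow> indicat_real {a<..<b} y"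
proof (cases "y \<in> {a<..<b}")
  case False
  then show ?thesis by (simp add: cutoff_eq_0)
next
  case True
  have *: "(\<lambda>n. flat 1 (real n * e - 1)) \<longlonglongrightarrow> 1" if "e > 0" for e
  proof -
    have "filterlim (\<lambda>n. e * real n) at_top sequentially"
      by (rule filterlim_tendsto_pos_mult_at_top[OF tendsto_const that filterlim_real_sequentially])
    then have l: "filterlim (\<lambda>n. real n * e - 1) at_top sequentially"
      by (simp add: mult.commute filterlim_at_top_add_at_top filterlim_tendsto_add_at_top[OF tendsto_const[of "-1"], simplified])
    have "(\<lambda>n. exp (- (1 / (real n * e - 1)))) \<longlonglongrightarrow> exp (- 0)"
      by (intro tendsto_intros tendsto_divide_0[OF tendsto_const] filterlim_at_top_imp_at_infinity l)
    moreover have "\<forall>\<^sub>F n in sequentially. exp (- (1 / (real n * e - 1))) = flat 1 (real n * e - 1)"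
      using filterlim_at_top_dense[THEN iffD1, OF l, rule_format, of 0]
      by eventually_elim (simp add: flat_def)
    ultimately show ?thesis by (simp add: Lim_transform_eventually)
  qed
  have "(\<lambda>n. flat 1 (real n * (y - a) - 1) * flat 1 (real n * (b - y) - 1)) \<longlonglongrightarrow> 1 * 1"
    using True by (intro tendsto_mult *) auto
  then show ?thesis using True by (simp add: cutoff_def algebra_simps)
qed

section \<open>Smooth bumps, their antiderivatives, and bounded approximation of functions with
  jumps\<close>

definition smooth_bump :: "(real \<Rightarrow> real) \<Rightarrow> bool" where
  "smooth_bump f \<longleftrightarrow> elementary_smooth f \<and> (\<exists>a b. 0 < a \<and> b < 1 \<and> (\<forall>y. y \<notin> {a..b} \<longrightarrow> f y = 0))"

lemma smooth_bump_test_function: "smooth_bump f \<Longrightarrow> test_function f"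
  unfolding smooth_bump_def using elementary_smooth_test_function by blast

lemma smooth_bump_add:
  assumes "smooth_bump f" "smooth_bump g" shows "smooth_bump (\<lambda>y. f y + g y)"
proof -
  obtain a b where ab: "0 < a" "b < 1" "\<And>y. y \<notin> {a..b} \<Longrightarrow> f y = 0"
    using assms(1) unfolding smooth_bump_def by blast
  obtain a' b' where ab': "0 < a'" "b' < 1" "\<And>y. y \<notin> {a'..b'} \<Longrightarrow> g y = 0"
    using assms(2) unfolding smooth_bump_def by blast
  have "f y + g y = 0" if "y \<notin> {min a a'..max b b'}" for y
    using that ab(3)[of y] ab'(3)[of y] by (simp add: min_le_iff_disj le_max_iff_disj) argo
  moreover have "0 < min a a'" "max b b' < 1" using ab ab' by auto
  moreover have "elementary_smooth (\<lambda>y. f y + g y)"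
    using assms by (auto simp: smooth_bump_def intro: es_add)
  ultimately show ?thesis unfolding smooth_bump_def by blast
qed

lemma smooth_bump_mult:
  assumes "elementary_smooth f" "smooth_bump g" shows "smooth_bump (\<lambda>y. f y * g y)"
  using assms unfolding smooth_bump_def by (auto intro: es_mult)

lemma smooth_bump_zero: "smooth_bump (\<lambda>y. 0)"
  unfolding smooth_bump_def by (auto intro!: es_const exI[of _ "1/2"])

lemma smooth_bump_sum:
  "finite I \<Longrightarrow> (\<And>i. i \<in> I \<Longrightarrow> smooth_bump (f i)) \<Longrightarrow> smooth_bump (\<lambda>y. \<Sum>i\<in>I. f i y)"
  by (induction rule: finite_induct) (auto intro: smooth_bump_add smooth_bump_zero)

lemma smooth_bump_cutoff:
  assumes "0 \<le> a" "b \<le> 1"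
  shows "smooth_bump (cutoff a b n)"
proof (cases "n = 0")
  case True
  then have "cutoff a b n = (\<lambda>y. 0)" by (auto simp: cutoff_def flat_def)
  then show ?thesis by (simp add: smooth_bump_zero)
next
  case False
  then have "1 / real n > 0" by simp
  then have "0 < a + 1 / real n" "b - 1 / real n < 1" using assms by linarith+
  then show ?thesis
    unfolding smooth_bump_def using elementary_smooth_cutoff cutoff_support by blast
qed

lemma smooth_bump_continuous_on:
  assumes "smooth_bump f" shows "continuous_on S f"
proof -
  obtain f' where "\<And>y. (f has_real_derivative f' y) (at y)"
    using elementary_smooth_deriv assms by (metis smooth_bump_def)
  then show ?thesis by (meson DERIV_isCont continuous_at_imp_continuous_on)
qed

text \<open>Zero mean makes the antiderivative vanish to the right of the support as well. It need
  not lie in the elementary class, but its derivative is \<open>f\<close>, so all higher derivatives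
  are those of \<open>f\<close>.\<close>

lemma smooth_bump_antiderivative:
  assumes "smooth_bump f" "integral {0..1} f = 0"
  shows "((\<lambda>y. integral {0..y} f) has_real_derivative f y) (at y)"
    and "test_function (\<lambda>y. integral {0..y} f)"
proof -
  let ?F = "\<lambda>y. integral {0..y} f"
  obtain a b where ab: "0 < a" "b < 1" and f0: "\<And>y. y \<notin> {a..b} \<Longrightarrow> f y = 0"
    using assms(1) unfolding smooth_bump_def by blast
  have cont: "continuous_on {s..t} f" for s t by (rule smooth_bump_continuous_on[OF assms(1)])
  have int: "f integrable_on {s..t}" for s t by (rule integrable_continuous_real[OF cont])
  have low: "?F y = 0" if "y < a" for y
  proof -
    have "?F y = integral {0..y} (\<lambda>y. 0)"
      using that by (intro integral_cong f0) auto
    then show ?thesis by simp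
  qed
  have high: "?F y = 0" if "y > b" for y
  proof -
    consider "y \<le> 0" | "0 \<le> y" "y \<le> 1" | "1 \<le> y" by linarith
    then show ?thesis
    proof cases
      case 1
      then show ?thesis using low ab by (smt (verit))
    next
      case 2
      have "integral {y..1} f = integral {y..1} (\<lambda>y. 0)"
        using that by (intro integral_cong f0) auto
      then show ?thesis
        using Henstock_Kurzweil_Integration.integral_combine[of 0 y 1 f] 2 int assms(2) by simp
    next
      case 3
      have "integral {1..y} f = integral {1..y} (\<lambda>y. 0)"
        using ab by (intro integral_cong f0) auto
      then show ?thesis
        using Henstock_Kurzweil_Integration.integral_combine[of 0 1 y f] 3 int assms(2) by simp
    qed
  qed
  show deriv: "(?F has_real_derivative f y) (at y)" for y
  proof (cases "y < a")
    case True
    have "((\<lambda>y. 0) has_real_derivative f y) (at y)" using f0[of y] True by auto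
    then show ?thesis
      by (rule has_field_derivative_transform_within_open[of _ _ _ "{..<a}"]) (use True low in auto)
  next
    case False
    have "(?F has_real_derivative f y) (at y within {0..y+1})"
      by (rule integral_has_real_derivative[OF cont]) (use False ab in auto)
    moreover have "at y within {0..y+1} = at y"
      using False ab by (intro at_within_interior) auto
    ultimately show ?thesis by simp
  qed
  have "deriv ?F = f" by (rule ext, rule DERIV_imp_deriv, rule deriv)
  then have "(deriv ^^ Suc k) ?F = (deriv ^^ k) f" for k
    by (simp add: funpow_swap1)
  then have "(deriv ^^ Suc k) ?F field_differentiable at y" for k y
    using elementary_smooth_differentiable[of f k y] assms(1) by (simp add: smooth_bump_def)
  moreover have "(deriv ^^ 0) ?F field_differentiable at y" for y
    using deriv[of y] unfolding field_differentiable_def by auto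
  ultimately have "(deriv ^^ k) ?F field_differentiable at y" for k y
    by (cases k) blast+
  moreover have "compact {a..b}" "{a..b} \<subseteq> {0<..<1}" using ab by auto
  ultimately show "test_function ?F"
    unfolding test_function_def using low high
    by (metis atLeastAtMost_iff not_less)
qed

text \<open>Uniform polynomial approximation times a cut-off handles the continuous part; each jump is
  approximated by a cut-off of its own.\<close>

lemma smooth_bump_approximation:
  fixes V h :: "real \<Rightarrow> real" and b \<xi> :: "'i \<Rightarrow> real"
  assumes "continuous_on {0..1} h" "finite J" "\<And>j. j \<in> J \<Longrightarrow> 0 \<le> \<xi> j"
    and V: "\<And>y. y \<in> {0<..<1} \<Longrightarrow> V y = h y - (\<Sum>j\<in>J. if \<xi> j < y then b j else 0)"
  obtains \<psi> B where "\<And>n::nat. smooth_bump (\<psi> n)" "\<And>n y. \<bar>\<psi> n y\<bar> \<le> B"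
    "\<And>y. y \<in> {0<..<1} \<Longrightarrow> (\<lambda>n. \<psi> n y) \<longlonglongrightarrow> V y"
proof -
  have "\<exists>q. real_polynomial_function q \<and> (\<forall>y\<in>{0..1}. \<bar>h y - q y\<bar> < 1 / real (Suc n))" for n
  proof -
    have "0 < 1 / real (Suc n)" by simp
    from Stone_Weierstrass_real_polynomial_function[OF compact_Icc assms(1) this]
    show ?thesis by metis
  qed
  then obtain q where q: "\<And>n. real_polynomial_function (q n)"
    "\<And>n y. y \<in> {0..1} \<Longrightarrow> \<bar>h y - q n y\<bar> < 1 / real (Suc n)" by metis
  obtain H where "H \<ge> 0" and H: "\<And>y. y \<in> {0..1} \<Longrightarrow> \<bar>h y\<bar> \<le> H"
    using bounded_on_Icc[OF assms(1)] by blast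
  define \<psi> where "\<psi> n y = q n y * cutoff 0 1 n y + (\<Sum>j\<in>J. - b j * cutoff (\<xi> j) 1 n y)" for n y
  show ?thesis
  proof
    show "smooth_bump (\<psi> n)" for n
      unfolding \<psi>_def
      using assms q by (intro smooth_bump_add smooth_bump_sum smooth_bump_mult smooth_bump_cutoff
          elementary_smooth_polynomial es_const) auto
    show "\<bar>\<psi> n y\<bar> \<le> (H + 1) + (\<Sum>j\<in>J. \<bar>b j\<bar>)" for n y
    proof -
      have "\<bar>q n y * cutoff 0 1 n y\<bar> \<le> H + 1"
      proof (cases "y \<in> {0..1}")
        case True
        have "1 / real (Suc n) \<le> 1" by simp
        then have "\<bar>q n y\<bar> \<le> H + 1" using q(2)[OF True, of n] H[OF True] by linarith
        then show ?thesis
          using mult_mono[of "\<bar>q n y\<bar>" "H + 1" "cutoff 0 1 n y" 1] cutoff_bounds[of 0 1 n y] \<open>H \<ge> 0\<close>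
          by (simp add: abs_mult)
      next
        case False
        then show ?thesis using \<open>H \<ge> 0\<close> cutoff_eq_0[of y 0 1 n] by auto
      qed
      moreover have "\<bar>\<Sum>j\<in>J. - b j * cutoff (\<xi> j) 1 n y\<bar> \<le> (\<Sum>j\<in>J. \<bar>b j\<bar>)"
      proof (rule order_trans[OF sum_abs sum_mono])
        fix j
        show "\<bar>- b j * cutoff (\<xi> j) 1 n y\<bar> \<le> \<bar>b j\<bar>"
          using cutoff_bounds[of "\<xi> j" 1 n y] by (simp add: abs_mult mult_left_le)
      qed
      ultimately show ?thesis unfolding \<psi>_def by linarith
    qed
    fix y :: real assume y: "y \<in> {0<..<1}"
    have "(\<lambda>n. q n y) \<longlonglongrightarrow> h y"
    proof (rule LIMSEQ_I)
      fix e :: real assume "e > 0"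
      then obtain N where N: "1 / real (Suc N) < e" using nat_approx_posE by blast
      have "norm (q n y - h y) < e" if "n \<ge> N" for n
      proof -
        have "1 / real (Suc n) \<le> 1 / real (Suc N)" using that by (simp add: field_simps)
        then show ?thesis using q(2)[of y n] y N by auto
      qed
      then show "\<exists>N. \<forall>n\<ge>N. norm (q n y - h y) < e" by blast
    qed
    then have "(\<lambda>n. \<psi> n y) \<longlonglongrightarrow> h y * indicat_real {0<..<1} y + (\<Sum>j\<in>J. - b j * indicat_real {\<xi> j<..<1} y)"
      unfolding \<psi>_def by (intro tendsto_intros cutoff_tendsto)
    moreover have "h y * indicat_real {0<..<1} y + (\<Sum>j\<in>J. - b j * indicat_real {\<xi> j<..<1} y) = V y"
      using y unfolding V[OF y] by (auto simp: indicator_def sum_negf[symmetric] intro!: sum.cong)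
    ultimately show "(\<lambda>n. \<psi> n y) \<longlonglongrightarrow> V y" by simp
  qed
qed

text \<open>Bounds and limits are asked for on the open interval only, because bumps vanish at 0 and
  1 whereas the velocity they approximate in general does not.\<close>

lemma integral_bounded_convergence:
  fixes f :: "nat \<Rightarrow> real \<Rightarrow> real"
  assumes "\<And>n. f n integrable_on {a..b}" "\<And>n y. y \<in> {a<..<b} \<Longrightarrow> \<bar>f n y\<bar> \<le> B"
    "\<And>y. y \<in> {a<..<b} \<Longrightarrow> (\<lambda>n. f n y) \<longlonglongrightarrow> g y"
  shows "g integrable_on {a..b}" "(\<lambda>n. integral {a..b} (f n)) \<longlonglongrightarrow> integral {a..b} g"
proof -
  have 1: "f n integrable_on {a<..<b}" for n
    using assms(1) by (simp add: integrable_on_open_interval_real)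
  have 2: "(\<lambda>y. B) integrable_on {a<..<b}"
    using integrable_const_ivl[of B a b] by (simp add: integrable_on_open_interval_real)
  show "g integrable_on {a..b}" "(\<lambda>n. integral {a..b} (f n)) \<longlonglongrightarrow> integral {a..b} g"
    using dominated_convergence[of f "{a<..<b}" "\<lambda>y. B" g, OF 1 2] assms(2,3)
    by (auto simp: integrable_on_open_interval_real integral_open_interval_real)
qed

text \<open>A multiple of one fixed bump with nonzero integral is subtracted. The coefficients tend
  to 0, since by bounded convergence the means of the approximations tend to the mean of
  \<open>V\<close>; so bound and limit survive, and the antiderivatives become test
  functions.\<close>

lemma smooth_bump_approximation_mean_zero:
  fixes V h :: "real \<Rightarrow> real" and b \<xi> :: "'i \<Rightarrow> real"
  assumes "continuous_on {0..1} h" "finite J" "\<And>j. j \<in> J \<Longrightarrow> 0 \<le> \<xi> j"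
    and V: "\<And>y. y \<in> {0<..<1} \<Longrightarrow> V y = h y - (\<Sum>j\<in>J. if \<xi> j < y then b j else 0)"
    and "integral {0..1} V = 0"
  obtains \<psi> B where "\<And>n::nat. smooth_bump (\<psi> n)" "\<And>n y. \<bar>\<psi> n y\<bar> \<le> B"
    "\<And>y. y \<in> {0<..<1} \<Longrightarrow> (\<lambda>n. \<psi> n y) \<longlonglongrightarrow> V y" "\<And>n. integral {0..1} (\<psi> n) = 0"
proof -
  obtain \<psi> B where \<psi>: "\<And>n::nat. smooth_bump (\<psi> n)" and B: "\<And>n y. \<bar>\<psi> n y\<bar> \<le> B"
    and lim: "\<And>y. y \<in> {0<..<1} \<Longrightarrow> (\<lambda>n. \<psi> n y) \<longlonglongrightarrow> V y"
    using smooth_bump_approximation[OF assms(1-3) V] by blast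
  have int: "\<psi> n integrable_on {0..1}" for n
    by (intro integrable_continuous_real smooth_bump_continuous_on \<psi>)
  have I: "(\<lambda>n. integral {0..1} (\<psi> n)) \<longlonglongrightarrow> 0"
    using integral_bounded_convergence(2)[of \<psi> 0 1 B V] int B lim assms(5) by simp
  \<comment> \<open>The index 4 exceeds 2/(1 - 0), so by \<open>cutoff_pos\<close> this bump is
    positive at 1/2 and has a nonzero integral.\<close>
  define \<theta> where "\<theta> = cutoff 0 1 4"
  have \<theta>: "smooth_bump \<theta>" unfolding \<theta>_def by (intro smooth_bump_cutoff) auto
  have \<theta>_int: "\<theta> integrable_on {0..1}" by (intro integrable_continuous_real smooth_bump_continuous_on \<theta>)
  define k where "k = integral {0..1} \<theta>"
  have "k \<noteq> 0"
  proof
    assume "k = 0"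
    then have "\<forall>y\<in>{0..1}. \<theta> y = 0"
      using integral_eq_0_iff[of 0 1 \<theta>] smooth_bump_continuous_on[OF \<theta>] cutoff_bounds
      unfolding k_def \<theta>_def by auto
    moreover have "\<theta> ((0 + 1) / 2) > 0" unfolding \<theta>_def by (rule cutoff_pos) auto
    ultimately show False by auto
  qed
  define c where "c n = integral {0..1} (\<psi> n) / k" for n
  have c: "c \<longlonglongrightarrow> 0" unfolding c_def using tendsto_divide[OF I tendsto_const[of k]] \<open>k \<noteq> 0\<close> by simp
  then obtain K where K: "\<And>n. \<bar>c n\<bar> \<le> K"
    using convergent_imp_bounded[of c 0] unfolding bounded_iff by auto
  show ?thesis
  proof
    show "smooth_bump (\<lambda>y. \<psi> n y + - c n * \<theta> y)" for n
      by (intro smooth_bump_add smooth_bump_mult \<psi> \<theta> es_const)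
    show "\<bar>\<psi> n y + - c n * \<theta> y\<bar> \<le> B + K" for n y
    proof -
      have "\<bar>c n * \<theta> y\<bar> \<le> \<bar>c n\<bar>"
        unfolding \<theta>_def using cutoff_bounds[of 0 1 4 y] by (simp add: abs_mult mult_left_le)
      then show ?thesis using B[of n y] K[of n] by linarith
    qed
    show "(\<lambda>n. \<psi> n y + - c n * \<theta> y) \<longlonglongrightarrow> V y" if "y \<in> {0<..<1}" for y
      using tendsto_add[OF lim[OF that] tendsto_mult[OF tendsto_minus[OF c] tendsto_const[of "\<theta> y"]]] by simp
    show "integral {0..1} (\<lambda>y. \<psi> n y + - c n * \<theta> y) = 0" for n
    proof -
      have "((\<lambda>y. \<psi> n y + - c n * \<theta> y) has_integral integral {0..1} (\<psi> n) + - c n * k) {0..1}"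
        unfolding k_def using int \<theta>_int
        by (intro has_integral_add has_integral_mult_right integrable_integral)
      then have "integral {0..1} (\<lambda>y. \<psi> n y + - c n * \<theta> y) = integral {0..1} (\<psi> n) + - c n * k"
        by (rule integral_unique)
      then show ?thesis using \<open>k \<noteq> 0\<close> by (simp add: c_def)
    qed
  qed
qed

subsection \<open>Delayed approximations of the initial value problem\<close>

text \<open>Clamping the delayed time at 0 removes the need for an initial history: up to time d
  only the value \<open>w 0\<close> is read.\<close>

definition lag :: "real \<Rightarrow> (real \<Rightarrow> real) \<Rightarrow> real \<Rightarrow> real" where
  "lag d w t = w (max 0 (t - d))"

lemma lag_mem: "d \<ge> 0 \<Longrightarrow> t \<in> {0..1} \<Longrightarrow> max 0 (t - d) \<in> {0..(1::real)}"
  by auto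

lemma lag_continuous: "d \<ge> 0 \<Longrightarrow> continuous_on {0..1} w \<Longrightarrow> continuous_on {0..1} (lag d w)"
  unfolding lag_def
  by (rule continuous_on_compose2[of "{0..1}" w]) (auto intro!: continuous_intros)

text \<open>Continuity and growth of \<open>f\<close> are required at every point of the closed
  interval, not merely almost everywhere; the function actually inserted here is a modification of
  the given one on a null set.\<close>

locale impulsive_ivp =
  fixes f :: "real \<Rightarrow> real \<Rightarrow> real" and m :: nat and x :: "nat \<Rightarrow> real" and \<iota> :: "nat \<Rightarrow> real \<Rightarrow> real"
    and L D0 :: real
  assumes f_measurable: "\<And>t. (\<lambda>y. f y t) \<in> borel_measurable (lebesgue_on {0..1})"
    and f_continuous: "\<And>y. y \<in> {0..1} \<Longrightarrow> continuous_on UNIV (f y)"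
    and f_growth: "\<And>y t. y \<in> {0..1} \<Longrightarrow> \<bar>f y t\<bar> \<le> L * \<bar>t\<bar> + D0"
    and L_nonneg: "L \<ge> 0" and D0_nonneg: "D0 \<ge> 0"
    and impulse_continuous: "\<And>j. j \<in> {1..m} \<Longrightarrow> continuous_on UNIV (\<iota> j)"
    and x_mem: "\<And>j. j \<in> {1..m} \<Longrightarrow> x j \<in> {0..1}"
begin

text \<open>This is the equation integrated once, with the right-hand side evaluated along a given
  path \<open>w\<close>. Thus \<open>pos p\<close> is the Picard operator, and a fixed point
  \<open>u = pos p u\<close> solves the initial value problem. The strict inequality
  \<open>x j < y\<close> gives the velocity at a node its left-hand value.\<close>

definition vel :: "real \<Rightarrow> (real \<Rightarrow> real) \<Rightarrow> real \<Rightarrow> real" where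
  "vel p w y = p - integral {0..y} (\<lambda>t. f t (w t)) - (\<Sum>j=1..m. if x j < y then \<iota> j (w (x j)) else 0)"

definition pos :: "real \<Rightarrow> (real \<Rightarrow> real) \<Rightarrow> real \<Rightarrow> real" where
  "pos p w y = integral {0..y} (vel p w)"

lemma vel_0: "vel p w 0 = p"
proof -
  have "(\<Sum>j=1..m. if x j < 0 then \<iota> j (w (x j)) else 0) = 0"
    using x_mem by (intro sum.neutral) fastforce
  then show ?thesis by (simp add: vel_def)
qed

text \<open>Rounding \<open>w\<close> down to multiples of 1/(n+1) leaves countably many values, for
  which measurability is that of \<open>f\<close> at fixed second argument. Continuity of
  \<open>f t\<close> passes to the limit.\<close>

lemma nemytskii_measurable:
  assumes "continuous_on {0..1} w"
  shows "(\<lambda>t. f t (w t)) \<in> borel_measurable (lebesgue_on {0..1})"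
proof (rule borel_measurable_LIMSEQ_real)
  note [measurable] = lebesgue_measurable_continuous[OF assms] f_measurable
  show "(\<lambda>t::real. f t (of_int \<lfloor>real (Suc n) * w t\<rfloor> / real (Suc n))) \<in> borel_measurable (lebesgue_on {0..1})" for n
  proof (rule measurable_compose_countable[where f = "\<lambda>i t. f t (of_int i / real (Suc n))"])
    show "(\<lambda>t. \<lfloor>real (Suc n) * w t\<rfloor>) \<in> measurable (lebesgue_on {0..1}) (count_space UNIV)"
      by measurable
  qed (rule f_measurable)
next
  fix t :: real assume "t \<in> space (lebesgue_on {0..1})"
  then have t: "t \<in> {0..1}" by (simp add: space_restrict_space)
  have "(\<lambda>n. of_int \<lfloor>real (Suc n) * w t\<rfloor> / real (Suc n)) \<longlonglongrightarrow> w t"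
  proof (rule LIMSEQ_I)
    fix e :: real assume "e > 0"
    then obtain N where N: "1 / real (Suc N) < e" using nat_approx_posE by blast
    have "norm (of_int \<lfloor>real (Suc n) * w t\<rfloor> / real (Suc n) - w t) < e" if "n \<ge> N" for n
    proof -
      define k where "k = real (Suc n)"
      have "1 / real (Suc n) \<le> 1 / real (Suc N)" using that by (simp add: field_simps)
      then have k: "k > 0" "1 / k < e" using N unfolding k_def by simp_all
      have "of_int \<lfloor>k * w t\<rfloor> / k - w t = (of_int \<lfloor>k * w t\<rfloor> - k * w t) / k"
        using k by (simp add: diff_divide_distrib)
      then have "norm (of_int \<lfloor>k * w t\<rfloor> / k - w t) = \<bar>of_int \<lfloor>k * w t\<rfloor> - k * w t\<bar> / k"
        using k by (simp add: abs_divide)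
      also have "\<bar>of_int \<lfloor>k * w t\<rfloor> - k * w t\<bar> / k \<le> 1 / k"
        using k by (intro divide_right_mono) linarith+
      finally show ?thesis using k(2) unfolding k_def by simp
    qed
    then show "\<exists>N. \<forall>n\<ge>N. norm (of_int \<lfloor>real (Suc n) * w t\<rfloor> / real (Suc n) - w t) < e" by blast
  qed
  moreover have "isCont (f t) (w t)"
    using f_continuous[OF t] by (simp add: continuous_on_eq_continuous_at)
  ultimately show "(\<lambda>n. f t (of_int \<lfloor>real (Suc n) * w t\<rfloor> / real (Suc n))) \<longlonglongrightarrow> f t (w t)"
    by (rule isCont_tendsto_compose[rotated])
qed

lemma nemytskii_bound:
  assumes "\<bar>w y\<bar> \<le> B" "y \<in> {0..1}" shows "\<bar>f y (w y)\<bar> \<le> L * B + D0"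
  using f_growth[OF assms(2), of "w y"] mult_left_mono[OF assms(1) L_nonneg] by linarith

lemma nemytskii_integrable:
  assumes "continuous_on {0..1} w" "0 \<le> a" "b \<le> 1"
  shows "(\<lambda>t. f t (w t)) integrable_on {a..b}"
proof -
  obtain B where "\<And>y. y \<in> {0..1} \<Longrightarrow> \<bar>w y\<bar> \<le> B" using bounded_on_Icc[OF assms(1)] by blast
  then have "(\<lambda>t. f t (w t)) integrable_on {0..1}"
    using bounded_measurable_integrable[OF nemytskii_measurable[OF assms(1)], of "L * B + D0"] nemytskii_bound
    by blast
  then show ?thesis using assms by (auto intro: integrable_subinterval_real)
qed

lemma impulse_bounded:
  "\<exists>J\<ge>0. \<forall>j\<in>{1..m}. \<forall>t. \<bar>t\<bar> \<le> B \<longrightarrow> \<bar>\<iota> j t\<bar> \<le> J"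
proof -
  have "\<exists>K\<ge>0. \<forall>t\<in>{-B..B}. \<bar>\<iota> j t\<bar> \<le> K" if "j \<in> {1..m}" for j
    using bounded_on_Icc[of "-B" B "\<iota> j"] continuous_on_subset[OF impulse_continuous[OF that]] by (metis subset_UNIV)
  then obtain K where K: "\<And>j. j \<in> {1..m} \<Longrightarrow> K j \<ge> 0" "\<And>j t. j \<in> {1..m} \<Longrightarrow> t \<in> {-B..B} \<Longrightarrow> \<bar>\<iota> j t\<bar> \<le> K j"
    by metis
  have "K j \<le> (\<Sum>j=1..m. K j)" if "j \<in> {1..m}" for j
    using K(1) that by (intro member_le_sum) auto
  then have "\<bar>\<iota> j t\<bar> \<le> (\<Sum>j=1..m. K j)" if "j \<in> {1..m}" "\<bar>t\<bar> \<le> B" for j t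
    using K(2)[of j t] that by (simp add: abs_le_iff) (smt (verit))
  moreover have "0 \<le> (\<Sum>j=1..m. K j)" using K(1) by (intro sum_nonneg) blast
  ultimately show ?thesis by blast
qed

lemma vel_bounded:
  "\<exists>J\<ge>0. \<forall>p w y. continuous_on {0..1} w \<longrightarrow> (\<forall>t\<in>{0..1}. \<bar>w t\<bar> \<le> B) \<longrightarrow> y \<in> {0..1} \<longrightarrow> \<bar>vel p w y\<bar> \<le> \<bar>p\<bar> + J"
proof -
  obtain J where J: "J \<ge> 0" "\<And>j t. j \<in> {1..m} \<Longrightarrow> \<bar>t\<bar> \<le> B \<Longrightarrow> \<bar>\<iota> j t\<bar> \<le> J" using impulse_bounded[of B] by blast
  have "\<bar>vel p w y\<bar> \<le> \<bar>p\<bar> + (L * \<bar>B\<bar> + D0 + real m * J)"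
    if w: "continuous_on {0..1} w" "\<And>t. t \<in> {0..1} \<Longrightarrow> \<bar>w t\<bar> \<le> B" and y: "y \<in> {0..1}" for p w y
  proof -
    have "\<bar>integral {0..y} (\<lambda>t. f t (w t))\<bar> \<le> (L * B + D0) * (y - 0)"
      using y by (intro abs_integral_le nemytskii_integrable w nemytskii_bound) auto
    also have "\<dots> \<le> (L * \<bar>B\<bar> + D0) * 1"
      using y L_nonneg D0_nonneg by (intro mult_mono add_mono mult_left_mono) auto
    finally have 1: "\<bar>integral {0..y} (\<lambda>t. f t (w t))\<bar> \<le> L * \<bar>B\<bar> + D0" by simp
    have "\<bar>\<Sum>j=1..m. if x j < y then \<iota> j (w (x j)) else 0\<bar> \<le> (\<Sum>j=1..m. J)"
      using J w(2) x_mem by (intro order_trans[OF sum_abs sum_mono]) auto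
    then show ?thesis using 1 unfolding vel_def by simp
  qed
  moreover have "0 \<le> L * \<bar>B\<bar> + D0 + real m * J" using L_nonneg D0_nonneg J(1) by simp
  ultimately show ?thesis by blast
qed

lemma vel_measurable:
  assumes "continuous_on {0..1} w"
  shows "vel p w \<in> borel_measurable (lebesgue_on {0..1})"
proof -
  have "(\<lambda>y. integral {0..y} (\<lambda>t. f t (w t))) \<in> borel_measurable (lebesgue_on {0..1})"
    by (intro lebesgue_measurable_continuous indefinite_integral_continuous_1 nemytskii_integrable assms) auto
  moreover have "(\<lambda>y. if x j < y then k else 0) \<in> borel_measurable (lebesgue_on {0..1})" for j and k :: real
    by (rule measurable_restrict_space1, rule measurable_completion) measurable
  ultimately show ?thesis unfolding vel_def by measurable
qed

lemma vel_integrable: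
  assumes "continuous_on {0..1} w" "0 \<le> a" "b \<le> 1"
  shows "vel p w integrable_on {a..b}"
proof -
  obtain B where B: "\<And>y. y \<in> {0..1} \<Longrightarrow> \<bar>w y\<bar> \<le> B" using bounded_on_Icc[OF assms(1)] by blast
  obtain J where J: "J \<ge> 0" "\<And>p w y. continuous_on {0..1} w \<Longrightarrow> (\<And>t. t \<in> {0..1} \<Longrightarrow> \<bar>w t\<bar> \<le> B) \<Longrightarrow> y \<in> {0..1}
    \<Longrightarrow> \<bar>vel p w y\<bar> \<le> \<bar>p\<bar> + J" using vel_bounded[of B] by blast
  have "vel p w integrable_on {0..1}"
    by (rule bounded_measurable_integrable[OF vel_measurable[OF assms(1)] J(2)[OF assms(1) B]])
  then show ?thesis using assms by (auto intro: integrable_subinterval_real)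
qed

lemma pos_continuous: "continuous_on {0..1} w \<Longrightarrow> continuous_on {0..1} (pos p w)"
  unfolding pos_def by (intro indefinite_integral_continuous_1 vel_integrable) auto

text \<open>Dominated convergence is applied to the source and then to the velocity; only pointwise
  convergence of bounded paths is needed. It serves both for continuity in the slope at fixed delay
  and for the limit of vanishing delay.\<close>

lemma vel_pos_tendsto:
  assumes P: "P \<longlonglongrightarrow> p" and W: "\<And>n. continuous_on {0..1} (W n)"
    and B: "\<And>n y. y \<in> {0..1} \<Longrightarrow> \<bar>W n y\<bar> \<le> B"
    and lim: "\<And>y. y \<in> {0..1} \<Longrightarrow> (\<lambda>n. W n y) \<longlonglongrightarrow> w y" and y: "y \<in> {0..1}"
  shows "(\<lambda>n. vel (P n) (W n) y) \<longlonglongrightarrow> vel p w y" "(\<lambda>n. pos (P n) (W n) y) \<longlonglongrightarrow> pos p w y"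
proof -
  have vel: "(\<lambda>n. vel (P n) (W n) y) \<longlonglongrightarrow> vel p w y" if y: "y \<in> {0..1}" for y
  proof -
    have "(\<lambda>n. integral {0..y} (\<lambda>t. f t (W n t))) \<longlonglongrightarrow> integral {0..y} (\<lambda>t. f t (w t))"
    proof (rule dominated_convergence)
      show "(\<lambda>t. f t (W n t)) integrable_on {0..y}" for n using y by (intro nemytskii_integrable W) auto
      show "(\<lambda>t. L * B + D0) integrable_on {0..y}" by (rule integrable_const_ivl)
      show "norm (f t (W n t)) \<le> L * B + D0" if "t \<in> {0..y}" for n t
        using nemytskii_bound[of "W n" t B] B that y by auto
      show "(\<lambda>n. f t (W n t)) \<longlonglongrightarrow> f t (w t)" if "t \<in> {0..y}" for t
      proof (rule isCont_tendsto_compose[OF _ lim])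
        show "isCont (f t) (w t)" using f_continuous[of t] that y by (simp add: continuous_on_eq_continuous_at)
      qed (use that y in auto)
    qed
    moreover have "(\<lambda>n. \<Sum>j=1..m. if x j < y then \<iota> j (W n (x j)) else 0)
        \<longlonglongrightarrow> (\<Sum>j=1..m. if x j < y then \<iota> j (w (x j)) else 0)"
    proof (rule tendsto_sum)
      fix j assume j: "j \<in> {1..m}"
      have "isCont (\<iota> j) (w (x j))"
        using impulse_continuous[OF j] by (simp add: continuous_on_eq_continuous_at)
      then have "(\<lambda>n. \<iota> j (W n (x j))) \<longlonglongrightarrow> \<iota> j (w (x j))"
        by (rule isCont_tendsto_compose[OF _ lim[OF x_mem[OF j]]])
      then show "(\<lambda>n. if x j < y then \<iota> j (W n (x j)) else 0) \<longlonglongrightarrow> (if x j < y then \<iota> j (w (x j)) else 0)"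
        by auto
    qed
    ultimately show ?thesis unfolding vel_def by (intro tendsto_diff P)
  qed
  then show "(\<lambda>n. vel (P n) (W n) y) \<longlonglongrightarrow> vel p w y" using y by blast
  obtain K where K: "\<And>n. \<bar>P n\<bar> \<le> K"
    using convergent_imp_bounded[OF P] unfolding bounded_iff by auto
  obtain J where J': "J \<ge> 0" "\<And>p w y. continuous_on {0..1} w \<Longrightarrow> (\<And>t. t \<in> {0..1} \<Longrightarrow> \<bar>w t\<bar> \<le> B) \<Longrightarrow> y \<in> {0..1}
    \<Longrightarrow> \<bar>vel p w y\<bar> \<le> \<bar>p\<bar> + J" using vel_bounded[of B] by blast
  have J: "\<bar>vel (P n) (W n) y\<bar> \<le> \<bar>P n\<bar> + J" if "y \<in> {0..1}" for n y
    by (rule J'(2)[OF W B that])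
  show "(\<lambda>n. pos (P n) (W n) y) \<longlonglongrightarrow> pos p w y"
    unfolding pos_def
  proof (rule dominated_convergence)
    show "vel (P n) (W n) integrable_on {0..y}" for n using y by (intro vel_integrable W) auto
    show "(\<lambda>t. K + J) integrable_on {0..y}" by (rule integrable_const_ivl)
    show "norm (vel (P n) (W n) t) \<le> K + J" if "t \<in> {0..y}" for n t
      using J[of t n] K[of n] that y by auto
    show "(\<lambda>n. vel (P n) (W n) t) \<longlonglongrightarrow> vel p w t" if "t \<in> {0..y}" for t
      using vel that y by auto
  qed
qed

text \<open>Tonelli's approximation: with a delay \<open>d > 0\<close> the values on \<open>[0, (k+1) d]\<close> depend only on those
  on \<open>[0, k d]\<close>, so the iteration becomes stationary.\<close>

primrec delayed_iterate :: "real \<Rightarrow> real \<Rightarrow> nat \<Rightarrow> real \<Rightarrow> real" where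
  "delayed_iterate d p 0 = (\<lambda>_. 0)"
| "delayed_iterate d p (Suc k) = pos p (lag d (delayed_iterate d p k))"

text \<open>After k iterations the values on [0, k d] are final, and k = ceiling(1/d) makes k d >=
  1.\<close>

definition delayed_solution :: "real \<Rightarrow> real \<Rightarrow> real \<Rightarrow> real" where
  "delayed_solution d p = delayed_iterate d p (nat \<lceil>1 / d\<rceil>)"

lemma delayed_iterate_continuous: "d \<ge> 0 \<Longrightarrow> continuous_on {0..1} (delayed_iterate d p k)"
  by (induction k) (auto intro: pos_continuous lag_continuous)

lemma pos_cong:
  assumes "\<And>t. t \<in> {0..y} \<Longrightarrow> w t = w' t" shows "pos p w y = pos p w' y"
  unfolding pos_def
proof (rule integral_cong)
  fix s assume s: "s \<in> {0..y}"
  have "integral {0..s} (\<lambda>t. f t (w t)) = integral {0..s} (\<lambda>t. f t (w' t))"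
    using s by (intro integral_cong) (auto simp: assms)
  moreover have "(\<Sum>j=1..m. if x j < s then \<iota> j (w (x j)) else 0) = (\<Sum>j=1..m. if x j < s then \<iota> j (w' (x j)) else 0)"
    using s x_mem by (intro sum.cong) (auto simp: assms)
  ultimately show "vel p w s = vel p w' s" unfolding vel_def by simp
qed

lemma delayed_iterate_stationary:
  assumes "d > 0" "y \<in> {0..1}" "y \<le> real k * d"
  shows "delayed_iterate d p (Suc k) y = delayed_iterate d p k y"
  using assms(2,3)
proof (induction k arbitrary: y)
  case 0
  then show ?case by (simp add: pos_def)
next
  case (Suc k)
  have "pos p (lag d (delayed_iterate d p (Suc k))) y = pos p (lag d (delayed_iterate d p k)) y"
  proof (rule pos_cong)
    fix t assume "t \<in> {0..y}"
    then show "lag d (delayed_iterate d p (Suc k)) t = lag d (delayed_iterate d p k) t"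
      unfolding lag_def using Suc.prems \<open>d > 0\<close> by (intro Suc.IH) (auto simp: algebra_simps)
  qed
  then show ?case by simp
qed

lemma delayed_solution_continuous: "d > 0 \<Longrightarrow> continuous_on {0..1} (delayed_solution d p)"
  unfolding delayed_solution_def by (rule delayed_iterate_continuous) simp

lemma delayed_solution_eq:
  assumes "d > 0" "y \<in> {0..1}"
  shows "delayed_solution d p y = pos p (lag d (delayed_solution d p)) y"
proof -
  have "1 / d \<le> real (nat \<lceil>1 / d\<rceil>)" by linarith
  then have "1 / d * d \<le> real (nat \<lceil>1 / d\<rceil>) * d" using assms by (intro mult_right_mono) auto
  then have "1 \<le> real (nat \<lceil>1 / d\<rceil>) * d" using assms(1) by (simp del: of_nat_nat)
  then have "y \<le> real (nat \<lceil>1 / d\<rceil>) * d" using assms(2) by auto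
  from delayed_iterate_stationary[OF assms this] show ?thesis
    unfolding delayed_solution_def by simp
qed

lemma delayed_solution_0: "d > 0 \<Longrightarrow> delayed_solution d p 0 = 0"
  using delayed_solution_eq[of d 0 p] by (simp add: pos_def)

text \<open>The uniform bound is carried through the induction because it is the domination needed
  for the next iterate.\<close>

lemma delayed_iterate_tendsto:
  assumes "d > 0" "P \<longlonglongrightarrow> p"
  shows "(\<forall>y\<in>{0..1}. (\<lambda>n. delayed_iterate d (P n) k y) \<longlonglongrightarrow> delayed_iterate d p k y)
    \<and> (\<exists>B. \<forall>n. \<forall>y\<in>{0..1}. \<bar>delayed_iterate d (P n) k y\<bar> \<le> B)"
proof (induction k)
  case 0
  show ?case by auto
next
  case (Suc k)
  let ?W = "\<lambda>n. lag d (delayed_iterate d (P n) k)"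
  obtain B where B: "\<And>n y. y \<in> {0..1} \<Longrightarrow> \<bar>delayed_iterate d (P n) k y\<bar> \<le> B" using Suc by metis
  have W: "continuous_on {0..1} (?W n)" for n
    using assms(1) by (intro lag_continuous delayed_iterate_continuous) auto
  have WB: "\<bar>?W n y\<bar> \<le> B" if "y \<in> {0..1}" for n y
    unfolding lag_def using assms(1) that by (intro B lag_mem) auto
  have Wl: "(\<lambda>n. ?W n y) \<longlonglongrightarrow> lag d (delayed_iterate d p k) y" if "y \<in> {0..1}" for y
    unfolding lag_def using Suc assms(1) lag_mem[of d y] that by (auto simp del: atLeastAtMost_iff)
  obtain K where K: "\<And>n. \<bar>P n\<bar> \<le> K"
    using convergent_imp_bounded[OF assms(2)] unfolding bounded_iff by auto
  obtain J where J': "J \<ge> 0" "\<And>p w y. continuous_on {0..1} w \<Longrightarrow> (\<And>t. t \<in> {0..1} \<Longrightarrow> \<bar>w t\<bar> \<le> B) \<Longrightarrow> y \<in> {0..1}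
    \<Longrightarrow> \<bar>vel p w y\<bar> \<le> \<bar>p\<bar> + J" using vel_bounded[of B] by blast
  have J: "\<bar>vel (P n) (?W n) y\<bar> \<le> \<bar>P n\<bar> + J" if "y \<in> {0..1}" for n y
    by (rule J'(2)[OF W WB that])
  have "\<bar>pos (P n) (?W n) y\<bar> \<le> \<bar>K + J\<bar>" if y: "y \<in> {0..1}" for n y
  proof -
    have "\<bar>pos (P n) (?W n) y\<bar> \<le> (\<bar>P n\<bar> + J) * (y - 0)"
      unfolding pos_def using y by (intro abs_integral_le vel_integrable W J) auto
    also have "\<dots> \<le> \<bar>K + J\<bar> * 1" using K[of n] y by (intro mult_mono) auto
    finally show ?thesis by simp
  qed
  then have "\<exists>B. \<forall>n. \<forall>y\<in>{0..1}. \<bar>pos (P n) (?W n) y\<bar> \<le> B" by blast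
  then show ?case using vel_pos_tendsto(2)[OF assms(2) W WB Wl] by simp
qed

text \<open>The number of iterations depends on \<open>d\<close> alone, so convergence of each
  iterate along converging slopes suffices.\<close>

lemma delayed_solution_continuous_parameter:
  assumes "d > 0" "y \<in> {0..1}"
  shows "continuous_on S (\<lambda>p. delayed_solution d p y)"
  unfolding continuous_on_sequentially comp_def delayed_solution_def
  using delayed_iterate_tendsto[OF assms(1)] assms(2) by blast

lemma delayed_solution_lipschitz:
  assumes "d > 0" "0 \<le> s" "s \<le> t" "t \<le> b" "b \<le> 1"
    and "\<And>y. y \<in> {0..b} \<Longrightarrow> \<bar>vel p (lag d (delayed_solution d p)) y\<bar> \<le> B"
  shows "\<bar>delayed_solution d p t - delayed_solution d p s\<bar> \<le> B * (t - s)"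
proof -
  let ?v = "vel p (lag d (delayed_solution d p))"
  have cont: "continuous_on {0..1} (lag d (delayed_solution d p))"
    using assms(1) by (intro lag_continuous delayed_solution_continuous) auto
  have "delayed_solution d p t - delayed_solution d p s = integral {s..t} ?v"
    using assms delayed_solution_eq[OF assms(1), of s p] delayed_solution_eq[OF assms(1), of t p]
      integral_diff_endpoints[OF vel_integrable[OF cont, of 0 1 p], of s t]
    unfolding pos_def by simp
  moreover have "\<bar>integral {s..t} ?v\<bar> \<le> B * (t - s)"
    using assms by (intro abs_integral_le vel_integrable cont) auto
  ultimately show ?thesis by simp
qed

text \<open>The velocity bound makes all approximations Lipschitz with the same constant B, so a
  subsequence converges uniformly. It also makes the delayed path differ from the undelayed one by
  at most B d, so both have the same limit and the delay disappears from the equation.\<close>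

lemma delayed_solution_limit:
  assumes d: "\<And>n. d n > 0" "d \<longlonglongrightarrow> 0" and P: "\<And>n. \<bar>P n\<bar> \<le> R"
    and u: "\<And>n y. y \<in> {0..1} \<Longrightarrow> \<bar>delayed_solution (d n) (P n) y\<bar> \<le> B"
    and v: "\<And>n y. y \<in> {0..1} \<Longrightarrow> \<bar>vel (P n) (lag (d n) (delayed_solution (d n) (P n))) y\<bar> \<le> B"
    and u1: "\<And>n. delayed_solution (d n) (P n) 1 = 0"
  shows "\<exists>p u. continuous_on {0..1} u \<and> u 1 = 0 \<and> (\<forall>y\<in>{0..1}. u y = pos p u y)"
proof -
  let ?U = "\<lambda>n. delayed_solution (d n) (P n)"
  have "B \<ge> 0" using u[of 0 0] by simp
  have lip: "\<bar>?U n t - ?U n s\<bar> \<le> B * \<bar>t - s\<bar>" if "s \<in> {0..1}" "t \<in> {0..1}" for n s t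
    using delayed_solution_lipschitz[of "d n" s t 1 "P n" B] delayed_solution_lipschitz[of "d n" t s 1 "P n" B]
      d(1) v that by (cases "s \<le> t") (auto simp: abs_minus_commute)
  have "bounded (range P)" using P by (auto simp: bounded_iff)
  then obtain k1 p where k1: "strict_mono (k1 :: nat \<Rightarrow> nat)" and p: "(P \<circ> k1) \<longlonglongrightarrow> p"
    using bounded_imp_convergent_subsequence by blast
  obtain u k2 where u_cont: "continuous_on {0..1} u" and k2: "strict_mono (k2 :: nat \<Rightarrow> nat)"
    and unif: "\<And>e. 0 < e \<Longrightarrow> \<exists>N. \<forall>n t. n \<ge> N \<and> t \<in> {0..1} \<longrightarrow> norm (?U (k1 (k2 n)) t - u t) < e"
  proof (rule Arzela_Ascoli[of "{0..1::real}" "\<lambda>n. ?U (k1 n)" B])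
    show "compact {0..1::real}" by simp
    show "norm (?U (k1 n) t) \<le> B" if "t \<in> {0..1}" for n t using u[OF that] by simp
    show "\<exists>\<delta>>0. \<forall>n s. s \<in> {0..1} \<and> norm (t - s) < \<delta> \<longrightarrow> norm (?U (k1 n) t - ?U (k1 n) s) < e"
      if t: "t \<in> {0..1}" and e: "0 < e" for t e
    proof (intro exI[of _ "e / (B + 1)"] conjI allI impI)
      show "e / (B + 1) > 0" using e \<open>B \<ge> 0\<close> by simp
      fix n s assume s: "s \<in> {0..1} \<and> norm (t - s) < e / (B + 1)"
      then have "(B + 1) * \<bar>t - s\<bar> < e" using \<open>B \<ge> 0\<close> by (simp add: pos_less_divide_eq mult.commute)
      moreover have "B * \<bar>t - s\<bar> \<le> (B + 1) * \<bar>t - s\<bar>" by (intro mult_right_mono) auto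
      ultimately show "norm (?U (k1 n) t - ?U (k1 n) s) < e" using lip[of s t "k1 n"] s t by simp
    qed
  qed blast
  define k where "k n = k1 (k2 n)" for n
  have k: "strict_mono k" unfolding k_def using k1 k2 by (simp add: strict_mono_def)
  have Plim: "(\<lambda>n. P (k n)) \<longlonglongrightarrow> p"
    using LIMSEQ_subseq_LIMSEQ[OF p k2] by (simp add: k_def comp_def)
  have dlim: "(\<lambda>n. d (k n)) \<longlonglongrightarrow> 0"
    using LIMSEQ_subseq_LIMSEQ[OF d(2) k] by (simp add: comp_def)
  have ulim: "(\<lambda>n. ?U (k n) t) \<longlonglongrightarrow> u t" if "t \<in> {0..1}" for t
    unfolding k_def using unif that by (intro LIMSEQ_I) blast
  have wlim: "(\<lambda>n. lag (d (k n)) (?U (k n)) t) \<longlonglongrightarrow> u t" if t: "t \<in> {0..1}" for t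
  proof -
    have "(\<lambda>n. lag (d (k n)) (?U (k n)) t - ?U (k n) t) \<longlonglongrightarrow> 0"
    proof (rule Lim_null_comparison)
      show "\<forall>\<^sub>F n in sequentially. norm (lag (d (k n)) (?U (k n)) t - ?U (k n) t) \<le> B * d (k n)"
      proof (rule always_eventually, rule allI)
        fix n
        have "norm (lag (d (k n)) (?U (k n)) t - ?U (k n) t) \<le> B * \<bar>max 0 (t - d (k n)) - t\<bar>"
          unfolding lag_def real_norm_def using t d(1)[of "k n"] by (intro lip lag_mem) auto
        also have "\<dots> \<le> B * d (k n)"
          using t d(1)[of "k n"] \<open>B \<ge> 0\<close> by (intro mult_left_mono) auto
        finally show "norm (lag (d (k n)) (?U (k n)) t - ?U (k n) t) \<le> B * d (k n)" .
      qed
      show "(\<lambda>n. B * d (k n)) \<longlonglongrightarrow> 0" using tendsto_mult[OF tendsto_const[of B] dlim] by simp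
    qed
    from tendsto_add[OF this ulim[OF t]] show ?thesis by simp
  qed
  have "u y = pos p u y" if y: "y \<in> {0..1}" for y
  proof -
    have "(\<lambda>n. pos (P (k n)) (lag (d (k n)) (?U (k n))) y) \<longlonglongrightarrow> pos p u y"
    proof (rule vel_pos_tendsto(2)[OF Plim _ _ wlim y])
      show "continuous_on {0..1} (lag (d (k n)) (?U (k n)))" for n
        using d(1)[of "k n"] by (intro lag_continuous delayed_solution_continuous) auto
      show "\<bar>lag (d (k n)) (?U (k n)) t\<bar> \<le> B" if "t \<in> {0..1}" for n t
        unfolding lag_def using d(1)[of "k n"] that by (intro u lag_mem) auto
    qed
    then have "(\<lambda>n. ?U (k n) y) \<longlonglongrightarrow> pos p u y"
      using delayed_solution_eq[OF d(1) y] by simp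
    then show ?thesis using ulim[OF y] LIMSEQ_unique by blast
  qed
  moreover have "u 1 = 0" using ulim[of 1] u1 LIMSEQ_unique[OF _ tendsto_const] by fastforce
  ultimately show ?thesis using u_cont by blast
qed

end

subsection \<open>Estimates on one interval\<close>

text \<open>The map M -> A + M/2 has the fixed point 2 A. Iterating it from the finite starting
  bound \<open>B\<close> halves the excess over 2 A each time. This takes the place of Gronwall's
  inequality and tolerates delayed arguments.\<close>

lemma contraction_bound:
  fixes E :: "real \<Rightarrow> real"
  assumes bdd: "\<And>s. s \<in> S \<Longrightarrow> E s \<le> B * w s" and "B \<ge> 0" "A \<ge> 0" and w: "\<And>s. s \<in> S \<Longrightarrow> w s \<ge> 0"
    and step: "\<And>M. M \<ge> 0 \<Longrightarrow> (\<And>s. s \<in> S \<Longrightarrow> E s \<le> M * w s) \<Longrightarrow> (\<And>s. s \<in> S \<Longrightarrow> E s \<le> (A + M / 2) * w s)"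
    and s: "s \<in> S"
  shows "E s \<le> 2 * A * w s"
proof -
  have "\<forall>s\<in>S. E s \<le> (2 * A + B / 2 ^ k) * w s" for k
  proof (induction k)
    case 0
    show ?case
    proof
      fix s assume s: "s \<in> S"
      have "B * w s \<le> (2 * A + B) * w s" using \<open>A \<ge> 0\<close> w[OF s] by (intro mult_right_mono) auto
      then show "E s \<le> (2 * A + B / 2 ^ 0) * w s" using bdd[OF s] by simp
    qed
  next
    case (Suc k)
    have "2 * A + B / 2 ^ Suc k = A + (2 * A + B / 2 ^ k) / 2" by (simp add: field_simps)
    moreover have "0 \<le> 2 * A + B / 2 ^ k" using \<open>A \<ge> 0\<close> \<open>B \<ge> 0\<close> by simp
    ultimately show ?case using step[of "2 * A + B / 2 ^ k"] Suc.IH by metis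
  qed
  then have "E s \<le> (2 * A + B / 2 ^ k) * w s" for k using s by blast
  moreover have "(\<lambda>k. (2 * A + B / 2 ^ k) * w s) \<longlonglongrightarrow> (2 * A + 0) * w s"
    by (intro tendsto_intros LIMSEQ_divide_realpow_zero) auto
  ultimately have "E s \<le> (2 * A + 0) * w s" by (intro LIMSEQ_le_const) auto
  then show ?thesis by simp
qed


text \<open>\<open>W\<close> is the size of the argument on which the source depends: either a value
  from before \<open>a\<close>, bounded by \<open>P\<close>, or a value of \<open>u\<close> at an
  earlier time in the interval. As the exponential weight increases, looking back in time does not
  spoil the weighted estimate.\<close>

lemma interval_bound:
  fixes u v F W :: "real \<Rightarrow> real"
  assumes ab: "a \<le> b" "b \<le> a + 1" and F: "F integrable_on {a..b}"
    and v: "\<And>t. t \<in> {a..b} \<Longrightarrow> v t = Q - integral {a..t} F"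
    and u: "\<And>t. t \<in> {a..b} \<Longrightarrow> u t = u0 + integral {a..t} v"
    and F_le: "\<And>s. s \<in> {a<..<b} \<Longrightarrow> \<bar>F s\<bar> \<le> L * W s + D"
    and W: "\<And>s. s \<in> {a<..<b} \<Longrightarrow> W s \<le> P \<or> (\<exists>s'\<in>{a..s}. W s \<le> \<bar>u s'\<bar>)"
    and nonneg: "L \<ge> 0" "D \<ge> 0" "P \<ge> 0" and t: "t \<in> {a..b}"
  shows "\<bar>u t\<bar> + \<bar>v t\<bar> \<le> 2 * (\<bar>u0\<bar> + \<bar>Q\<bar> + L * P + D) * exp (2 * (L + 1))"
proof -
  \<comment> \<open>Integrating the weight exp(\<kappa> (s - a)) gains a factor 1/\<kappa>. The
    equations for u and v together contribute (L + 1)/\<kappa>, which this choice makes the 1/2 of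
    \<open>contraction_bound\<close>.\<close>
  define \<kappa> where "\<kappa> = 2 * (L + 1)"
  have \<kappa>: "\<kappa> > 0" using nonneg by (simp add: \<kappa>_def)
  define w where "w s = exp (\<kappa> * (s - a))" for s
  have w1: "w s \<ge> 1" if "s \<ge> a" for s unfolding w_def using that \<kappa> by simp
  have w_mono: "w s \<le> w s'" if "s \<le> s'" for s s' unfolding w_def using that \<kappa> by simp
  have w_int: "(w has_integral (w t - 1) / \<kappa>) {a..t}" if "a \<le> t" for t
  proof -
    have "(w has_integral (w t / \<kappa> - w a / \<kappa>)) {a..t}"
      unfolding w_def using \<kappa> that
      by (intro fundamental_theorem_of_calculus)
         (auto simp flip: has_real_derivative_iff_has_vector_derivative intro!: derivative_eq_intros)
    then show ?thesis by (simp add: w_def diff_divide_distrib)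
  qed
  define A where "A = \<bar>u0\<bar> + \<bar>Q\<bar> + L * P + D"
  have A: "A \<ge> 0" using nonneg by (simp add: A_def)
  have v_cont: "continuous_on {a..b} v"
  proof -
    have "continuous_on {a..b} (\<lambda>t. Q - integral {a..t} F)"
      by (intro continuous_intros indefinite_integral_continuous_1 F)
    then show ?thesis by (rule continuous_on_eq) (use v in auto)
  qed
  have v_int: "v integrable_on {a..b}" by (rule integrable_continuous_real[OF v_cont])
  have u_cont: "continuous_on {a..b} u"
  proof -
    have "continuous_on {a..b} (\<lambda>t. u0 + integral {a..t} v)"
      by (intro continuous_intros indefinite_integral_continuous_1 v_int)
    then show ?thesis by (rule continuous_on_eq) (use u in auto)
  qed
  obtain B1 where B1: "B1 \<ge> 0" "\<And>y. y \<in> {a..b} \<Longrightarrow> \<bar>u y\<bar> \<le> B1" using bounded_on_Icc[OF u_cont] by blast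
  obtain B2 where B2: "B2 \<ge> 0" "\<And>y. y \<in> {a..b} \<Longrightarrow> \<bar>v y\<bar> \<le> B2" using bounded_on_Icc[OF v_cont] by blast
  have "\<bar>u t\<bar> + \<bar>v t\<bar> \<le> 2 * A * w t"
  proof (rule contraction_bound[where S = "{a..b}" and E = "\<lambda>t. \<bar>u t\<bar> + \<bar>v t\<bar>" and B = "B1 + B2"])
    show "\<bar>u s\<bar> + \<bar>v s\<bar> \<le> (B1 + B2) * w s" if "s \<in> {a..b}" for s
    proof -
      have "(B1 + B2) * 1 \<le> (B1 + B2) * w s" using B1 B2 w1[of s] that by (intro mult_left_mono) auto
      then show ?thesis using B1(2)[OF that] B2(2)[OF that] by simp
    qed
    show "0 \<le> B1 + B2" "A \<ge> 0" "t \<in> {a..b}" using B1 B2 A t by auto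
    show "w s \<ge> 0" for s by (simp add: w_def)
    fix M s assume M: "0 \<le> M" and IH: "\<And>s. s \<in> {a..b} \<Longrightarrow> \<bar>u s\<bar> + \<bar>v s\<bar> \<le> M * w s" and s: "s \<in> {a..b}"
    have F_le': "\<bar>F y\<bar> \<le> (L * P + D) + L * M * w y" if "y \<in> {a<..<b}" for y
    proof -
      have "W y \<le> P + M * w y"
      proof (rule disjE[OF W[OF that]])
        assume "W y \<le> P"
        moreover have "0 \<le> M * w y" using M by (simp add: w_def)
        ultimately show ?thesis by simp
      next
        assume "\<exists>s'\<in>{a..y}. W y \<le> \<bar>u s'\<bar>"
        then obtain s' where s': "s' \<in> {a..y}" "W y \<le> \<bar>u s'\<bar>" by blast
        have "M * w s' \<le> M * w y" using s' M w_mono by (intro mult_left_mono) auto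
        moreover have "\<bar>u s'\<bar> + \<bar>v s'\<bar> \<le> M * w s'" using s' that by (intro IH) auto
        ultimately show ?thesis using s'(2) nonneg by linarith
      qed
      then have "L * W y \<le> L * (P + M * w y)" using nonneg by (intro mult_left_mono)
      then show ?thesis using F_le[OF that] by (simp add: algebra_simps)
    qed
    have "\<bar>integral {a..s} F\<bar> \<le> (L * P + D) * (s - a) + L * M * ((w s - 1) / \<kappa>)"
    proof -
      have "((\<lambda>y. (L * P + D) + L * M * w y) has_integral ((L * P + D) * (s - a) + L * M * ((w s - 1) / \<kappa>))) {a..s}"
        using s has_integral_const_real[of "L * P + D" a s]
        by (intro has_integral_add has_integral_mult_right w_int) (auto simp: mult.commute)
      then have "((\<lambda>y. (L * P + D) + L * M * w y) has_integral ((L * P + D) * (s - a) + L * M * ((w s - 1) / \<kappa>))) {a<..<s}"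
        by (simp add: has_integral_Icc_iff_Ioo)
      moreover have "F integrable_on {a<..<s}"
        using F s by (auto simp: integrable_on_open_interval_real intro: integrable_subinterval_real)
      ultimately have "norm (integral {a<..<s} F) \<le> (L * P + D) * (s - a) + L * M * ((w s - 1) / \<kappa>)"
        using integral_norm_bound_integral[of F "{a<..<s}" "\<lambda>y. (L * P + D) + L * M * w y"] F_le' s
        by (auto simp: integral_unique)
      then show ?thesis by (simp add: integral_open_interval_real)
    qed
    moreover have "(L * P + D) * (s - a) \<le> (L * P + D) * 1"
      using s ab nonneg by (intro mult_left_mono) auto
    moreover have "L * M * ((w s - 1) / \<kappa>) \<le> L * M * w s / \<kappa>"
      using M nonneg \<kappa> by (simp add: divide_right_mono mult_left_mono)
    moreover have "\<bar>v s\<bar> \<le> \<bar>Q\<bar> + \<bar>integral {a..s} F\<bar>" using v[OF s] by linarith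
    ultimately have v_le: "\<bar>v s\<bar> \<le> \<bar>Q\<bar> + ((L * P + D) * 1 + L * M * w s / \<kappa>)"
      by (meson add_mono order_refl order_trans)
    have "\<bar>integral {a..s} v\<bar> \<le> M * ((w s - 1) / \<kappa>)"
    proof -
      have "((\<lambda>y. M * w y) has_integral (M * ((w s - 1) / \<kappa>))) {a..s}"
        using s by (intro has_integral_mult_right w_int) auto
      moreover have "v integrable_on {a..s}" using v_int s by (auto intro: integrable_subinterval_real)
      moreover have "norm (v y) \<le> M * w y" if "y \<in> {a..s}" for y using IH[of y] that s by auto
      ultimately have "norm (integral {a..s} v) \<le> integral {a..s} (\<lambda>y. M * w y)"
        and "integral {a..s} (\<lambda>y. M * w y) = M * ((w s - 1) / \<kappa>)"
        by (blast intro: integral_norm_bound_integral integral_unique)+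
      then show ?thesis by (simp only: real_norm_def)
    qed
    moreover have "M * ((w s - 1) / \<kappa>) \<le> M * w s / \<kappa>"
      using M \<kappa> by (simp add: divide_right_mono mult_left_mono)
    moreover have "\<bar>u s\<bar> \<le> \<bar>u0\<bar> + \<bar>integral {a..s} v\<bar>" using u[OF s] by linarith
    ultimately have u_le: "\<bar>u s\<bar> \<le> \<bar>u0\<bar> + M * w s / \<kappa>" by linarith
    have "M * w s / \<kappa> + L * M * w s / \<kappa> = (L + 1) / \<kappa> * (M * w s)" by (simp add: algebra_simps add_divide_distrib)
    also have "(L + 1) / \<kappa> = 1 / 2" using nonneg by (simp add: \<kappa>_def)
    finally have half: "M * w s / \<kappa> + L * M * w s / \<kappa> = M / 2 * w s" by simp
    have "\<bar>u s\<bar> + \<bar>v s\<bar> \<le> (\<bar>u0\<bar> + M * w s / \<kappa>) + (\<bar>Q\<bar> + ((L * P + D) * 1 + L * M * w s / \<kappa>))"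
      by (rule add_mono[OF u_le v_le])
    also have "\<dots> = A + (M * w s / \<kappa> + L * M * w s / \<kappa>)" by (simp add: A_def)
    also have "\<dots> = A + M / 2 * w s" by (simp only: half)
    also have "A \<le> A * w s" using A w1[of s] s mult_left_mono[of 1 "w s" A] by simp
    finally show "\<bar>u s\<bar> + \<bar>v s\<bar> \<le> (A + M / 2) * w s" by (simp add: algebra_simps)
  qed
  also have "2 * A * w t \<le> 2 * A * exp \<kappa>"
  proof (intro mult_left_mono)
    have "\<kappa> * (t - a) \<le> \<kappa> * 1" using \<kappa> t ab by (intro mult_left_mono) auto
    then show "w t \<le> exp \<kappa>" by (simp add: w_def)
  qed (use A in auto)
  finally show ?thesis by (simp add: A_def \<kappa>_def)
qed

text \<open>S is sin(\<omega> t)/\<omega>, t or sinh(\<omega> t)/\<omega> according to the sign of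
  \<alpha>. Only the sine has positive zeros, at \<omega> l = k \<pi>, and then \<alpha> is a
  Dirichlet eigenvalue of an interval of length l.\<close>

lemma fundamental_solution:
  fixes \<alpha> :: real
  obtains S S' where "\<And>t. (S has_real_derivative S' t) (at t)"
    "\<And>t. (S' has_real_derivative - \<alpha> * S t) (at t)" "S 0 = 0" "S' 0 = 1"
    "\<And>l. l > 0 \<Longrightarrow> S l = 0 \<Longrightarrow> \<exists>k::nat. k \<ge> 1 \<and> \<alpha> = (real k)\<^sup>2 * pi\<^sup>2 / l\<^sup>2"
proof -
  consider "\<alpha> > 0" | "\<alpha> = 0" | "\<alpha> < 0" by linarith
  then show ?thesis
  proof cases
    case 1
    define \<omega> where "\<omega> = sqrt \<alpha>"
    have \<omega>: "\<omega> > 0" "\<alpha> = \<omega>\<^sup>2" using 1 by (auto simp: \<omega>_def)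
    show ?thesis
    proof (rule that[of "\<lambda>t. sin (\<omega> * t) / \<omega>" "\<lambda>t. cos (\<omega> * t)"])
      fix l :: real assume l: "l > 0" "sin (\<omega> * l) / \<omega> = 0"
      then have "sin (\<omega> * l) = 0" using \<omega> by simp
      then obtain i :: int where i: "\<omega> * l = real_of_int i * pi" using sin_zero_iff_int2 by blast
      have "real_of_int i * pi > 0" using i \<omega> l by (metis mult_pos_pos)
      then have "i > 0" by (simp add: zero_less_mult_iff)
      moreover have "\<omega> = real_of_int i * pi / l" using i l by (simp add: field_simps)
      ultimately have "\<alpha> = (real (nat i))\<^sup>2 * pi\<^sup>2 / l\<^sup>2" using \<omega>
        by (simp add: power_divide power_mult_distrib)
      then show "\<exists>k::nat. k \<ge> 1 \<and> \<alpha> = (real k)\<^sup>2 * pi\<^sup>2 / l\<^sup>2"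
        using \<open>i > 0\<close> by (intro exI[of _ "nat i"]) auto
    qed (use \<omega> in \<open>auto intro!: derivative_eq_intros simp: power2_eq_square\<close>)
  next
    case 2
    show ?thesis
      by (rule that[of "\<lambda>t. t" "\<lambda>t. 1"]) (use 2 in \<open>auto intro!: derivative_eq_intros\<close>)
  next
    case 3
    define \<omega> where "\<omega> = sqrt (- \<alpha>)"
    have \<omega>: "\<omega> > 0" "- \<alpha> = \<omega>\<^sup>2" using 3 by (auto simp: \<omega>_def)
    show ?thesis
    proof (rule that[of "\<lambda>t. sinh (\<omega> * t) / \<omega>" "\<lambda>t. cosh (\<omega> * t)"])
      fix l :: real assume l: "l > 0" "sinh (\<omega> * l) / \<omega> = 0"
      then have "\<omega> * l = 0" using \<omega> by simp
      then show "\<exists>k::nat. k \<ge> 1 \<and> \<alpha> = (real k)\<^sup>2 * pi\<^sup>2 / l\<^sup>2" using \<omega> l by simp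
    qed (use \<omega> in \<open>auto intro!: derivative_eq_intros simp: power2_eq_square\<close>)
  qed
qed

text \<open>The difference between u and Q S(t - a) satisfies the same linear equation with initial
  velocity 0 and a perturbation of size \<open>D\<close>, so \<open>interval_bound\<close> applies
  with vanishing velocity and past terms. The resulting error does not involve Q.\<close>

lemma interval_shooting_error:
  fixes u v F :: "real \<Rightarrow> real"
  assumes ab: "a \<le> b" "b \<le> a + 1" and F: "F integrable_on {a..b}"
    and v: "\<And>t. t \<in> {a..b} \<Longrightarrow> v t = Q - integral {a..t} F"
    and u: "\<And>t. t \<in> {a..b} \<Longrightarrow> u t = u0 + integral {a..t} v"
    and F_le: "\<And>s. s \<in> {a<..<b} \<Longrightarrow> \<bar>F s - \<alpha> * u s\<bar> \<le> D" and D: "D \<ge> 0"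
    and S: "\<And>t. (S has_real_derivative S' t) (at t)" "\<And>t. (S' has_real_derivative - \<alpha> * S t) (at t)"
      "S 0 = 0" "S' 0 = 1" and t: "t \<in> {a..b}"
  shows "\<bar>u t - Q * S (t - a)\<bar> \<le> 2 * (\<bar>u0\<bar> + D) * exp (2 * (\<bar>\<alpha>\<bar> + 1))"
proof -
  have cont: "continuous_on X (\<lambda>t. S (t - a))" for X
  proof -
    have "continuous_on UNIV S" using S(1) by (meson DERIV_isCont continuous_at_imp_continuous_on)
    then show ?thesis by (rule continuous_on_compose2) (auto intro!: continuous_intros)
  qed
  have cont': "continuous_on X (\<lambda>t. S' (t - a))" for X
  proof -
    have "continuous_on UNIV S'" using S(2) by (meson DERIV_isCont continuous_at_imp_continuous_on)
    then show ?thesis by (rule continuous_on_compose2) (auto intro!: continuous_intros)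
  qed
  have S_int: "((\<lambda>t. \<alpha> * Q * S (t - a)) has_integral (Q - Q * S' (t - a))) {a..t}" if "a \<le> t" for t
  proof -
    have "((\<lambda>t. - (Q * S' (t - a))) has_real_derivative \<alpha> * Q * S (t - a)) (at t)" for t
      by (auto intro!: derivative_eq_intros DERIV_chain2[OF S(2)])
    then have "((\<lambda>t. \<alpha> * Q * S (t - a)) has_integral (- (Q * S' (t - a)) - - (Q * S' (a - a)))) {a..t}"
      using that by (intro fundamental_theorem_of_calculus)
        (auto simp flip: has_real_derivative_iff_has_vector_derivative intro: DERIV_subset)
    then show ?thesis using S by simp
  qed
  have S'_int: "((\<lambda>t. Q * S' (t - a)) has_integral (Q * S (t - a))) {a..t}" if "a \<le> t" for t
  proof -
    have "((\<lambda>t. Q * S (t - a)) has_real_derivative Q * S' (t - a)) (at t)" for t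
      by (auto intro!: derivative_eq_intros DERIV_chain2[OF S(1)])
    then have "((\<lambda>t. Q * S' (t - a)) has_integral (Q * S (t - a) - Q * S (a - a))) {a..t}"
      using that by (intro fundamental_theorem_of_calculus)
        (auto simp flip: has_real_derivative_iff_has_vector_derivative intro: DERIV_subset)
    then show ?thesis using S by simp
  qed
  have F': "F integrable_on {a..t}" if "t \<in> {a..b}" for t
    using F that by (auto intro: integrable_subinterval_real)
  have v_int: "v integrable_on {a..t}" if "t \<in> {a..b}" for t
  proof -
    have "continuous_on {a..b} (\<lambda>t. Q - integral {a..t} F)"
      by (intro continuous_intros indefinite_integral_continuous_1 F)
    then have "continuous_on {a..b} v" by (rule continuous_on_eq) (use v in auto)
    then show ?thesis using that by (intro integrable_continuous_real) (auto elim: continuous_on_subset)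
  qed
  let ?e = "\<lambda>t. u t - Q * S (t - a)" and ?v = "\<lambda>t. v t - Q * S' (t - a)" and ?F = "\<lambda>t. F t - \<alpha> * Q * S (t - a)"
  have "\<bar>?e t\<bar> + \<bar>?v t\<bar> \<le> 2 * (\<bar>u0\<bar> + \<bar>0\<bar> + \<bar>\<alpha>\<bar> * 0 + D) * exp (2 * (\<bar>\<alpha>\<bar> + 1))"
  proof (rule interval_bound[where u = ?e and v = ?v and t = t and F = ?F and W = "\<lambda>t. \<bar>?e t\<bar>", OF ab])
    show "?F integrable_on {a..b}" using F S_int[OF ab(1)] by (intro integrable_diff) auto
    show "?v t = 0 - integral {a..t} ?F" if t: "t \<in> {a..b}" for t
    proof -
      have "(?F has_integral (integral {a..t} F - (Q - Q * S' (t - a)))) {a..t}"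
        using t by (intro has_integral_diff S_int integrable_integral F') auto
      then show ?thesis using v[OF t] by (simp add: integral_unique)
    qed
    show "?e t = u0 + integral {a..t} ?v" if t: "t \<in> {a..b}" for t
    proof -
      have "(?v has_integral (integral {a..t} v - Q * S (t - a))) {a..t}"
        using t by (intro has_integral_diff S'_int integrable_integral v_int) auto
      then show ?thesis using u[OF t] by (simp add: integral_unique)
    qed
    show "\<bar>?F s\<bar> \<le> \<bar>\<alpha>\<bar> * \<bar>?e s\<bar> + D" if "s \<in> {a<..<b}" for s
    proof -
      have "?F s = (F s - \<alpha> * u s) + \<alpha> * ?e s" by (simp add: algebra_simps)
      then show ?thesis using F_le[OF that] abs_mult[of \<alpha> "?e s"] by linarith
    qed
  qed (use D t in auto)
  then show ?thesis by simp
qed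

subsection \<open>The shooting method\<close>

text \<open>After division by q the left side consists of multiples of q^(r-2) and 1/q, both of
  which tend to 0 because r < 2.\<close>

lemma eventually_sublinear:
  fixes C K r \<delta> :: real
  assumes "1 < r" "r < 2" "\<delta> > 0" "K > 0"
  shows "\<forall>\<^sub>F q in at_top. C * ((K * q) powr (r - 1) + 1) \<le> \<delta> * q"
proof -
  have "((\<lambda>q. C * (K powr (r - 1) * q powr (r - 2) + 1 / q)) \<longlongrightarrow> C * (K powr (r - 1) * 0 + 0)) at_top"
    using assms
    by (intro tendsto_intros tendsto_neg_powr filterlim_ident tendsto_divide_0[OF tendsto_const]
        filterlim_at_top_imp_at_infinity) auto
  then have "\<forall>\<^sub>F q in at_top. C * (K powr (r - 1) * q powr (r - 2) + 1 / q) < \<delta>"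
    using assms by (intro order_tendstoD) auto
  then show ?thesis
    using eventually_gt_at_top[of 0]
  proof eventually_elim
    case (elim q)
    have "q powr (r - 2) * q = q powr (r - 1)" using elim powr_add[of q "r - 2" 1] by simp
    with elim assms have "C * ((K * q) powr (r - 1) + 1) = C * (K powr (r - 1) * q powr (r - 2) + 1 / q) * q"
      by (simp add: powr_mult algebra_simps)
    also have "\<dots> \<le> \<delta> * q" using elim by (intro mult_right_mono) auto
    finally show ?case .
  qed
qed

lemma partition_mono:
  fixes x :: "nat \<Rightarrow> real"
  assumes step: "\<And>j. j \<le> m \<Longrightarrow> x j < x (Suc j)" and "i \<le> k" "k \<le> Suc m"
  shows "x i \<le> x k"
  using assms(2,3)
proof (induction k)
  case (Suc k)
  then show ?case using step[of k] by (cases "i = Suc k") auto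
qed simp

locale superlinear_impulses = impulsive_ivp +
  fixes a :: "nat \<Rightarrow> real" and C r \<mu> c C' :: real
  assumes x_0: "x 0 = 0" and x_last: "x (Suc m) = 1" and x_step: "\<And>j. j \<le> m \<Longrightarrow> x j < x (Suc j)"
    and f_linear_part: "\<And>j y t. j \<le> m \<Longrightarrow> y \<in> {x j<..<x (Suc j)} \<Longrightarrow>
      \<bar>f y t - a (Suc j) * t\<bar> \<le> C * (\<bar>t\<bar> powr (r - 1) + 1)"
    and r_gt: "1 < r" and r_lt: "r < 2" and C_pos: "C > 0" and \<mu>_gt: "\<mu> > 2" and c_pos: "c > 0" and C'_pos: "C' > 0"
    and superlinear: "\<And>j t. j \<in> {1..m} \<Longrightarrow> t * \<iota> j t \<ge> c * \<bar>t\<bar> powr \<mu> - C'"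
    and nonresonant: "\<And>j. j \<le> m \<Longrightarrow> a (Suc j) \<notin> dirichlet_spectrum x (Suc j)"
begin

text \<open>Since \<mu> > 2, the factor c |t|^(\<mu>-2) eventually exceeds |G| + C'. The first
  summand dominates any prescribed quadratic, the second absorbs the additive constant.\<close>

lemma impulse_superlinear:
  "\<exists>T>0. \<forall>j\<in>{1..m}. \<forall>t. \<bar>t\<bar> \<ge> T \<longrightarrow> t * \<iota> j t \<ge> G * t\<^sup>2"
proof -
  define B where "B = (\<bar>G\<bar> + C') / c"
  have B: "B > 0" using c_pos C'_pos by (simp add: B_def)
  \<comment> \<open>The second entry makes c |t|^(\<mu>-2) at least |G| + C'; the entry 1 gives t^2
    >= 1, so that C' <= C' t^2.\<close>
  define T where "T = max 1 (B powr (1 / (\<mu> - 2)))"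
  have "G * t\<^sup>2 \<le> t * \<iota> j t" if "j \<in> {1..m}" "\<bar>t\<bar> \<ge> T" for j t
  proof -
    have t: "\<bar>t\<bar> \<ge> 1" using that by (simp add: T_def)
    then have "t\<^sup>2 \<ge> 1" by (metis one_power2 power2_abs power_mono zero_le_one)
    have "B = (B powr (1 / (\<mu> - 2))) powr (\<mu> - 2)" using B \<mu>_gt by (simp add: powr_powr)
    also have "\<dots> \<le> \<bar>t\<bar> powr (\<mu> - 2)" using that \<mu>_gt by (intro powr_mono2) (auto simp: T_def)
    finally have "\<bar>G\<bar> + C' \<le> c * \<bar>t\<bar> powr (\<mu> - 2)"
      using c_pos by (simp add: B_def pos_divide_le_eq mult.commute)
    then have "(\<bar>G\<bar> + C') * t\<^sup>2 \<le> c * \<bar>t\<bar> powr (\<mu> - 2) * t\<^sup>2" by (intro mult_right_mono) auto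
    also have "\<bar>t\<bar> powr (\<mu> - 2) * t\<^sup>2 = \<bar>t\<bar> powr \<mu>"
    proof -
      have "t\<^sup>2 = \<bar>t\<bar> powr 2" using t by (simp add: powr_numeral)
      then show ?thesis using powr_add[of "\<bar>t\<bar>" "\<mu> - 2" 2] by simp
    qed
    then have "c * \<bar>t\<bar> powr (\<mu> - 2) * t\<^sup>2 = c * \<bar>t\<bar> powr \<mu>" by (simp add: mult.assoc)
    finally have "\<bar>G\<bar> * t\<^sup>2 + C' * t\<^sup>2 \<le> c * \<bar>t\<bar> powr \<mu>" by (simp add: distrib_right)
    moreover have "C' * 1 \<le> C' * t\<^sup>2" using \<open>t\<^sup>2 \<ge> 1\<close> C'_pos by (intro mult_left_mono) auto
    moreover have "G * t\<^sup>2 \<le> \<bar>G\<bar> * t\<^sup>2" by (intro mult_right_mono) auto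
    ultimately show ?thesis using superlinear[OF that(1), of t] by linarith
  qed
  then show ?thesis by (intro exI[of _ T]) (auto simp: T_def)
qed

lemma x_le: "j \<le> k \<Longrightarrow> k \<le> Suc m \<Longrightarrow> x j \<le> x k"
  using partition_mono[of m x j k] x_step by blast

lemma x_range: "j \<le> Suc m \<Longrightarrow> 0 \<le> x j \<and> x j \<le> 1"
  using x_le[of 0 j] x_le[of j "Suc m"] x_0 x_last by simp

section \<open>Velocities after the nodes and bounds uniform in the delay\<close>

abbreviation "u_del d p \<equiv> delayed_solution d p"
abbreviation "w_del d p \<equiv> lag d (u_del d p)"
abbreviation "v_del d p \<equiv> vel p (w_del d p)"

text \<open>The sum includes the impulse at \<open>x j\<close> itself, which \<open>vel\<close> at
  \<open>x j\<close> does not yet count. For j = 0 the value is the initial slope.\<close>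

definition node_vel :: "real \<Rightarrow> real \<Rightarrow> nat \<Rightarrow> real" where
  "node_vel d p j = p - integral {0..x j} (\<lambda>t. f t (w_del d p t)) - (\<Sum>i=1..j. \<iota> i (w_del d p (x i)))"

lemma w_del_continuous: "d > 0 \<Longrightarrow> continuous_on {0..1} (w_del d p)"
  by (intro lag_continuous delayed_solution_continuous) auto

text \<open>The interval is half-open because the velocity is left-continuous: at \<open>x j\<close>
  it still has its value before the jump, at \<open>x (Suc j)\<close> it has not yet jumped.\<close>

lemma v_del_eq:
  assumes "d > 0" "j \<le> m" "y \<in> {x j<..x (Suc j)}"
  shows "v_del d p y = node_vel d p j - integral {x j..y} (\<lambda>t. f t (w_del d p t))"
proof -
  have "(\<Sum>i=1..m. if x i < y then \<iota> i (w_del d p (x i)) else 0) = (\<Sum>i=1..j. \<iota> i (w_del d p (x i)))"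
  proof (rule sum.mono_neutral_cong_right)
    show "\<forall>i\<in>{1..m} - {1..j}. (if x i < y then \<iota> i (w_del d p (x i)) else 0) = 0"
    proof
      fix i assume "i \<in> {1..m} - {1..j}"
      then have "x (Suc j) \<le> x i" by (intro x_le) auto
      then show "(if x i < y then \<iota> i (w_del d p (x i)) else 0) = 0" using assms by auto
    qed
    show "(if x i < y then \<iota> i (w_del d p (x i)) else 0) = \<iota> i (w_del d p (x i))" if "i \<in> {1..j}" for i
    proof -
      have "x i \<le> x j" using that assms by (intro x_le) auto
      then show ?thesis using assms by auto
    qed
  qed (use assms in auto)
  moreover have "integral {0..y} (\<lambda>t. f t (w_del d p t)) - integral {0..x j} (\<lambda>t. f t (w_del d p t))
      = integral {x j..y} (\<lambda>t. f t (w_del d p t))"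
    using assms x_range[of j] x_range[of "Suc j"]
    by (intro integral_diff_endpoints[of _ 0 1] nemytskii_integrable w_del_continuous) auto
  ultimately show ?thesis unfolding vel_def node_vel_def by simp
qed

lemma node_vel_Suc:
  assumes "d > 0" "j \<le> m"
  shows "node_vel d p (Suc j) = v_del d p (x (Suc j)) - \<iota> (Suc j) (w_del d p (x (Suc j)))"
proof -
  have "integral {0..x (Suc j)} (\<lambda>t. f t (w_del d p t)) - integral {0..x j} (\<lambda>t. f t (w_del d p t))
      = integral {x j..x (Suc j)} (\<lambda>t. f t (w_del d p t))"
    using assms x_range[of j] x_range[of "Suc j"] x_step[of j]
    by (intro integral_diff_endpoints[of _ 0 1] nemytskii_integrable w_del_continuous) auto
  then show ?thesis
    using v_del_eq[OF assms, of "x (Suc j)" p] x_step[OF assms(2)] by (simp add: node_vel_def)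
qed

lemma u_del_eq:
  assumes "d > 0" "j \<le> m" "y \<in> {x j..x (Suc j)}"
  shows "u_del d p y = u_del d p (x j)
    + integral {x j..y} (\<lambda>y. node_vel d p j - integral {x j..y} (\<lambda>t. f t (w_del d p t)))"
proof -
  have "u_del d p y - u_del d p (x j) = integral {x j..y} (v_del d p)"
    using assms x_range[of j] x_range[of "Suc j"] delayed_solution_eq[OF assms(1), of y p] delayed_solution_eq[OF assms(1), of "x j" p]
      integral_diff_endpoints[OF vel_integrable[OF w_del_continuous[OF assms(1)], of 0 1 p p], of "x j" y]
    unfolding pos_def by simp
  also have "\<dots> = integral {x j..y} (\<lambda>y. node_vel d p j - integral {x j..y} (\<lambda>t. f t (w_del d p t)))"
    \<comment> \<open>The actual velocity and its continuous extension to the left endpoint differ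
      at \<open>x j\<close> only.\<close>
    using assms by (intro integral_spike[of "{x j}"]) (auto simp: v_del_eq)
  finally show ?thesis by simp
qed

text \<open>\<open>interval_bound\<close> applies because the delayed argument either falls before
  the node, where \<open>P\<close> bounds the position, or refers to an earlier time in the current
  interval. The resulting constants are independent of the delay.\<close>

lemma interval_estimate:
  assumes "d > 0" "j \<le> m" "P \<ge> 0" "\<And>t. t \<in> {0..x j} \<Longrightarrow> \<bar>u_del d p t\<bar> \<le> P"
    and y: "y \<in> {x j..x (Suc j)}"
  shows "\<bar>u_del d p y\<bar> \<le> 2 * (P + \<bar>node_vel d p j\<bar> + L * P + D0) * exp (2 * (L + 1))"
    and "y \<noteq> x j \<Longrightarrow> \<bar>v_del d p y\<bar> \<le> 2 * (P + \<bar>node_vel d p j\<bar> + L * P + D0) * exp (2 * (L + 1))"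
proof -
  have xs: "0 \<le> x j" "x j < x (Suc j)" "x (Suc j) \<le> 1"
    using assms(2) x_range[of j] x_range[of "Suc j"] x_step[of j] by auto
  let ?v = "\<lambda>y. node_vel d p j - integral {x j..y} (\<lambda>t. f t (w_del d p t))"
  have "\<bar>u_del d p y\<bar> + \<bar>?v y\<bar> \<le> 2 * (\<bar>u_del d p (x j)\<bar> + \<bar>node_vel d p j\<bar> + L * P + D0) * exp (2 * (L + 1))"
  proof (rule interval_bound[where u = "u_del d p" and v = ?v and a = "x j" and b = "x (Suc j)" and t = y
        and F = "\<lambda>t. f t (w_del d p t)" and W = "\<lambda>t. \<bar>w_del d p t\<bar>"])
    show "(\<lambda>t. f t (w_del d p t)) integrable_on {x j..x (Suc j)}"
      using xs by (intro nemytskii_integrable w_del_continuous assms(1)) auto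
    show "u_del d p t = u_del d p (x j) + integral {x j..t} ?v" if "t \<in> {x j..x (Suc j)}" for t
      by (rule u_del_eq[OF assms(1,2) that])
    show "\<bar>f s (w_del d p s)\<bar> \<le> L * \<bar>w_del d p s\<bar> + D0" if "s \<in> {x j<..<x (Suc j)}" for s
      using that xs by (intro f_growth) auto
    show "\<bar>w_del d p s\<bar> \<le> P \<or> (\<exists>s'\<in>{x j..s}. \<bar>w_del d p s\<bar> \<le> \<bar>u_del d p s'\<bar>)" if "s \<in> {x j<..<x (Suc j)}" for s
    proof (cases "max 0 (s - d) \<le> x j")
      case True
      then show ?thesis using assms(4)[of "max 0 (s - d)"] by (simp add: lag_def)
    next
      case False
      then have "max 0 (s - d) \<in> {x j..s}" using assms(1) that xs by auto
      then show ?thesis unfolding lag_def by blast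
    qed
  qed (use assms xs L_nonneg D0_nonneg in auto)
  also have "\<dots> \<le> 2 * (P + \<bar>node_vel d p j\<bar> + L * P + D0) * exp (2 * (L + 1))"
    using assms(4)[of "x j"] xs by (intro mult_right_mono mult_left_mono add_mono) auto
  finally have *: "\<bar>u_del d p y\<bar> + \<bar>?v y\<bar> \<le> 2 * (P + \<bar>node_vel d p j\<bar> + L * P + D0) * exp (2 * (L + 1))" .
  then show "\<bar>u_del d p y\<bar> \<le> 2 * (P + \<bar>node_vel d p j\<bar> + L * P + D0) * exp (2 * (L + 1))" by linarith
  show "\<bar>v_del d p y\<bar> \<le> 2 * (P + \<bar>node_vel d p j\<bar> + L * P + D0) * exp (2 * (L + 1))" if "y \<noteq> x j"
    using * v_del_eq[OF assms(1,2), of y p] y that by auto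
qed

lemma bound_step:
  assumes "j \<le> m" "B \<ge> 0"
  obtains B' where "B' \<ge> 0" "\<And>d p t. d > 0 \<Longrightarrow> (\<And>t. t \<in> {0..x j} \<Longrightarrow> \<bar>u_del d p t\<bar> \<le> B \<and> \<bar>v_del d p t\<bar> \<le> B) \<Longrightarrow>
    \<bar>node_vel d p j\<bar> \<le> B \<Longrightarrow> t \<in> {0..x (Suc j)} \<Longrightarrow> \<bar>u_del d p t\<bar> \<le> B' \<and> \<bar>v_del d p t\<bar> \<le> B'"
proof
  let ?B = "2 * (B + B + L * B + D0) * exp (2 * (L + 1))"
  have "?B \<ge> 0" using assms L_nonneg D0_nonneg by simp
  then show "max B ?B \<ge> 0" by simp
  fix d p t
  assume d: "d > 0" and past: "\<And>t. t \<in> {0..x j} \<Longrightarrow> \<bar>u_del d p t\<bar> \<le> B \<and> \<bar>v_del d p t\<bar> \<le> B"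
    and Q: "\<bar>node_vel d p j\<bar> \<le> B" and t: "t \<in> {0..x (Suc j)}"
  show "\<bar>u_del d p t\<bar> \<le> max B ?B \<and> \<bar>v_del d p t\<bar> \<le> max B ?B"
  proof (cases "t \<le> x j")
    case True
    then show ?thesis using past[of t] t by auto
  next
    case False
    have le: "2 * (B + \<bar>node_vel d p j\<bar> + L * B + D0) * exp (2 * (L + 1)) \<le> ?B"
      using Q by (intro mult_right_mono) auto
    have "t \<in> {x j..x (Suc j)}" "t \<noteq> x j" using t False by auto
    then have "\<bar>u_del d p t\<bar> \<le> ?B" "\<bar>v_del d p t\<bar> \<le> ?B"
      using order_trans[OF interval_estimate(1)[OF d assms] le] order_trans[OF interval_estimate(2)[OF d assms] le] past
      by blast+
    then show ?thesis by auto
  qed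
qed

text \<open>Between nodes the growth of \<open>f\<close> is linear. At a node the position is
  already bounded, so continuity bounds the impulse however fast it grows; finitely many nodes cause
  finitely many enlargements of the bound.\<close>

lemma a_priori_bound_node:
  "j \<le> m \<Longrightarrow> \<exists>B\<ge>0. \<forall>d p. d > 0 \<longrightarrow> \<bar>p\<bar> \<le> R \<longrightarrow>
     (\<forall>t\<in>{0..x j}. \<bar>u_del d p t\<bar> \<le> B \<and> \<bar>v_del d p t\<bar> \<le> B) \<and> \<bar>node_vel d p j\<bar> \<le> B"
proof (induction j)
  case 0
  show ?case
  proof (intro exI[of _ "max 0 R"] conjI allI impI ballI)
    fix d p t :: real assume *: "d > 0" "\<bar>p\<bar> \<le> R"
    assume "t \<in> {0..x 0}"
    then show "\<bar>u_del d p t\<bar> \<le> max 0 R" "\<bar>v_del d p t\<bar> \<le> max 0 R"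
      using * x_0 vel_0[of p "w_del d p"] delayed_solution_0[OF *(1), of p] by auto
  qed (auto simp: node_vel_def x_0)
next
  case (Suc j)
  then obtain B where B: "B \<ge> 0" "\<And>d p t. d > 0 \<Longrightarrow> \<bar>p\<bar> \<le> R \<Longrightarrow> t \<in> {0..x j} \<Longrightarrow> \<bar>u_del d p t\<bar> \<le> B \<and> \<bar>v_del d p t\<bar> \<le> B"
    "\<And>d p. d > 0 \<Longrightarrow> \<bar>p\<bar> \<le> R \<Longrightarrow> \<bar>node_vel d p j\<bar> \<le> B"
    using Suc_leD by blast
  obtain B' where B': "B' \<ge> 0" "\<And>d p t. d > 0 \<Longrightarrow> (\<And>t. t \<in> {0..x j} \<Longrightarrow> \<bar>u_del d p t\<bar> \<le> B \<and> \<bar>v_del d p t\<bar> \<le> B) \<Longrightarrow>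
    \<bar>node_vel d p j\<bar> \<le> B \<Longrightarrow> t \<in> {0..x (Suc j)} \<Longrightarrow> \<bar>u_del d p t\<bar> \<le> B' \<and> \<bar>v_del d p t\<bar> \<le> B'"
    using bound_step[of j B] Suc.prems B(1) by (metis Suc_leD)
  have uv: "\<bar>u_del d p t\<bar> \<le> B' \<and> \<bar>v_del d p t\<bar> \<le> B'" if "d > 0" "\<bar>p\<bar> \<le> R" "t \<in> {0..x (Suc j)}" for d p t
    by (rule B'(2)[OF that(1) B(2)[OF that(1,2)] B(3)[OF that(1,2)] that(3)])
  obtain J where J: "J \<ge> 0" "\<And>j t. j \<in> {1..m} \<Longrightarrow> \<bar>t\<bar> \<le> B' \<Longrightarrow> \<bar>\<iota> j t\<bar> \<le> J" using impulse_bounded[of B'] by blast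
  have "\<bar>node_vel d p (Suc j)\<bar> \<le> B' + J" if "d > 0" "\<bar>p\<bar> \<le> R" for d p
  proof -
    have x: "x (Suc j) \<ge> 0" using x_range Suc.prems by auto
    have "\<bar>w_del d p (x (Suc j))\<bar> \<le> B'" unfolding lag_def using uv[OF that, of "max 0 (x (Suc j) - d)"] that x by auto
    then have "\<bar>\<iota> (Suc j) (w_del d p (x (Suc j)))\<bar> \<le> J" using Suc.prems by (intro J) auto
    moreover have "\<bar>v_del d p (x (Suc j))\<bar> \<le> B'" using uv[OF that, of "x (Suc j)"] x by auto
    ultimately show ?thesis using node_vel_Suc[OF that(1), of j p] Suc.prems by simp
  qed
  then show ?case using uv B'(1) J(1)
    by (intro exI[of _ "B' + J"]) force
qed

lemma a_priori_bound:
  "\<exists>B. \<forall>d p. d > 0 \<longrightarrow> \<bar>p\<bar> \<le> R \<longrightarrow> (\<forall>t\<in>{0..1}. \<bar>u_del d p t\<bar> \<le> B \<and> \<bar>v_del d p t\<bar> \<le> B)"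
proof -
  obtain B where B: "B \<ge> 0" "\<And>d p t. d > 0 \<Longrightarrow> \<bar>p\<bar> \<le> R \<Longrightarrow> t \<in> {0..x m} \<Longrightarrow> \<bar>u_del d p t\<bar> \<le> B \<and> \<bar>v_del d p t\<bar> \<le> B"
    "\<And>d p. d > 0 \<Longrightarrow> \<bar>p\<bar> \<le> R \<Longrightarrow> \<bar>node_vel d p m\<bar> \<le> B"
    using a_priori_bound_node[of m R] by blast
  obtain B' where B': "B' \<ge> 0" "\<And>d p t. d > 0 \<Longrightarrow> (\<And>t. t \<in> {0..x m} \<Longrightarrow> \<bar>u_del d p t\<bar> \<le> B \<and> \<bar>v_del d p t\<bar> \<le> B) \<Longrightarrow>
    \<bar>node_vel d p m\<bar> \<le> B \<Longrightarrow> t \<in> {0..x (Suc m)} \<Longrightarrow> \<bar>u_del d p t\<bar> \<le> B' \<and> \<bar>v_del d p t\<bar> \<le> B'"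
    using bound_step[of m B] B(1) by (metis order_refl)
  have "\<bar>u_del d p t\<bar> \<le> B' \<and> \<bar>v_del d p t\<bar> \<le> B'" if "d > 0" "\<bar>p\<bar> \<le> R" "t \<in> {0..1}" for d p t
    using B'(2)[OF that(1) B(2)[OF that(1,2)] B(3)[OF that(1,2)], of t] that(3) x_last by simp
  then show ?thesis by blast
qed

text \<open>The product filter lets delay and slope vary independently: an eventual property
  provides a threshold for d and one for |p| that do not depend on each other.
  \<open>at_infinity\<close> covers both signs of the slope.\<close>

abbreviation shooting_filter :: "(real \<times> real) filter" where
  "shooting_filter \<equiv> at_right 0 \<times>\<^sub>F at_infinity"

lemma eventually_delay_pos: "\<forall>\<^sub>F (d, p) in shooting_filter. d > 0"
proof -
  have "\<forall>\<^sub>F z in shooting_filter. fst z > (0::real)"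
    using filterlim_fst[of "at_right (0::real)" "at_infinity :: real filter"] eventually_at_right_less[of "0::real"]
    unfolding filterlim_iff by blast
  then show ?thesis by (simp add: case_prod_unfold)
qed

lemma eventually_delay_less: "\<epsilon> > 0 \<Longrightarrow> \<forall>\<^sub>F (d, p) in shooting_filter. d < \<epsilon>"
proof -
  assume "\<epsilon> > 0"
  then have "\<forall>\<^sub>F d in at_right (0::real). d < \<epsilon>" unfolding eventually_at_right_field by blast
  then have "\<forall>\<^sub>F z in shooting_filter. fst z < \<epsilon>"
    using filterlim_fst[of "at_right (0::real)" "at_infinity :: real filter"]
    unfolding filterlim_iff by blast
  then show ?thesis by (simp add: case_prod_unfold)
qed

lemma filterlim_slope: "filterlim (\<lambda>(d, p). \<bar>p\<bar>) at_top shooting_filter"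
proof -
  have "filterlim (\<lambda>z::real \<times> real. norm (snd z)) at_top shooting_filter"
    by (rule filterlim_compose[OF filterlim_norm_at_top filterlim_snd])
  then show ?thesis by (simp add: case_prod_unfold)
qed

text \<open>After the node \<open>x\<^sub>j\<close> the solution is dominated by its velocity \<open>Q\<close> there: all past
  positions are \<open>o(Q)\<close>, and \<open>Q\<close> tends to infinity with a sign determined by that of the initial velocity.\<close>

definition velocity_dominates :: "nat \<Rightarrow> bool" where
  "velocity_dominates j \<longleftrightarrow>
     filterlim (\<lambda>(d, p). \<bar>node_vel d p j\<bar>) at_top shooting_filter \<and>
     (\<forall>\<epsilon>>0. \<forall>\<^sub>F (d, p) in shooting_filter. \<forall>t\<in>{0..x j}. \<bar>u_del d p t\<bar> \<le> \<epsilon> * \<bar>node_vel d p j\<bar>) \<and>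
     (\<forall>\<^sub>F (d, p) in shooting_filter. \<forall>t\<in>{0..x j}. \<bar>v_del d p t\<bar> \<le> \<bar>node_vel d p j\<bar>) \<and>
     (\<exists>\<sigma>. \<forall>\<^sub>F (d, p) in shooting_filter. \<sigma> * p * node_vel d p j > 0)"

text \<open>The factor s is the fundamental solution at the interval's length, nonzero by
  nonresonance. The deviation from s Q has three sources, each an arbitrarily small multiple of |Q|:
  the position at the left node, the sublinear part of \<open>f\<close>, and the displacement of at
  most d K |Q| due to the delay.\<close>

lemma interval_asymptotics:
  assumes j: "j \<le> m" and dom: "velocity_dominates j"
  obtains K s where "K \<ge> 1" "s \<noteq> 0"
    "\<forall>\<^sub>F (d, p) in shooting_filter. \<forall>t\<in>{0..x (Suc j)}.
       \<bar>u_del d p t\<bar> \<le> K * \<bar>node_vel d p j\<bar> \<and> \<bar>v_del d p t\<bar> \<le> K * \<bar>node_vel d p j\<bar>"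
    "\<And>\<epsilon>. \<epsilon> > 0 \<Longrightarrow> \<forall>\<^sub>F (d, p) in shooting_filter.
       \<bar>u_del d p (x (Suc j)) - s * node_vel d p j\<bar> \<le> \<epsilon> * \<bar>node_vel d p j\<bar> \<and>
       \<bar>w_del d p (x (Suc j)) - s * node_vel d p j\<bar> \<le> \<epsilon> * \<bar>node_vel d p j\<bar>"
proof -
  let ?Q = "\<lambda>d p. node_vel d p j"
  have xs: "0 \<le> x j" "x j < x (Suc j)" "x (Suc j) \<le> 1"
    using j x_range[of j] x_range[of "Suc j"] x_step[of j] by auto
  have large: "\<forall>\<^sub>F (d, p) in shooting_filter. P \<bar>?Q d p\<bar>" if "\<forall>\<^sub>F q in at_top. P q" for P
    using dom that unfolding velocity_dominates_def filterlim_iff by (auto simp: case_prod_unfold)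
  have small: "\<forall>\<^sub>F (d, p) in shooting_filter. \<forall>t\<in>{0..x j}. \<bar>u_del d p t\<bar> \<le> \<epsilon> * \<bar>?Q d p\<bar>" if "\<epsilon> > 0" for \<epsilon>
    using dom that unfolding velocity_dominates_def by blast
  have past_v: "\<forall>\<^sub>F (d, p) in shooting_filter. \<forall>t\<in>{0..x j}. \<bar>v_del d p t\<bar> \<le> \<bar>?Q d p\<bar>"
    using dom unfolding velocity_dominates_def by blast
  \<comment> \<open>This is the constant of \<open>interval_estimate\<close> when the past positions
    are bounded by |Q| and |Q| >= 1, so that D0 <= D0 |Q|.\<close>
  define K where "K = 2 * (2 + L + D0) * exp (2 * (L + 1))"
  have K: "K \<ge> 1"
  proof -
    have "1 * 1 \<le> (2 * (2 + L + D0)) * exp (2 * (L + 1))"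
      using L_nonneg D0_nonneg by (intro mult_mono) auto
    then show ?thesis by (simp add: K_def)
  qed
  obtain S S' where S: "\<And>t. (S has_real_derivative S' t) (at t)"
    "\<And>t. (S' has_real_derivative - a (Suc j) * S t) (at t)" "S 0 = 0" "S' 0 = 1"
    "\<And>l. l > 0 \<Longrightarrow> S l = 0 \<Longrightarrow> \<exists>k::nat. k \<ge> 1 \<and> a (Suc j) = (real k)\<^sup>2 * pi\<^sup>2 / l\<^sup>2"
    using fundamental_solution[of "a (Suc j)"] by metis
  define s where "s = S (x (Suc j) - x j)"
  have "s \<noteq> 0"
    using S(5)[of "x (Suc j) - x j"] nonresonant[OF j] xs unfolding s_def dirichlet_spectrum_def by auto
  have KQ: "\<forall>\<^sub>F (d, p) in shooting_filter. \<forall>t\<in>{0..x (Suc j)}.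
       \<bar>u_del d p t\<bar> \<le> K * \<bar>?Q d p\<bar> \<and> \<bar>v_del d p t\<bar> \<le> K * \<bar>?Q d p\<bar>"
    using eventually_delay_pos small[of 1, simplified] past_v large[OF eventually_ge_at_top[of 1]]
  proof eventually_elim
    case (elim z)
    obtain d p where z: "z = (d, p)" by (cases z)
    have *: "d > 0" "\<forall>t\<in>{0..x j}. \<bar>u_del d p t\<bar> \<le> \<bar>?Q d p\<bar>" "\<forall>t\<in>{0..x j}. \<bar>v_del d p t\<bar> \<le> \<bar>?Q d p\<bar>" "\<bar>?Q d p\<bar> \<ge> 1"
      using elim unfolding z prod.case by blast+
    have QK: "\<bar>?Q d p\<bar> \<le> K * \<bar>?Q d p\<bar>" using mult_right_mono[OF K, of "\<bar>?Q d p\<bar>"] by simp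
    have le: "2 * (\<bar>?Q d p\<bar> + \<bar>?Q d p\<bar> + L * \<bar>?Q d p\<bar> + D0) * exp (2 * (L + 1)) \<le> K * \<bar>?Q d p\<bar>"
    proof -
      have "D0 * 1 \<le> D0 * \<bar>?Q d p\<bar>" using *(4) D0_nonneg by (intro mult_left_mono)
      then have "2 * (\<bar>?Q d p\<bar> + \<bar>?Q d p\<bar> + L * \<bar>?Q d p\<bar> + D0) * exp (2 * (L + 1))
          \<le> 2 * (\<bar>?Q d p\<bar> + \<bar>?Q d p\<bar> + L * \<bar>?Q d p\<bar> + D0 * \<bar>?Q d p\<bar>) * exp (2 * (L + 1))"
        by (intro mult_right_mono) auto
      also have "\<dots> = K * \<bar>?Q d p\<bar>" by (simp add: K_def algebra_simps)
      finally show ?thesis .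
    qed
    have "\<bar>u_del d p t\<bar> \<le> K * \<bar>?Q d p\<bar> \<and> \<bar>v_del d p t\<bar> \<le> K * \<bar>?Q d p\<bar>" if t: "t \<in> {0..x (Suc j)}" for t
    proof (cases "t \<le> x j")
      case True
      then have "t \<in> {0..x j}" using t by simp
      then show ?thesis using *(2,3) QK by (meson order_trans)
    next
      case False
      then have "t \<in> {x j..x (Suc j)}" "t \<noteq> x j" using t by auto
      moreover have "\<And>t. t \<in> {0..x j} \<Longrightarrow> \<bar>u_del d p t\<bar> \<le> \<bar>?Q d p\<bar>" using *(2) by blast
      ultimately show ?thesis
        using order_trans[OF interval_estimate(1)[OF *(1) j abs_ge_zero] le]
          order_trans[OF interval_estimate(2)[OF *(1) j abs_ge_zero] le] by blast
    qed
    then show ?case by (simp add: z)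
  qed
  have "\<forall>\<^sub>F (d, p) in shooting_filter.
       \<bar>u_del d p (x (Suc j)) - s * ?Q d p\<bar> \<le> \<epsilon> * \<bar>?Q d p\<bar> \<and>
       \<bar>w_del d p (x (Suc j)) - s * ?Q d p\<bar> \<le> \<epsilon> * \<bar>?Q d p\<bar>" if \<epsilon>: "\<epsilon> > 0" for \<epsilon>
  proof -
    let ?a = "\<bar>a (Suc j)\<bar>"
    define k where "k = exp (2 * (?a + 1))"
    have k: "k \<ge> 1" by (simp add: k_def)
    \<comment> \<open>The initial position contributes \<delta>, the sublinear part \<delta> and the
      delay in the linear term \<delta>; \<open>interval_shooting_error\<close> multiplies the sum
      by 2 k, giving \<epsilon>/2. The other half is reserved for passing from u to its delayed
      value.\<close>
    define \<delta> where "\<delta> = \<epsilon> / (12 * k)"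
    have \<delta>: "\<delta> > 0" using \<epsilon> k by (simp add: \<delta>_def)
    \<comment> \<open>The first entry keeps the delay error in the linear term below \<delta> |Q|,
      the second keeps the displacement d K |Q| itself below (\<epsilon>/2) |Q|.\<close>
    define d0 where "d0 = min (\<delta> / (K * (?a + 1))) (\<epsilon> / (2 * K))"
    have "K > 0" using K by linarith
    then have Ka: "K * (?a + 1) > 0" by (intro mult_pos_pos) auto
    have d0: "d0 > 0"
      unfolding d0_def min_less_iff_conj using \<delta> \<epsilon> Ka \<open>K > 0\<close> by (intro conjI divide_pos_pos) auto
    show ?thesis
      using eventually_delay_pos eventually_delay_less[OF d0] small[OF \<delta>] KQ
        large[OF eventually_sublinear[OF r_gt r_lt \<delta> \<open>K > 0\<close>, of C]]
    proof eventually_elim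
      case (elim z)
      obtain d p where z: "z = (d, p)" by (cases z)
      let ?q = "\<bar>?Q d p\<bar>"
      have d: "d > 0" "d < d0" and past: "\<And>t. t \<in> {0..x j} \<Longrightarrow> \<bar>u_del d p t\<bar> \<le> \<delta> * ?q"
        and uK: "\<And>t. t \<in> {0..x (Suc j)} \<Longrightarrow> \<bar>u_del d p t\<bar> \<le> K * ?q"
        and vK: "\<And>t. t \<in> {0..x (Suc j)} \<Longrightarrow> \<bar>v_del d p t\<bar> \<le> K * ?q"
        and sub: "C * ((K * ?q) powr (r - 1) + 1) \<le> \<delta> * ?q"
        using elim unfolding z prod.case by blast+
      have lagdiff: "\<bar>w_del d p t - u_del d p t\<bar> \<le> d * K * ?q" if t: "t \<in> {0..x (Suc j)}" for t
      proof -
        have "\<bar>u_del d p t - u_del d p (max 0 (t - d))\<bar> \<le> K * ?q * (t - max 0 (t - d))"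
          using t xs d by (intro delayed_solution_lipschitz[of d _ t "x (Suc j)" p]) (auto intro: vK)
        also have "\<dots> \<le> K * ?q * d" using t d K by (intro mult_left_mono) auto
        finally show ?thesis unfolding lag_def by (simp add: abs_minus_commute mult.assoc mult.commute mult.left_commute)
      qed
      have "d * K * (?a + 1) \<le> \<delta>"
      proof -
        have "d \<le> \<delta> / (K * (?a + 1))" using d by (simp add: d0_def)
        then show ?thesis using Ka by (simp add: pos_le_divide_eq mult.assoc)
      qed
      then have adK: "?a * (d * K) \<le> \<delta>"
        using mult_pos_pos[OF d(1) \<open>K > 0\<close>] by (simp add: algebra_simps)
      have "d \<le> \<epsilon> / (2 * K)" using d by (simp add: d0_def)
      then have dK: "d * K \<le> \<epsilon> / 2" using K by (simp add: pos_le_divide_eq mult.commute mult.left_commute)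
      have F_le: "\<bar>f y (w_del d p y) - a (Suc j) * u_del d p y\<bar> \<le> 2 * \<delta> * ?q" if y: "y \<in> {x j<..<x (Suc j)}" for y
      proof -
        have y': "y \<in> {0..x (Suc j)}" using y xs by auto
        have "\<bar>w_del d p y\<bar> \<le> K * ?q" unfolding lag_def using y' d by (intro uK) auto
        then have "C * (\<bar>w_del d p y\<bar> powr (r - 1) + 1) \<le> C * ((K * ?q) powr (r - 1) + 1)"
          using C_pos r_gt by (intro mult_left_mono add_right_mono powr_mono2) auto
        then have 1: "\<bar>f y (w_del d p y) - a (Suc j) * w_del d p y\<bar> \<le> \<delta> * ?q"
          using f_linear_part[OF j y, of "w_del d p y"] sub by linarith
        have "\<bar>a (Suc j) * (w_del d p y - u_del d p y)\<bar> \<le> ?a * (d * K * ?q)"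
          unfolding abs_mult using lagdiff[OF y'] by (intro mult_left_mono) auto
        also have "\<dots> \<le> \<delta> * ?q" using mult_right_mono[OF adK, of ?q] by (simp add: mult.assoc)
        finally have 2: "\<bar>a (Suc j) * w_del d p y - a (Suc j) * u_del d p y\<bar> \<le> \<delta> * ?q"
          by (simp add: right_diff_distrib)
        show ?thesis using 1 2 by linarith
      qed
      let ?v = "\<lambda>y. ?Q d p - integral {x j..y} (\<lambda>t. f t (w_del d p t))"
      have "\<bar>u_del d p (x (Suc j)) - ?Q d p * S (x (Suc j) - x j)\<bar> \<le> 2 * (\<bar>u_del d p (x j)\<bar> + 2 * \<delta> * ?q) * exp (2 * (?a + 1))"
      proof (rule interval_shooting_error[where v = ?v and F = "\<lambda>t. f t (w_del d p t)" and b = "x (Suc j)", OF _ _ _ _ _ _ _ S(1-4)])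
        show "(\<lambda>t. f t (w_del d p t)) integrable_on {x j..x (Suc j)}"
          using xs by (intro nemytskii_integrable w_del_continuous d(1)) auto
        show "u_del d p t = u_del d p (x j) + integral {x j..t} ?v" if "t \<in> {x j..x (Suc j)}" for t
          by (rule u_del_eq[OF d(1) j that])
      qed (use F_le xs \<delta> in auto)
      also have "\<dots> \<le> 2 * (\<delta> * ?q + 2 * \<delta> * ?q) * k"
        unfolding k_def using past[of "x j"] xs by (intro mult_right_mono mult_left_mono add_right_mono) auto
      also have "\<dots> = \<epsilon> / 2 * ?q" using k by (simp add: \<delta>_def field_simps)
      finally have u: "\<bar>u_del d p (x (Suc j)) - s * ?Q d p\<bar> \<le> \<epsilon> / 2 * ?q" by (simp add: s_def mult.commute)
      have "d * K * ?q \<le> \<epsilon> / 2 * ?q" using dK by (rule mult_right_mono) simp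
      then have "\<bar>w_del d p (x (Suc j)) - u_del d p (x (Suc j))\<bar> \<le> \<epsilon> / 2 * ?q"
        using lagdiff[of "x (Suc j)"] xs by force
      then have "\<bar>w_del d p (x (Suc j)) - s * ?Q d p\<bar> \<le> \<epsilon> / 2 * ?q + \<epsilon> / 2 * ?q" using u by linarith
      moreover have "\<epsilon> / 2 * ?q \<ge> 0" using \<epsilon> by simp
      ultimately show ?case using u by (simp add: z)
    qed
  qed
  then show ?thesis using that[OF K \<open>s \<noteq> 0\<close> KQ] by blast
qed

lemma same_sign_of_close:
  fixes w s q :: real
  assumes "\<bar>w - s * q\<bar> \<le> \<bar>s\<bar> / 2 * \<bar>q\<bar>" "s \<noteq> 0" "q \<noteq> 0"
  shows "w * (s * q) > 0" "\<bar>w\<bar> \<ge> \<bar>s\<bar> / 2 * \<bar>q\<bar>"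
proof -
  define y where "y = s * q"
  have eq: "\<bar>s\<bar> / 2 * \<bar>q\<bar> = \<bar>y\<bar> / 2" by (simp add: y_def abs_mult)
  have *: "\<bar>w - y\<bar> \<le> \<bar>y\<bar> / 2" "y \<noteq> 0" using assms unfolding eq by (simp_all add: y_def)
  have "y > 0 \<and> w > 0 \<or> y < 0 \<and> w < 0" using * by arith
  then show "w * (s * q) > 0" unfolding y_def[symmetric] by (auto intro: mult_pos_pos mult_neg_neg)
  show "\<bar>w\<bar> \<ge> \<bar>s\<bar> / 2 * \<bar>q\<bar>" unfolding eq using *(1) by arith
qed

lemma velocity_dominates_0: "velocity_dominates 0"
proof -
  have Q: "node_vel d p 0 = p" for d p by (simp add: node_vel_def x_0)
  have u0: "\<forall>\<^sub>F (d, p) in shooting_filter. u_del d p 0 = 0"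
    using eventually_delay_pos by eventually_elim (auto simp: delayed_solution_0)
  have "\<forall>\<^sub>F (d, p) in shooting_filter. \<bar>p\<bar> > 0"
    using filterlim_at_top_dense[THEN iffD1, OF filterlim_slope, rule_format, of 0]
    by (simp add: case_prod_unfold)
  then have "\<forall>\<^sub>F (d, p) in shooting_filter. 1 * p * p > 0"
    by eventually_elim (auto simp: zero_less_mult_iff)
  then have "\<exists>\<sigma>. \<forall>\<^sub>F (d, p) in shooting_filter. \<sigma> * p * p > 0" by blast
  moreover have "\<forall>\<^sub>F (d, p) in shooting_filter. \<bar>u_del d p 0\<bar> \<le> \<epsilon> * \<bar>p\<bar>" if "\<epsilon> > 0" for \<epsilon>
    using u0 by eventually_elim (use that in auto)
  moreover have "\<forall>\<^sub>F (d, p) in shooting_filter. \<bar>v_del d p 0\<bar> \<le> \<bar>p\<bar>"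
    unfolding vel_0 by (simp add: case_prod_unfold)
  moreover have "(\<forall>t\<in>{0..0::real}. P t) \<longleftrightarrow> P 0" for P by auto
  ultimately show ?thesis
    unfolding velocity_dominates_def Q x_0 using filterlim_slope by (simp only:) blast
qed

text \<open>The jump \<open>- \<iota>(u)\<close> is superlinear in \<open>u\<close>, hence much larger than the incoming velocity, and of sign
  opposite to that of \<open>u\<close>.\<close>

lemma velocity_dominates_Suc:
  assumes j: "j < m" and dom: "velocity_dominates j"
  shows "velocity_dominates (Suc j)"
proof -
  let ?Q = "\<lambda>d p. node_vel d p j" and ?Q' = "\<lambda>d p. node_vel d p (Suc j)" and ?w = "\<lambda>d p. w_del d p (x (Suc j))"
  have jm: "j \<le> m" using j by simp
  obtain K s where K: "K \<ge> 1" "s \<noteq> 0" and KQ: "\<forall>\<^sub>F (d, p) in shooting_filter. \<forall>t\<in>{0..x (Suc j)}.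
       \<bar>u_del d p t\<bar> \<le> K * \<bar>?Q d p\<bar> \<and> \<bar>v_del d p t\<bar> \<le> K * \<bar>?Q d p\<bar>"
    and close: "\<And>\<epsilon>. \<epsilon> > 0 \<Longrightarrow> \<forall>\<^sub>F (d, p) in shooting_filter.
       \<bar>u_del d p (x (Suc j)) - s * ?Q d p\<bar> \<le> \<epsilon> * \<bar>?Q d p\<bar> \<and>
       \<bar>?w d p - s * ?Q d p\<bar> \<le> \<epsilon> * \<bar>?Q d p\<bar>"
    using interval_asymptotics[OF jm dom] by blast
  obtain \<sigma> where \<sigma>: "\<forall>\<^sub>F (d, p) in shooting_filter. \<sigma> * p * ?Q d p > 0"
    using dom unfolding velocity_dominates_def by blast
  have Qlim: "filterlim (\<lambda>(d, p). \<bar>?Q d p\<bar>) at_top shooting_filter"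
    using dom unfolding velocity_dominates_def by blast
  have large: "\<forall>\<^sub>F (d, p) in shooting_filter. P \<bar>?Q d p\<bar>" if "\<forall>\<^sub>F q in at_top. P q" for P
    using Qlim that unfolding filterlim_iff by (auto simp: case_prod_unfold)
  have jump: "\<forall>\<^sub>F (d, p) in shooting_filter. H * \<bar>?Q d p\<bar> \<le> \<bar>?Q' d p\<bar> \<and> ?w d p * ?Q' d p < 0 \<and> ?w d p * (s * ?Q d p) > 0"
    if H: "H > 0" for H
  proof -
    \<comment> \<open>The incoming velocity contributes at most (2 K / |s|) w^2 to w Q', and G
      exceeds this coefficient by 2 H / |s|. With |w| >= |s| |Q| / 2 the excess yields |Q'| >= H
      |Q|.\<close>
    define G where "G = (2 * K + 2 * H) / \<bar>s\<bar>"
    obtain T where T: "T > 0" "\<And>t. \<bar>t\<bar> \<ge> T \<Longrightarrow> t * \<iota> (Suc j) t \<ge> G * t\<^sup>2"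
      using impulse_superlinear[of G] j by (metis Suc_leI atLeastAtMost_iff le_add1 plus_1_eq_Suc)
    have "\<bar>s\<bar> / 2 > 0" using K by simp
    from eventually_delay_pos close[OF this] KQ large[OF eventually_ge_at_top[of "2 * T / \<bar>s\<bar>"]] large[OF eventually_gt_at_top[of 0]]
    show ?thesis
    proof eventually_elim
      case (elim z)
      obtain d p where z: "z = (d, p)" by (cases z)
      have d: "d > 0" and cl: "\<bar>?w d p - s * ?Q d p\<bar> \<le> \<bar>s\<bar> / 2 * \<bar>?Q d p\<bar>"
        and q: "\<bar>?Q d p\<bar> \<ge> 2 * T / \<bar>s\<bar>" "?Q d p \<noteq> 0"
        and v: "\<bar>v_del d p (x (Suc j))\<bar> \<le> K * \<bar>?Q d p\<bar>"
        using elim x_range[of "Suc j"] j by (auto simp: z)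
      note sign = same_sign_of_close[OF cl K(2) q(2)]
      define w where "w = ?w d p"
      have qw: "\<bar>?Q d p\<bar> \<le> 2 / \<bar>s\<bar> * \<bar>w\<bar>" using sign(2) K by (simp add: w_def field_simps)
      have "T \<le> \<bar>s\<bar> / 2 * \<bar>?Q d p\<bar>" using q(1) K by (simp add: field_simps)
      then have w: "\<bar>w\<bar> \<ge> T" using sign(2) by (simp add: w_def)
      then have "w \<noteq> 0" using T(1) by auto
      have "w * v_del d p (x (Suc j)) \<le> \<bar>w\<bar> * \<bar>v_del d p (x (Suc j))\<bar>" by (metis abs_ge_self abs_mult)
      also have "\<dots> \<le> \<bar>w\<bar> * (K * (2 / \<bar>s\<bar> * \<bar>w\<bar>))"
        using v mult_left_mono[OF qw, of K] K by (intro mult_left_mono) auto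
      also have "\<dots> = 2 * K / \<bar>s\<bar> * w\<^sup>2" by (simp add: power2_eq_square flip: abs_mult)
      finally have 1: "w * v_del d p (x (Suc j)) \<le> 2 * K / \<bar>s\<bar> * w\<^sup>2" .
      have "w * ?Q' d p = w * v_del d p (x (Suc j)) - w * \<iota> (Suc j) w"
        using node_vel_Suc[OF d jm, of p] by (simp add: w_def right_diff_distrib)
      then have "w * ?Q' d p \<le> 2 * K / \<bar>s\<bar> * w\<^sup>2 - G * w\<^sup>2" using 1 T(2)[OF w] by linarith
      also have "\<dots> = - (2 * H / \<bar>s\<bar> * w\<^sup>2)" by (simp add: G_def add_divide_distrib algebra_simps)
      finally have 2: "w * ?Q' d p \<le> - (2 * H / \<bar>s\<bar> * w\<^sup>2)" .
      have pos: "2 * H / \<bar>s\<bar> * w\<^sup>2 > 0" using H K \<open>w \<noteq> 0\<close> by simp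
      have "2 * H / \<bar>s\<bar> * \<bar>w\<bar> * \<bar>w\<bar> \<le> \<bar>?Q' d p\<bar> * \<bar>w\<bar>"
      proof -
        have "2 * H / \<bar>s\<bar> * \<bar>w\<bar> * \<bar>w\<bar> = 2 * H / \<bar>s\<bar> * w\<^sup>2" by (simp add: power2_eq_square mult.assoc flip: abs_mult)
        also have "\<dots> \<le> \<bar>w * ?Q' d p\<bar>" using 2 by linarith
        finally show ?thesis by (simp add: abs_mult mult.commute)
      qed
      then have "2 * H / \<bar>s\<bar> * \<bar>w\<bar> \<le> \<bar>?Q' d p\<bar>"
        by (rule mult_right_le_imp_le) (use \<open>w \<noteq> 0\<close> in simp)
      moreover have "H * \<bar>?Q d p\<bar> \<le> H * (2 / \<bar>s\<bar> * \<bar>w\<bar>)" using qw H by (intro mult_left_mono) auto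
      ultimately have "H * \<bar>?Q d p\<bar> \<le> \<bar>?Q' d p\<bar>" by (simp add: algebra_simps)
      moreover have "w * ?Q' d p < 0" using 2 pos by linarith
      ultimately show ?case using sign(1) by (simp add: z w_def)
    qed
  qed
  have "filterlim (\<lambda>(d, p). \<bar>?Q' d p\<bar>) at_top shooting_filter"
  proof (rule filterlim_at_top_mono[OF Qlim])
    show "\<forall>\<^sub>F z in shooting_filter. (case z of (d, p) \<Rightarrow> \<bar>?Q d p\<bar>) \<le> (case z of (d, p) \<Rightarrow> \<bar>?Q' d p\<bar>)"
      using jump[of 1] by (auto elim!: eventually_mono)
  qed
  moreover have small: "\<forall>\<^sub>F (d, p) in shooting_filter. \<forall>t\<in>{0..x (Suc j)}. \<bar>u_del d p t\<bar> \<le> \<epsilon> * \<bar>?Q' d p\<bar> \<and> \<bar>v_del d p t\<bar> \<le> \<epsilon> * \<bar>?Q' d p\<bar>"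
    if \<epsilon>: "\<epsilon> > 0" for \<epsilon>
  proof -
    \<comment> \<open>With amplification factor H = K/\<epsilon>, the bound K |Q| on the preceding
      interval turns into \<epsilon> |Q'|.\<close>
    have "K / \<epsilon> > 0" using \<epsilon> K by simp
    from jump[OF this] KQ show ?thesis
    proof eventually_elim
      case (elim z)
      obtain d p where z: "z = (d, p)" by (cases z)
      have "K / \<epsilon> * \<bar>?Q d p\<bar> \<le> \<bar>?Q' d p\<bar>" using elim by (simp add: z)
      then have "K * \<bar>?Q d p\<bar> \<le> \<epsilon> * \<bar>?Q' d p\<bar>" using \<epsilon> by (simp add: field_simps)
      then show ?case using elim(2) by (auto simp: z intro: order_trans)
    qed
  qed
  moreover have "\<forall>\<^sub>F (d, p) in shooting_filter. \<forall>t\<in>{0..x (Suc j)}. \<bar>u_del d p t\<bar> \<le> \<epsilon> * \<bar>?Q' d p\<bar>"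
    if "\<epsilon> > 0" for \<epsilon>
    using small[OF that] by (auto elim!: eventually_mono)
  moreover have "\<forall>\<^sub>F (d, p) in shooting_filter. \<forall>t\<in>{0..x (Suc j)}. \<bar>v_del d p t\<bar> \<le> \<bar>?Q' d p\<bar>"
    using small[of 1] by (auto elim!: eventually_mono)
  moreover have "\<exists>\<sigma>. \<forall>\<^sub>F (d, p) in shooting_filter. \<sigma> * p * ?Q' d p > 0"
  \<comment> \<open>The delayed position w has the sign of s Q, and Q' has the opposite sign. Each
    interval thus multiplies the sign factor by - s.\<close>
  proof (rule exI[of _ "- \<sigma> * s"])
    show "\<forall>\<^sub>F (d, p) in shooting_filter. - \<sigma> * s * p * ?Q' d p > 0"
      using jump[of 1, simplified] \<sigma>
    proof eventually_elim
      case (elim z)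
      obtain d p where z: "z = (d, p)" by (cases z)
      have "?w d p * ?Q' d p < 0" "?w d p * (s * ?Q d p) > 0" "\<sigma> * p * ?Q d p > 0" using elim by (auto simp: z)
      then have "- \<sigma> * s * p * ?Q' d p > 0"
        by (auto simp: zero_less_mult_iff mult_less_0_iff)
      then show ?case by (simp add: z)
    qed
  qed
  ultimately show ?thesis
    unfolding velocity_dominates_def by blast
qed

lemma velocity_dominates: "j \<le> m \<Longrightarrow> velocity_dominates j"
  by (induction j) (auto intro: velocity_dominates_0 velocity_dominates_Suc)

text \<open>On the last interval u(1) is close to s Q, and no impulse follows; hence the sign factor
  \<sigma> of the last node velocity is multiplied by s without a change of sign.\<close>

lemma endpoint_sign:
  obtains \<tau> where "\<forall>\<^sub>F (d, p) in shooting_filter. \<tau> * p * u_del d p 1 > 0"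
proof -
  obtain K :: real and s where K: "K \<ge> 1" "s \<noteq> 0" "\<forall>\<^sub>F (d, p) in shooting_filter. \<forall>t\<in>{0..x (Suc m)}.
       \<bar>u_del d p t\<bar> \<le> K * \<bar>node_vel d p m\<bar> \<and> \<bar>v_del d p t\<bar> \<le> K * \<bar>node_vel d p m\<bar>" and close: "\<And>\<epsilon>. \<epsilon> > 0 \<Longrightarrow> \<forall>\<^sub>F (d, p) in shooting_filter.
       \<bar>u_del d p (x (Suc m)) - s * node_vel d p m\<bar> \<le> \<epsilon> * \<bar>node_vel d p m\<bar> \<and>
       \<bar>w_del d p (x (Suc m)) - s * node_vel d p m\<bar> \<le> \<epsilon> * \<bar>node_vel d p m\<bar>"
    using interval_asymptotics[OF order_refl velocity_dominates[OF order_refl]] by blast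
  obtain \<sigma> where \<sigma>: "\<forall>\<^sub>F (d, p) in shooting_filter. \<sigma> * p * node_vel d p m > 0"
    using velocity_dominates[of m] unfolding velocity_dominates_def by blast
  have "\<bar>s\<bar> / 2 > 0" using K by simp
  from close[OF this] \<sigma> have "\<forall>\<^sub>F (d, p) in shooting_filter. (\<sigma> * s) * p * u_del d p 1 > 0"
  proof eventually_elim
    case (elim z)
    obtain d p where z: "z = (d, p)" by (cases z)
    have *: "\<bar>u_del d p 1 - s * node_vel d p m\<bar> \<le> \<bar>s\<bar> / 2 * \<bar>node_vel d p m\<bar>" "\<sigma> * p * node_vel d p m > 0"
      using elim by (auto simp: z x_last)
    then have "node_vel d p m \<noteq> 0" by auto
    from mult_pos_pos[OF same_sign_of_close(1)[OF *(1) K(2) this] *(2)]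
    have "((\<sigma> * s) * p * u_del d p 1) * (node_vel d p m)\<^sup>2 > 0"
      by (simp add: power2_eq_square mult_ac)
    then have "(\<sigma> * s) * p * u_del d p 1 > 0"
      by (rule zero_less_mult_pos2) (use \<open>node_vel d p m \<noteq> 0\<close> in simp)
    then show ?case by (simp add: z)
  qed
  then show ?thesis using that by blast
qed

text \<open>One R serves for all delays below \<open>d0\<close>: at the slopes R and -R the endpoint
  values have opposite signs, and the endpoint value is continuous in the slope. So every such delay
  has a zero in [-R, R], and the a priori bounds for these slopes allow the delay to vanish.\<close>

theorem exists_shooting_solution:
  "\<exists>p u. continuous_on {0..1} u \<and> u 1 = 0 \<and> (\<forall>y\<in>{0..1}. u y = pos p u y)"
proof -
  obtain \<tau> where "\<forall>\<^sub>F (d, p) in shooting_filter. \<tau> * p * u_del d p 1 > 0" by (rule endpoint_sign)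
  then obtain P1 P2 where P: "eventually P1 (at_right (0::real))" "eventually P2 (at_infinity :: real filter)"
    "\<And>d p. P1 d \<Longrightarrow> P2 p \<Longrightarrow> \<tau> * p * u_del d p 1 > 0"
    unfolding eventually_prod_filter by auto
  obtain d0 where d0: "d0 > 0" "\<And>d. 0 < d \<Longrightarrow> d < d0 \<Longrightarrow> P1 d"
    using P(1) unfolding eventually_at_right_field by blast
  obtain R0 where R0: "\<And>p. \<bar>p\<bar> \<ge> R0 \<Longrightarrow> P2 p" using P(2) unfolding eventually_at_infinity by auto
  define R where "R = max 1 R0"
  have R: "R > 0" "P2 R" "P2 (- R)" using R0 by (auto simp: R_def)
  \<comment> \<open>The shift by 2 keeps the denominator above 1, so that every delay is strictly
    below \<open>d0\<close>.\<close>
  define d where "d n = d0 / real (n + 2)" for n :: nat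
  have d: "0 < d n" "d n < d0" for n
    using d0(1) by (auto simp: d_def divide_less_eq)
  have dlim: "d \<longlonglongrightarrow> 0"
  proof -
    have "(\<lambda>n. d0 / real n) \<longlonglongrightarrow> 0" by (rule lim_const_over_n)
    from LIMSEQ_ignore_initial_segment[OF this, of 2] show ?thesis unfolding d_def .
  qed
  have "\<exists>p. \<bar>p\<bar> \<le> R \<and> u_del (d n) p 1 = 0" for n
  proof -
    have "\<tau> * R * u_del (d n) R 1 > 0" "\<tau> * (- R) * u_del (d n) (- R) 1 > 0"
      using P(3) R d0(2) d by blast+
    then have "0 \<le> \<tau> * u_del (d n) R 1" "\<tau> * u_del (d n) (- R) 1 \<le> 0" "\<tau> \<noteq> 0"
      using R(1) by (auto simp: zero_less_mult_iff mult_less_0_iff mult_le_0_iff zero_le_mult_iff)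
    moreover have "continuous_on {-R..R} (\<lambda>p. \<tau> * u_del (d n) p 1)"
      using d by (intro continuous_intros delayed_solution_continuous_parameter) auto
    ultimately obtain p where "-R \<le> p" "p \<le> R" "\<tau> * u_del (d n) p 1 = 0"
      using IVT'[of "\<lambda>p. \<tau> * u_del (d n) p 1" "-R" 0 R] R(1) by auto
    then show ?thesis using \<open>\<tau> \<noteq> 0\<close> by (intro exI[of _ p]) auto
  qed
  then obtain p where p: "\<And>n. \<bar>p n\<bar> \<le> R" "\<And>n. u_del (d n) (p n) 1 = 0" by metis
  obtain B where "\<forall>d p. d > 0 \<longrightarrow> \<bar>p\<bar> \<le> R \<longrightarrow> (\<forall>t\<in>{0..1}. \<bar>u_del d p t\<bar> \<le> B \<and> \<bar>v_del d p t\<bar> \<le> B)"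
    using a_priori_bound by blast
  then show ?thesis
    using delayed_solution_limit[of d p R B] d dlim p by blast
qed

end

subsection \<open>Weak derivatives\<close>

lemma test_function_deriv: "test_function \<phi> \<Longrightarrow> (\<phi> has_real_derivative deriv \<phi> y) (at y)"
  unfolding test_function_def by (metis field_differentiable_derivI funpow_0)

lemma test_function_continuous: "test_function \<phi> \<Longrightarrow> continuous_on S \<phi>"
  by (meson test_function_deriv DERIV_isCont continuous_at_imp_continuous_on)

lemma test_function_continuous_deriv:
  assumes "test_function \<phi>" shows "continuous_on S (deriv \<phi>)"
proof -
  have "(deriv ^^ 1) \<phi> field_differentiable at y" for y
    using assms unfolding test_function_def by blast
  then show ?thesis
    by (auto intro!: continuous_at_imp_continuous_on field_differentiable_imp_continuous_at)
qed

lemma test_function_eq_0: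
  assumes "test_function \<phi>" "y \<notin> {0<..<1}" shows "\<phi> y = 0"
  using assms unfolding test_function_def by blast

section \<open>Integration and square-integrable functions on the open unit interval\<close>

lemma unit_leb_finite: "finite_measure unit_leb"
  by (rule finite_measure_lebesgue_on) simp

lemma unit_leb_measurable:
  "k \<in> borel_measurable (lebesgue_on {0..1}) \<Longrightarrow> k \<in> borel_measurable unit_leb"
  by (erule measurable_restrict_mono) auto

lemma unit_leb_AE: "(\<And>y. y \<in> {0<..<1} \<Longrightarrow> P y) \<Longrightarrow> AE y in unit_leb. P y"
  by (rule AE_I2) (auto simp: space_restrict_space)

text \<open>This links the Bochner integral over the open interval, used in the definitions, with
  the gauge integral over [0,1], used for the initial value problem.\<close>

lemma unit_integral_bounded:
  fixes k :: "real \<Rightarrow> real"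
  assumes "k \<in> borel_measurable (lebesgue_on {0..1})" "\<And>y. y \<in> {0..1} \<Longrightarrow> \<bar>k y\<bar> \<le> B"
  shows "integrable unit_leb k" "integral\<^sup>L unit_leb k = integral {0..1} k"
proof -
  show *: "integrable unit_leb k"
  proof (rule finite_measure.integrable_const_bound[OF unit_leb_finite, where B = B])
    show "AE y in unit_leb. norm (k y) \<le> B" by (rule unit_leb_AE) (use assms(2) in auto)
  qed (rule unit_leb_measurable[OF assms(1)])
  have "integral\<^sup>L unit_leb k = integral {0<..<1} k"
    by (rule lebesgue_integral_eq_integral[OF *]) simp
  then show "integral\<^sup>L unit_leb k = integral {0..1} k" by (simp add: integral_open_interval_real)
qed

lemma unit_integral_continuous:
  fixes k :: "real \<Rightarrow> real"
  assumes "continuous_on {0..1} k"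
  shows "integrable unit_leb k" "integral\<^sup>L unit_leb k = integral {0..1} k"
proof -
  obtain B where "\<And>y. y \<in> {0..1} \<Longrightarrow> \<bar>k y\<bar> \<le> B" using bounded_on_Icc[OF assms] by blast
  from unit_integral_bounded[OF lebesgue_measurable_continuous[OF assms] this]
  show "integrable unit_leb k" "integral\<^sup>L unit_leb k = integral {0..1} k" by blast+
qed

lemma L2_fun_bounded:
  assumes "k \<in> borel_measurable (lebesgue_on {0..1})" "\<And>y. y \<in> {0..1} \<Longrightarrow> \<bar>k y\<bar> \<le> B"
  shows "L2_fun k"
  unfolding L2_fun_def
proof
  show "k \<in> borel_measurable unit_leb" by (rule unit_leb_measurable[OF assms(1)])
  show "integrable unit_leb (\<lambda>y. (k y)\<^sup>2)"
  proof (rule unit_integral_bounded(1)[where B = "B\<^sup>2"])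
    show "(\<lambda>y. (k y)\<^sup>2) \<in> borel_measurable (lebesgue_on {0..1})" using assms(1) by measurable
    show "\<bar>(k y)\<^sup>2\<bar> \<le> B\<^sup>2" if "y \<in> {0..1}" for y
      using assms(2)[OF that] abs_le_square_iff[of "k y" B] by simp
  qed
qed

lemma L2_fun_continuous: "continuous_on {0..1} k \<Longrightarrow> L2_fun k"
  by (metis L2_fun_bounded bounded_on_Icc lebesgue_measurable_continuous)

lemma L2_fun_diff:
  assumes "L2_fun f" "L2_fun g" shows "L2_fun (\<lambda>y. f y - g y)"
  unfolding L2_fun_def
proof
  have [measurable]: "f \<in> borel_measurable unit_leb" "g \<in> borel_measurable unit_leb"
    using assms by (auto simp: L2_fun_def)
  show "(\<lambda>y. f y - g y) \<in> borel_measurable unit_leb" by measurable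
  have "integrable unit_leb (\<lambda>y. 2 * (f y)\<^sup>2 + 2 * (g y)\<^sup>2)"
    using assms by (auto simp: L2_fun_def)
  then show "integrable unit_leb (\<lambda>y. (f y - g y)\<^sup>2)"
  proof (rule Bochner_Integration.integrable_bound)
    have "(f y - g y)\<^sup>2 \<le> 2 * (f y)\<^sup>2 + 2 * (g y)\<^sup>2" for y
      using zero_le_power2[of "f y + g y"] by (simp add: power2_eq_square algebra_simps)
    then show "AE y in unit_leb. norm ((f y - g y)\<^sup>2) \<le> norm (2 * (f y)\<^sup>2 + 2 * (g y)\<^sup>2)" by simp
  qed measurable
qed

lemma L2_fun_integrable:
  assumes "L2_fun f" shows "integrable unit_leb f"
proof -
  interpret finite_measure unit_leb by (rule unit_leb_finite)
  have "integrable unit_leb (\<lambda>y. 1 + (f y)\<^sup>2)" using assms by (auto simp: L2_fun_def)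
  then show ?thesis
  proof (rule Bochner_Integration.integrable_bound)
    have "\<bar>f y\<bar> \<le> 1 + (f y)\<^sup>2" for y
      using zero_le_power2[of "\<bar>f y\<bar> - 1"] by (simp add: power2_eq_square algebra_simps)
    then show "AE y in unit_leb. norm (f y) \<le> norm (1 + (f y)\<^sup>2)" by simp
  qed (use assms in \<open>simp add: L2_fun_def\<close>)
qed

lemma L2_fun_integrable_mult:
  assumes "k \<in> borel_measurable (lebesgue_on {0..1})" "\<And>y. y \<in> {0..1} \<Longrightarrow> \<bar>k y\<bar> \<le> B" "L2_fun f"
  shows "integrable unit_leb (\<lambda>y. k y * f y)"
proof -
  have "integrable unit_leb (\<lambda>y. B * f y)" using L2_fun_integrable[OF assms(3)] by simp
  then show ?thesis
  proof (rule Bochner_Integration.integrable_bound)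
    have [measurable]: "f \<in> borel_measurable unit_leb" using assms(3) by (auto simp: L2_fun_def)
    have [measurable]: "k \<in> borel_measurable unit_leb" using assms(1) by (rule unit_leb_measurable)
    show "(\<lambda>y. k y * f y) \<in> borel_measurable unit_leb" by measurable
    show "AE y in unit_leb. norm (k y * f y) \<le> norm (B * f y)"
    proof (rule unit_leb_AE)
      fix y :: real assume "y \<in> {0<..<1}"
      then have "\<bar>k y\<bar> \<le> \<bar>B\<bar>" using assms(2)[of y] by auto
      then show "norm (k y * f y) \<le> norm (B * f y)" by (simp add: abs_mult mult_right_mono)
    qed
  qed
qed

text \<open>Integration by parts against a test function leaves no boundary term, as the integral
  vanishes at 0 and the test function at 1.\<close>

lemma has_weak_deriv_indefinite_integral:
  assumes V: "V \<in> borel_measurable (lebesgue_on {0..1})" "\<And>y. y \<in> {0..1} \<Longrightarrow> \<bar>V y\<bar> \<le> B"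
    and u: "\<And>y. y \<in> {0..1} \<Longrightarrow> u y = integral {0..y} V"
  shows "has_weak_deriv u V"
  unfolding has_weak_deriv_def
proof (intro conjI allI impI)
  have u_cont: "continuous_on {0..1} u"
    by (rule continuous_on_eq[OF indefinite_integral_continuous_1[OF bounded_measurable_integrable[OF V]]])
       (use u in auto)
  then show "L2_fun u" by (rule L2_fun_continuous)
  show "L2_fun V" by (rule L2_fun_bounded[OF V])
  fix \<phi> assume \<phi>: "test_function \<phi>"
  have "integral {0..1} (\<lambda>y. u y * deriv \<phi> y) = integral {0..1} (\<lambda>y. integral {0..y} V * deriv \<phi> y)"
    by (rule integral_cong) (simp add: u)
  also have "\<dots> = integral {0..1} V * \<phi> 1 - integral {0..1} (\<lambda>y. V y * \<phi> y)"
    by (rule integral_by_parts_indefinite[OF V test_function_deriv[OF \<phi>] test_function_continuous_deriv[OF \<phi>]])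
  also have "\<phi> 1 = 0" by (rule test_function_eq_0[OF \<phi>]) simp
  finally have "integral {0..1} (\<lambda>y. u y * deriv \<phi> y) = - integral {0..1} (\<lambda>y. V y * \<phi> y)" by simp
  moreover have "integral\<^sup>L unit_leb (\<lambda>y. u y * deriv \<phi> y) = integral {0..1} (\<lambda>y. u y * deriv \<phi> y)"
    by (intro unit_integral_continuous continuous_on_mult u_cont test_function_continuous_deriv \<phi>)
  moreover have "integral\<^sup>L unit_leb (\<lambda>y. V y * \<phi> y) = integral {0..1} (\<lambda>y. V y * \<phi> y)"
  proof -
    obtain P where P: "P \<ge> 0" "\<And>y. y \<in> {0..1} \<Longrightarrow> \<bar>\<phi> y\<bar> \<le> P"
      using bounded_on_Icc[OF test_function_continuous[OF \<phi>]] by blast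
    show ?thesis
    proof (rule unit_integral_bounded(2)[where B = "B * P"])
      show "(\<lambda>y. V y * \<phi> y) \<in> borel_measurable (lebesgue_on {0..1})"
        using V(1) lebesgue_measurable_continuous[OF test_function_continuous[OF \<phi>]] by measurable
      show "\<bar>V y * \<phi> y\<bar> \<le> B * P" if "y \<in> {0..1}" for y
        unfolding abs_mult using V(2)[OF that] P(2)[OF that] by (intro mult_mono) auto
    qed
  qed
  ultimately show "integral\<^sup>L unit_leb (\<lambda>y. u y * deriv \<phi> y) = - integral\<^sup>L unit_leb (\<lambda>y. V y * \<phi> y)" by simp
qed

text \<open>The pointwise inequality |k| <= k^2/d + d takes the place of the Cauchy-Schwarz
  inequality: the interval has measure 1, so d can be fixed as e/2 before the squared norms are made
  small.\<close>

lemma L1_tendsto_0_of_L2: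
  assumes L2: "\<And>n. L2_fun (k n)" and lim: "(\<lambda>n::nat. \<integral>y. (k n y)\<^sup>2 \<partial>unit_leb) \<longlonglongrightarrow> 0"
  shows "(\<lambda>n. \<integral>y. \<bar>k n y\<bar> \<partial>unit_leb) \<longlonglongrightarrow> 0"
proof (rule LIMSEQ_I)
  fix e :: real assume e: "e > 0"
  interpret finite_measure unit_leb by (rule unit_leb_finite)
  define d where "d = e / 2"
  have d: "d > 0" using e by (simp add: d_def)
  have le: "(\<integral>y. \<bar>k n y\<bar> \<partial>unit_leb) \<le> (\<integral>y. (k n y)\<^sup>2 \<partial>unit_leb) / d + d" for n
  proof -
    have "(\<integral>y. \<bar>k n y\<bar> \<partial>unit_leb) \<le> (\<integral>y. (k n y)\<^sup>2 / d + d \<partial>unit_leb)"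
    proof (rule integral_mono)
      show "integrable unit_leb (\<lambda>y. \<bar>k n y\<bar>)" using L2_fun_integrable[OF L2] by simp
      show "integrable unit_leb (\<lambda>y. (k n y)\<^sup>2 / d + d)" using L2[of n] by (auto simp: L2_fun_def)
      show "\<bar>k n y\<bar> \<le> (k n y)\<^sup>2 / d + d" for y
      proof -
        have "(\<bar>k n y\<bar> - d)\<^sup>2 = (k n y)\<^sup>2 + d * d - 2 * (\<bar>k n y\<bar> * d)"
          unfolding power2_diff by (simp add: power2_eq_square mult_ac)
        moreover have "0 \<le> \<bar>k n y\<bar> * d" using d by simp
        ultimately have "\<bar>k n y\<bar> * d \<le> (k n y)\<^sup>2 + d * d"
          using zero_le_power2[of "\<bar>k n y\<bar> - d"] by linarith
        then have "\<bar>k n y\<bar> \<le> ((k n y)\<^sup>2 + d * d) / d" using d by (simp add: pos_le_divide_eq)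
        then show ?thesis using d by (simp add: add_divide_distrib)
      qed
    qed
    also have "\<dots> = (\<integral>y. (k n y)\<^sup>2 \<partial>unit_leb) / d + d * measure unit_leb (space unit_leb)"
      using L2[of n] by (subst Bochner_Integration.integral_add) (auto simp: L2_fun_def)
    also have "measure unit_leb (space unit_leb) = 1"
      by (simp add: measure_restrict_space space_restrict_space)
    finally show ?thesis by simp
  qed
  obtain N where N: "\<And>n. n \<ge> N \<Longrightarrow> \<bar>\<integral>y. (k n y)\<^sup>2 \<partial>unit_leb\<bar> < d * d"
    using LIMSEQ_D[OF lim, of "d * d"] d by auto
  have "norm ((\<integral>y. \<bar>k n y\<bar> \<partial>unit_leb) - 0) < e" if "n \<ge> N" for n
  proof -
    have "(\<integral>y. (k n y)\<^sup>2 \<partial>unit_leb) < d * d" using N[OF that] by linarith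
    then have "(\<integral>y. (k n y)\<^sup>2 \<partial>unit_leb) / d < d" using d by (simp add: pos_divide_less_eq)
    then have "(\<integral>y. \<bar>k n y\<bar> \<partial>unit_leb) < e" using le[of n] by (simp add: d_def)
    moreover have "(\<integral>y. \<bar>k n y\<bar> \<partial>unit_leb) \<ge> 0" by (rule integral_nonneg_AE) simp
    ultimately show ?thesis by simp
  qed
  then show "\<exists>N. \<forall>n\<ge>N. norm ((\<integral>y. \<bar>k n y\<bar> \<partial>unit_leb) - 0) < e" by blast
qed

lemma integral_indicator_Icc:
  fixes k :: "real \<Rightarrow> real"
  assumes "y \<in> {0..1}"
  shows "integral {0..1} (\<lambda>z. indicat_real {0..y} z * k z) = integral {0..y} k"
proof -
  have "integral {0..1} (\<lambda>z. indicat_real {0..y} z * k z) = integral {0..1} (\<lambda>z. if z \<in> {0..y} then k z else 0)"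
    by (rule integral_cong) (simp add: indicator_def)
  also have "\<dots> = integral {0..y} k"
    using integral_restrict_Int[of "{0..1}" "{0..y}" k] assms by (simp add: Int_absorb1)
  finally show ?thesis .
qed

lemma test_function_representation:
  assumes \<phi>: "test_function \<phi>" and y: "y \<in> {0..1}"
  shows "\<phi> y = (\<integral>z. indicat_real {0..y} z * deriv \<phi> z \<partial>unit_leb)"
proof -
  obtain P where P: "P \<ge> 0" "\<And>y. y \<in> {0..1} \<Longrightarrow> \<bar>deriv \<phi> y\<bar> \<le> P"
    using bounded_on_Icc[OF test_function_continuous_deriv[OF \<phi>]] by blast
  have "(\<integral>z. indicat_real {0..y} z * deriv \<phi> z \<partial>unit_leb) = integral {0..1} (\<lambda>z. indicat_real {0..y} z * deriv \<phi> z)"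
  proof (rule unit_integral_bounded(2)[where B = P])
    have "indicat_real {0..y} \<in> borel_measurable (lebesgue_on {0..1})"
      by (intro measurable_restrict_space1 borel_measurable_indicator) simp
    then show "(\<lambda>z. indicat_real {0..y} z * deriv \<phi> z) \<in> borel_measurable (lebesgue_on {0..1})"
      using lebesgue_measurable_continuous[OF test_function_continuous_deriv[OF \<phi>]] by measurable
  qed (use P in \<open>auto simp: indicator_def\<close>)
  also have "\<dots> = integral {0..y} (deriv \<phi>)" by (rule integral_indicator_Icc[OF y])
  also have "\<dots> = \<phi> y - \<phi> 0"
    using y test_function_deriv[OF \<phi>]
    by (intro integral_unique fundamental_theorem_of_calculus)
       (auto simp flip: has_real_derivative_iff_has_vector_derivative intro: DERIV_subset)
  also have "\<phi> 0 = 0" by (rule test_function_eq_0[OF \<phi>]) simp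
  finally show ?thesis by simp
qed

text \<open>The derivatives converge in the L1 norm, so the test functions, being their integrals
  from 0, converge uniformly to the integral P of w. Their L2 limit is v. As both limits are
  continuous, v = P everywhere on [0,1], which gives convergence at the nodes too.\<close>

lemma H1_0_approximation:
  assumes "v \<in> H1_0"
  obtains w \<phi> e where "has_weak_deriv v w" "\<And>n::nat. test_function (\<phi> n)" "e \<longlonglongrightarrow> (0::real)"
    "\<And>n. (\<integral>y. \<bar>w y - deriv (\<phi> n) y\<bar> \<partial>unit_leb) \<le> e n" "\<And>n y. y \<in> {0..1} \<Longrightarrow> \<bar>v y - \<phi> n y\<bar> \<le> e n"
proof -
  obtain w \<phi> where v_cont: "continuous_on {0..1} v" and w: "has_weak_deriv v w" and \<phi>: "\<And>n::nat. test_function (\<phi> n)"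
    and lim: "(\<lambda>n. (\<integral>y. (v y - \<phi> n y)\<^sup>2 \<partial>unit_leb) + (\<integral>y. (w y - deriv (\<phi> n) y)\<^sup>2 \<partial>unit_leb)) \<longlonglongrightarrow> 0"
    using assms unfolding H1_0_def by blast
  have wL2: "L2_fun w" using w by (simp add: has_weak_deriv_def)
  have kL2: "L2_fun (\<lambda>y. w y - deriv (\<phi> n) y)" for n
    by (intro L2_fun_diff wL2 L2_fun_continuous test_function_continuous_deriv \<phi>)
  have lim1: "(\<lambda>n. \<integral>y. (v y - \<phi> n y)\<^sup>2 \<partial>unit_leb) \<longlonglongrightarrow> 0"
    by (rule tendsto_sandwich[OF _ _ tendsto_const lim]) auto
  have lim2: "(\<lambda>n. \<integral>y. (w y - deriv (\<phi> n) y)\<^sup>2 \<partial>unit_leb) \<longlonglongrightarrow> 0"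
    by (rule tendsto_sandwich[OF _ _ tendsto_const lim]) auto
  define e where "e n = (\<integral>y. \<bar>w y - deriv (\<phi> n) y\<bar> \<partial>unit_leb)" for n
  have e: "e \<longlonglongrightarrow> 0" unfolding e_def by (rule L1_tendsto_0_of_L2[OF kL2 lim2])
  define P where "P y = (\<integral>z. indicat_real {0..y} z * w z \<partial>unit_leb)" for y
  have ind: "indicat_real {0..y} \<in> borel_measurable (lebesgue_on {0..1})" for y :: real
    by (intro measurable_restrict_space1 borel_measurable_indicator) simp
  have ind_int: "integrable unit_leb (\<lambda>z. indicat_real {0..y} z * k z)" if "L2_fun k" for k y
    by (rule L2_fun_integrable_mult[where B = 1, OF ind _ that]) (simp add: indicator_def)
  have P_\<phi>: "\<bar>P y - \<phi> n y\<bar> \<le> e n" if y: "y \<in> {0..1}" for n y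
  proof -
    have "P y - \<phi> n y = (\<integral>z. indicat_real {0..y} z * w z - indicat_real {0..y} z * deriv (\<phi> n) z \<partial>unit_leb)"
      unfolding P_def test_function_representation[OF \<phi> y]
      by (intro Bochner_Integration.integral_diff[symmetric] ind_int wL2 L2_fun_continuous test_function_continuous_deriv \<phi>)
    also have "\<dots> = (\<integral>z. indicat_real {0..y} z * (w z - deriv (\<phi> n) z) \<partial>unit_leb)"
      by (simp add: right_diff_distrib)
    also have "\<bar>\<dots>\<bar> \<le> (\<integral>z. \<bar>w z - deriv (\<phi> n) z\<bar> \<partial>unit_leb)"
    proof (rule order_trans[OF integral_abs_bound], rule integral_mono)
      show "integrable unit_leb (\<lambda>z. \<bar>indicat_real {0..y} z * (w z - deriv (\<phi> n) z)\<bar>)"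
        using ind_int[OF kL2] by simp
      show "integrable unit_leb (\<lambda>z. \<bar>w z - deriv (\<phi> n) z\<bar>)"
        using L2_fun_integrable[OF kL2] by simp
    qed (auto simp: indicator_def)
    finally show ?thesis by (simp add: e_def)
  qed
  have P_cont: "continuous_on {0..1} P"
  proof (rule uniform_limit_theorem[of _ _ sequentially])
    show "uniform_limit {0..1} \<phi> P sequentially"
    proof (rule uniform_limitI)
      fix \<epsilon> :: real assume "\<epsilon> > 0"
      then have "\<forall>\<^sub>F n in sequentially. e n < \<epsilon>" by (rule order_tendstoD(2)[OF e])
      then show "\<forall>\<^sub>F n in sequentially. \<forall>y\<in>{0..1}. dist (\<phi> n y) (P y) < \<epsilon>"
      proof eventually_elim
        case (elim n)
        show ?case
        proof
          fix y :: real assume "y \<in> {0..1}"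
          from P_\<phi>[OF this, of n] elim show "dist (\<phi> n y) (P y) < \<epsilon>"
            by (simp add: dist_real_def abs_minus_commute)
        qed
      qed
    qed
  qed (use test_function_continuous[OF \<phi>] in auto)
  \<comment> \<open>The squared distance of v and P is at most twice the squared L2 error of the
    approximation to v plus twice the squared uniform error of the approximation to P; both vanish
    in the limit.\<close>
  have "integral {0..1} (\<lambda>y. (v y - P y)\<^sup>2) \<le> 0"
  proof (rule LIMSEQ_le_const)
    show "(\<lambda>n. 2 * (\<integral>y. (v y - \<phi> n y)\<^sup>2 \<partial>unit_leb) + 2 * (e n)\<^sup>2) \<longlonglongrightarrow> 0"
      using tendsto_add[OF tendsto_mult[OF tendsto_const[of 2] lim1] tendsto_mult[OF tendsto_const[of 2] tendsto_power[OF e, of 2]]]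
      by simp
    have "integral {0..1} (\<lambda>y. (v y - P y)\<^sup>2) \<le> 2 * (\<integral>y. (v y - \<phi> n y)\<^sup>2 \<partial>unit_leb) + 2 * (e n)\<^sup>2" for n
    proof -
      have c: "continuous_on {0..1} (\<lambda>y. (v y - \<phi> n y)\<^sup>2)"
        by (intro continuous_intros v_cont test_function_continuous \<phi>)
      have "integral {0..1} (\<lambda>y. (v y - P y)\<^sup>2) \<le> integral {0..1} (\<lambda>y. 2 * (v y - \<phi> n y)\<^sup>2 + 2 * (e n)\<^sup>2)"
      proof (rule integral_le)
        show "(\<lambda>y. (v y - P y)\<^sup>2) integrable_on {0..1}"
          by (intro integrable_continuous_real continuous_intros v_cont P_cont)
        show "(\<lambda>y. 2 * (v y - \<phi> n y)\<^sup>2 + 2 * (e n)\<^sup>2) integrable_on {0..1}"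
          by (intro integrable_continuous_real continuous_intros v_cont test_function_continuous \<phi>)
        show "(v y - P y)\<^sup>2 \<le> 2 * (v y - \<phi> n y)\<^sup>2 + 2 * (e n)\<^sup>2" if "y \<in> {0..1}" for y
        proof -
          have "(P y - \<phi> n y)\<^sup>2 \<le> (e n)\<^sup>2" using P_\<phi>[OF that, of n] by (metis abs_ge_zero power2_abs power_mono)
          moreover have "(v y - P y)\<^sup>2 \<le> 2 * (v y - \<phi> n y)\<^sup>2 + 2 * (P y - \<phi> n y)\<^sup>2"
            using zero_le_power2[of "(v y - \<phi> n y) + (P y - \<phi> n y)"] by (simp add: power2_eq_square algebra_simps)
          ultimately show ?thesis by linarith
        qed
      qed
      also have "\<dots> = 2 * integral {0..1} (\<lambda>y. (v y - \<phi> n y)\<^sup>2) + 2 * (e n)\<^sup>2"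
      proof -
        have "((\<lambda>y. 2 * (v y - \<phi> n y)\<^sup>2 + 2 * (e n)\<^sup>2) has_integral (2 * integral {0..1} (\<lambda>y. (v y - \<phi> n y)\<^sup>2) + 2 * (e n)\<^sup>2)) {0..1}"
          using has_integral_const_real[of "(e n)\<^sup>2" 0 1]
          by (intro has_integral_add has_integral_mult_right integrable_integral integrable_continuous_real c) auto
        then show ?thesis by (rule integral_unique)
      qed
      also have "integral {0..1} (\<lambda>y. (v y - \<phi> n y)\<^sup>2) = (\<integral>y. (v y - \<phi> n y)\<^sup>2 \<partial>unit_leb)"
        by (rule unit_integral_continuous(2)[OF c, symmetric])
      finally show ?thesis .
    qed
    then show "\<exists>N. \<forall>n\<ge>N. integral {0..1} (\<lambda>y. (v y - P y)\<^sup>2) \<le> 2 * (\<integral>y. (v y - \<phi> n y)\<^sup>2 \<partial>unit_leb) + 2 * (e n)\<^sup>2" by blast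
  qed
  moreover have c: "continuous_on {0..1} (\<lambda>y. (v y - P y)\<^sup>2)" by (intro continuous_intros v_cont P_cont)
  then have "integral {0..1} (\<lambda>y. (v y - P y)\<^sup>2) \<ge> 0"
    by (intro integral_nonneg integrable_continuous_real) auto
  ultimately have "integral {0..1} (\<lambda>y. (v y - P y)\<^sup>2) = 0" by linarith
  then have "\<forall>y\<in>{0..1}. (v y - P y)\<^sup>2 = 0" using integral_eq_0_iff[OF c] by simp
  then have v_P: "v y = P y" if "y \<in> {0..1}" for y using that by auto
  show ?thesis
  proof (rule that[OF w \<phi> e])
    show "(\<integral>y. \<bar>w y - deriv (\<phi> n) y\<bar> \<partial>unit_leb) \<le> e n" for n by (simp add: e_def)
    show "\<bar>v y - \<phi> n y\<bar> \<le> e n" if "y \<in> {0..1}" for n y using P_\<phi>[OF that] v_P[OF that] by simp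
  qed
qed

text \<open>Two weak derivatives of \<open>v\<close> have the same integrals against every test
  function, and boundedly convergent sequences of test functions extend this to \<open>V\<close>.
  This weak form of uniqueness avoids proving equality almost everywhere.\<close>

lemma weak_deriv_tested_unique:
  assumes "has_weak_deriv v v'" "has_weak_deriv v w"
    and \<psi>: "\<And>n::nat. test_function (\<psi> n)" "\<And>n y. \<bar>\<psi> n y\<bar> \<le> B"
    and lim: "\<And>y. y \<in> {0<..<1} \<Longrightarrow> (\<lambda>n. \<psi> n y) \<longlonglongrightarrow> V y"
    and V: "V \<in> borel_measurable (lebesgue_on {0..1})"
  shows "(\<integral>y. V y * v' y \<partial>unit_leb) = (\<integral>y. V y * w y \<partial>unit_leb)"
proof -
  have *: "(\<lambda>n. \<integral>y. \<psi> n y * k y \<partial>unit_leb) \<longlonglongrightarrow> (\<integral>y. V y * k y \<partial>unit_leb)" if k: "L2_fun k" for k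
  proof (rule integral_dominated_convergence)
    have [measurable]: "k \<in> borel_measurable unit_leb" using k by (auto simp: L2_fun_def)
    have [measurable]: "V \<in> borel_measurable unit_leb" using V by (rule unit_leb_measurable)
    have [measurable]: "\<psi> n \<in> borel_measurable unit_leb" for n
      by (intro unit_leb_measurable lebesgue_measurable_continuous test_function_continuous \<psi>)
    show "(\<lambda>y. V y * k y) \<in> borel_measurable unit_leb" "(\<lambda>y. \<psi> n y * k y) \<in> borel_measurable unit_leb" for n
      by measurable
    show "integrable unit_leb (\<lambda>y. B * \<bar>k y\<bar>)" using L2_fun_integrable[OF k] by simp
    show "AE y in unit_leb. (\<lambda>n. \<psi> n y * k y) \<longlonglongrightarrow> V y * k y"
      by (rule unit_leb_AE) (intro tendsto_intros lim)
    show "AE y in unit_leb. norm (\<psi> n y * k y) \<le> B * \<bar>k y\<bar>" for n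
    proof (intro always_eventually allI)
      fix y
      show "norm (\<psi> n y * k y) \<le> B * \<bar>k y\<bar>"
        unfolding real_norm_def abs_mult by (rule mult_right_mono[OF \<psi>(2)]) simp
    qed
  qed
  have "(\<integral>y. \<psi> n y * v' y \<partial>unit_leb) = (\<integral>y. \<psi> n y * w y \<partial>unit_leb)" for n
  proof -
    have "(\<integral>y. v' y * \<psi> n y \<partial>unit_leb) = (\<integral>y. w y * \<psi> n y \<partial>unit_leb)"
    proof -
      have "(\<integral>y. v y * deriv (\<psi> n) y \<partial>unit_leb) = - (\<integral>y. v' y * \<psi> n y \<partial>unit_leb)"
        "(\<integral>y. v y * deriv (\<psi> n) y \<partial>unit_leb) = - (\<integral>y. w y * \<psi> n y \<partial>unit_leb)"
        using assms(1,2) \<psi>(1)[of n] unfolding has_weak_deriv_def by blast+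
      then show ?thesis by linarith
    qed
    then show ?thesis by (simp add: mult.commute)
  qed
  moreover have "L2_fun v'" "L2_fun w" using assms(1,2) unfolding has_weak_deriv_def by blast+
  ultimately show ?thesis using *[of v'] *[of w] LIMSEQ_unique by simp
qed

subsection \<open>The weak formulation\<close>

text \<open>The nonlinearities are frozen: in the application \<open>F\<close> is the right-hand
  side along the solution and \<open>b j\<close> the impulse at its value there. What remains is a
  linear statement about a given source and given jumps.\<close>

locale impulsive_bvp_solution =
  fixes F :: "real \<Rightarrow> real" and p B\<^sub>F :: real and m :: nat and x b :: "nat \<Rightarrow> real" and u V :: "real \<Rightarrow> real"
  assumes F_measurable: "F \<in> borel_measurable (lebesgue_on {0..1})"
    and F_bounded: "\<And>y. y \<in> {0..1} \<Longrightarrow> \<bar>F y\<bar> \<le> B\<^sub>F"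
    and nodes: "\<And>j. j \<in> {1..m} \<Longrightarrow> x j \<in> {0..1}"
    and velocity: "\<And>y. V y = p - integral {0..y} F - (\<Sum>j=1..m. if x j < y then b j else 0)"
    and position: "\<And>y. y \<in> {0..1} \<Longrightarrow> u y = integral {0..y} V" and right_end: "u 1 = 0"
begin

lemma F_integrable: "F integrable_on {0..1}"
  by (rule bounded_measurable_integrable[OF F_measurable F_bounded])

text \<open>The continuous part of the velocity; it plays the role of \<open>h\<close> in
  \<open>smooth_bump_approximation\<close>.\<close>

definition "momentum y = p - integral {0..y} F"

lemma momentum_continuous: "continuous_on {0..1} momentum"
  unfolding momentum_def by (intro continuous_intros indefinite_integral_continuous_1 F_integrable)

lemma velocity': "V y = momentum y - (\<Sum>j\<in>{1..m}. if x j < y then b j else 0)"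
  using velocity by (simp add: momentum_def)

lemma step_measurable: "(\<lambda>y. if s < y then k else 0 :: real) \<in> borel_measurable (lebesgue_on {0..1::real})"
  by (rule measurable_restrict_space1, rule measurable_completion) measurable

lemma V_measurable: "V \<in> borel_measurable (lebesgue_on {0..1})"
proof -
  have "(\<lambda>y. momentum y - (\<Sum>j\<in>{1..m}. if x j < y then b j else 0)) \<in> borel_measurable (lebesgue_on {0..1})"
    using lebesgue_measurable_continuous[OF momentum_continuous] step_measurable by measurable
  then show ?thesis by (simp add: velocity'[abs_def])
qed

lemma V_bounded: obtains B where "B \<ge> 0" "\<And>y. y \<in> {0..1} \<Longrightarrow> \<bar>V y\<bar> \<le> B"
proof -
  obtain H where H: "H \<ge> 0" "\<And>y. y \<in> {0..1} \<Longrightarrow> \<bar>momentum y\<bar> \<le> H" using bounded_on_Icc[OF momentum_continuous] by blast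
  have "\<bar>V y\<bar> \<le> H + (\<Sum>j\<in>{1..m}. \<bar>b j\<bar>)" if "y \<in> {0..1}" for y
  proof -
    have "\<bar>\<Sum>j\<in>{1..m}. if x j < y then b j else 0\<bar> \<le> (\<Sum>j\<in>{1..m}. \<bar>b j\<bar>)"
      by (rule order_trans[OF sum_abs sum_mono]) auto
    then show ?thesis using H(2)[OF that] unfolding velocity' by linarith
  qed
  then show ?thesis using H(1) by (intro that[of "H + (\<Sum>j\<in>{1..m}. \<bar>b j\<bar>)"]) (auto intro: add_nonneg_nonneg sum_nonneg)
qed

lemma weak_deriv: "has_weak_deriv u V"
proof -
  obtain B where "\<And>y. y \<in> {0..1} \<Longrightarrow> \<bar>V y\<bar> \<le> B" using V_bounded by blast
  then show ?thesis by (rule has_weak_deriv_indefinite_integral[OF V_measurable _ position])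
qed

text \<open>The condition u(1) = 0 says that V has mean zero, so V is a bounded limit of mean-zero
  bumps. Their antiderivatives are test functions and converge boundedly to u; bounded convergence
  of the squares gives both L2 limits.\<close>

lemma u_in_H1_0: "u \<in> H1_0"
proof -
  obtain BV where BV: "BV \<ge> 0" "\<And>y. y \<in> {0..1} \<Longrightarrow> \<bar>V y\<bar> \<le> BV" using V_bounded by blast
  have V_int: "V integrable_on {0..1}" by (rule bounded_measurable_integrable[OF V_measurable BV(2)])
  have u_cont: "continuous_on {0..1} u"
    by (rule continuous_on_eq[OF indefinite_integral_continuous_1[OF V_int]]) (use position in auto)
  have mean: "integral {0..1} V = 0" using position[of 1] right_end by simp
  have nodes0: "\<And>j. j \<in> {1..m} \<Longrightarrow> 0 \<le> x j" using nodes by simp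
  obtain \<psi> B where \<psi>: "\<And>n::nat. smooth_bump (\<psi> n)" and B: "\<And>n y. \<bar>\<psi> n y\<bar> \<le> B"
    and lim: "\<And>y. y \<in> {0<..<1} \<Longrightarrow> (\<lambda>n. \<psi> n y) \<longlonglongrightarrow> V y" and zero: "\<And>n. integral {0..1} (\<psi> n) = 0"
    using smooth_bump_approximation_mean_zero[OF momentum_continuous finite_atLeastAtMost nodes0 velocity' mean] by blast
  define \<phi> where "\<phi> n y = integral {0..y} (\<psi> n)" for n y
  have \<phi>: "test_function (\<phi> n)" for n
    unfolding \<phi>_def by (rule smooth_bump_antiderivative(2)[OF \<psi> zero])
  have \<phi>': "deriv (\<phi> n) = \<psi> n" for n
    unfolding \<phi>_def by (rule ext, rule DERIV_imp_deriv, rule smooth_bump_antiderivative(1)[OF \<psi> zero])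
  have \<psi>_int: "\<psi> n integrable_on {s..t}" for n s t
    by (intro integrable_continuous_real smooth_bump_continuous_on \<psi>)
  have \<phi>_lim: "(\<lambda>n. \<phi> n y) \<longlonglongrightarrow> u y" if y: "y \<in> {0..1}" for y
    unfolding \<phi>_def position[OF y]
    by (rule integral_bounded_convergence(2)[OF \<psi>_int B lim]) (use y in auto)
  have \<phi>_bound: "\<bar>\<phi> n y\<bar> \<le> B" if y: "y \<in> {0..1}" for n y
  proof -
    have "\<bar>\<phi> n y\<bar> \<le> B * (y - 0)" unfolding \<phi>_def using y by (intro abs_integral_le \<psi>_int B) auto
    also have "\<dots> \<le> B * 1" using B[of 0 0] y by (intro mult_left_mono) auto
    finally show ?thesis by simp
  qed
  have u_bound: "\<bar>u y\<bar> \<le> BV" if y: "y \<in> {0..1}" for y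
  proof -
    have "\<bar>u y\<bar> \<le> BV * (y - 0)" unfolding position[OF y]
      using y BV V_int by (intro abs_integral_le) (auto intro: integrable_subinterval_real)
    also have "\<dots> \<le> BV * 1" using BV y by (intro mult_left_mono) auto
    finally show ?thesis by simp
  qed
  have square: "\<bar>(s - t)\<^sup>2\<bar> \<le> (BV + B)\<^sup>2" if "\<bar>s\<bar> \<le> BV" "\<bar>t\<bar> \<le> B" for s t :: real
  proof -
    have "\<bar>s - t\<bar> \<le> \<bar>BV + B\<bar>" using that by linarith
    then show ?thesis using abs_le_square_iff[of "s - t" "BV + B"] by simp
  qed
  have sq_lim: "(\<lambda>n. \<integral>y. (k y - \<kappa> n y)\<^sup>2 \<partial>unit_leb) \<longlonglongrightarrow> 0"
    if k: "k \<in> borel_measurable (lebesgue_on {0..1})" "\<And>y. y \<in> {0..1} \<Longrightarrow> \<bar>k y\<bar> \<le> BV"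
    and \<kappa>: "\<And>n. continuous_on {0..1} (\<kappa> n)" "\<And>n y. y \<in> {0..1} \<Longrightarrow> \<bar>\<kappa> n y\<bar> \<le> B"
    and l: "\<And>y. y \<in> {0<..<1} \<Longrightarrow> (\<lambda>n. \<kappa> n y) \<longlonglongrightarrow> k y" for k \<kappa>
  proof -
    have meas: "(\<lambda>y. (k y - \<kappa> n y)\<^sup>2) \<in> borel_measurable (lebesgue_on {0..1})" for n
      using k(1) lebesgue_measurable_continuous[OF \<kappa>(1)] by measurable
    have bound: "\<bar>(k y - \<kappa> n y)\<^sup>2\<bar> \<le> (BV + B)\<^sup>2" if "y \<in> {0..1}" for y n
      by (rule square[OF k(2)[OF that] \<kappa>(2)[OF that]])
    have "(\<lambda>n. integral {0..1} (\<lambda>y. (k y - \<kappa> n y)\<^sup>2)) \<longlonglongrightarrow> integral {0..1} (\<lambda>y :: real. 0 :: real)"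
    proof (rule integral_bounded_convergence(2))
      show "(\<lambda>y. (k y - \<kappa> n y)\<^sup>2) integrable_on {0..1}" for n
        by (rule bounded_measurable_integrable[OF meas bound])
      show "\<bar>(k y - \<kappa> n y)\<^sup>2\<bar> \<le> (BV + B)\<^sup>2" if "y \<in> {0<..<1}" for n y using that by (intro bound) auto
      show "(\<lambda>n. (k y - \<kappa> n y)\<^sup>2) \<longlonglongrightarrow> 0" if "y \<in> {0<..<1}" for y
        using tendsto_power[OF tendsto_diff[OF tendsto_const[of "k y"] l[OF that]], of 2] by simp
    qed
    then show ?thesis using unit_integral_bounded(2)[OF meas bound] by simp
  qed
  have "(\<lambda>n. \<integral>y. (u y - \<phi> n y)\<^sup>2 \<partial>unit_leb) \<longlonglongrightarrow> 0"
    by (rule sq_lim[OF lebesgue_measurable_continuous[OF u_cont] u_bound test_function_continuous[OF \<phi>] \<phi>_bound \<phi>_lim]) auto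
  moreover have "(\<lambda>n. \<integral>y. (V y - deriv (\<phi> n) y)\<^sup>2 \<partial>unit_leb) \<longlonglongrightarrow> 0"
    unfolding \<phi>' by (rule sq_lim[OF V_measurable BV(2) smooth_bump_continuous_on[OF \<psi>] B lim])
  ultimately have "(\<lambda>n. (\<integral>y. (u y - \<phi> n y)\<^sup>2 \<partial>unit_leb) + (\<integral>y. (V y - deriv (\<phi> n) y)\<^sup>2 \<partial>unit_leb)) \<longlonglongrightarrow> 0 + 0"
    by (rule tendsto_add)
  then show ?thesis
    unfolding H1_0_def using u_cont weak_deriv \<phi> by auto
qed

text \<open>The velocity is split into its three parts. The constant slope contributes nothing
  because \<phi> vanishes at both ends, the source term is integrated by parts, and each step at
  \<open>x j\<close>, which enters V with a minus sign, contributes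
  \<open>b j * \<phi> (x j)\<close>.\<close>

lemma weak_form_test_function:
  assumes \<phi>: "test_function \<phi>"
  shows "(\<integral>y. V y * deriv \<phi> y \<partial>unit_leb) = (\<integral>y. F y * \<phi> y \<partial>unit_leb) + (\<Sum>j=1..m. b j * \<phi> (x j))"
proof -
  note \<phi>_cont = test_function_continuous[OF \<phi>] and \<phi>'_cont = test_function_continuous_deriv[OF \<phi>]
  obtain BV where BV: "BV \<ge> 0" "\<And>y. y \<in> {0..1} \<Longrightarrow> \<bar>V y\<bar> \<le> BV" using V_bounded by blast
  obtain P where P: "P \<ge> 0" "\<And>y. y \<in> {0..1} \<Longrightarrow> \<bar>\<phi> y\<bar> \<le> P" using bounded_on_Icc[OF \<phi>_cont] by blast
  obtain P' where P': "P' \<ge> 0" "\<And>y. y \<in> {0..1} \<Longrightarrow> \<bar>deriv \<phi> y\<bar> \<le> P'" using bounded_on_Icc[OF \<phi>'_cont] by blast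
  have zero: "\<phi> 0 = 0" "\<phi> 1 = 0" using test_function_eq_0[OF \<phi>] by auto
  have ftc: "(deriv \<phi> has_integral (\<phi> t - \<phi> s)) {s..t}" if "s \<le> t" for s t
    using that test_function_deriv[OF \<phi>]
    by (intro fundamental_theorem_of_calculus)
       (auto simp flip: has_real_derivative_iff_has_vector_derivative intro: DERIV_subset)
  have i1: "((\<lambda>y. p * deriv \<phi> y) has_integral p * (\<phi> 1 - \<phi> 0)) {0..1}"
    by (intro has_integral_mult_right ftc) simp
  have "(\<lambda>y. integral {0..y} F * deriv \<phi> y) integrable_on {0..1}"
    by (intro integrable_continuous_real continuous_on_mult \<phi>'_cont indefinite_integral_continuous_1 F_integrable)
  then have i2: "((\<lambda>y. integral {0..y} F * deriv \<phi> y) has_integral - integral {0..1} (\<lambda>y. F y * \<phi> y)) {0..1}"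
    using integral_by_parts_indefinite[OF F_measurable F_bounded test_function_deriv[OF \<phi>] \<phi>'_cont] zero
    by (simp add: has_integral_integrable_integral)
  have i3: "((\<lambda>y. (if x j < y then b j else 0) * deriv \<phi> y) has_integral b j * (\<phi> 1 - \<phi> (x j))) {0..1}"
    if "j \<in> {1..m}" for j
  proof -
    have "((\<lambda>y. b j * deriv \<phi> y) has_integral b j * (\<phi> 1 - \<phi> (x j))) {x j..1}"
      using nodes[OF that] by (intro has_integral_mult_right ftc) auto
    then have "((\<lambda>y. if y \<in> {x j..1} then b j * deriv \<phi> y else 0) has_integral b j * (\<phi> 1 - \<phi> (x j))) {0..1}"
      using nodes[OF that] by (subst has_integral_restrict) auto
    then show ?thesis
      by (rule has_integral_spike[of "{x j}", rotated 2]) auto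
  qed
  have "((\<lambda>y. p * deriv \<phi> y - integral {0..y} F * deriv \<phi> y - (\<Sum>j=1..m. (if x j < y then b j else 0) * deriv \<phi> y))
      has_integral (p * (\<phi> 1 - \<phi> 0) - - integral {0..1} (\<lambda>y. F y * \<phi> y) - (\<Sum>j=1..m. b j * (\<phi> 1 - \<phi> (x j))))) {0..1}"
    by (intro has_integral_diff has_integral_sum i1 i2 i3) auto
  then have "((\<lambda>y. V y * deriv \<phi> y) has_integral (integral {0..1} (\<lambda>y. F y * \<phi> y) + (\<Sum>j=1..m. b j * \<phi> (x j)))) {0..1}"
    by (simp add: velocity zero left_diff_distrib sum_distrib_right sum_negf)
  then have "integral {0..1} (\<lambda>y. V y * deriv \<phi> y) = integral {0..1} (\<lambda>y. F y * \<phi> y) + (\<Sum>j=1..m. b j * \<phi> (x j))"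
    by (rule integral_unique)
  moreover have "(\<integral>y. V y * deriv \<phi> y \<partial>unit_leb) = integral {0..1} (\<lambda>y. V y * deriv \<phi> y)"
  proof (rule unit_integral_bounded(2)[where B = "BV * P'"])
    show "(\<lambda>y. V y * deriv \<phi> y) \<in> borel_measurable (lebesgue_on {0..1})"
      using V_measurable lebesgue_measurable_continuous[OF \<phi>'_cont] by measurable
    show "\<bar>V y * deriv \<phi> y\<bar> \<le> BV * P'" if "y \<in> {0..1}" for y
      unfolding abs_mult using BV(2)[OF that] P'(2)[OF that] by (intro mult_mono) auto
  qed
  moreover have "(\<integral>y. F y * \<phi> y \<partial>unit_leb) = integral {0..1} (\<lambda>y. F y * \<phi> y)"
  proof (rule unit_integral_bounded(2)[where B = "B\<^sub>F * P"])
    show "(\<lambda>y. F y * \<phi> y) \<in> borel_measurable (lebesgue_on {0..1})"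
      using F_measurable lebesgue_measurable_continuous[OF \<phi>_cont] by measurable
    show "\<bar>F y * \<phi> y\<bar> \<le> B\<^sub>F * P" if "y \<in> {0..1}" for y
      unfolding abs_mult using F_bounded[OF that] P(2)[OF that] by (intro mult_mono) auto
  qed
  ultimately show ?thesis by simp
qed

text \<open>Density of test functions: V is bounded, so L1 convergence of the derivatives handles
  the left side, and uniform convergence handles the source term and the point values at the
  nodes.\<close>

lemma weak_form:
  assumes v: "v \<in> H1_0" and v': "has_weak_deriv v v'"
  shows "integrable unit_leb (\<lambda>y. F y * v y)"
    and "(\<integral>y. V y * v' y \<partial>unit_leb) = (\<integral>y. F y * v y \<partial>unit_leb) + (\<Sum>j=1..m. b j * v (x j))"
proof -
  obtain w \<phi> e where w: "has_weak_deriv v w" and \<phi>: "\<And>n::nat. test_function (\<phi> n)" and e: "e \<longlonglongrightarrow> (0::real)"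
    and w_\<phi>: "\<And>n. (\<integral>y. \<bar>w y - deriv (\<phi> n) y\<bar> \<partial>unit_leb) \<le> e n"
    and v_\<phi>: "\<And>n y. y \<in> {0..1} \<Longrightarrow> \<bar>v y - \<phi> n y\<bar> \<le> e n"
    using H1_0_approximation[OF v] by blast
  obtain BV where BV: "BV \<ge> 0" "\<And>y. y \<in> {0..1} \<Longrightarrow> \<bar>V y\<bar> \<le> BV" using V_bounded by blast
  have v_cont: "continuous_on {0..1} v" using v by (simp add: H1_0_def)
  have wL2: "L2_fun w" using w by (simp add: has_weak_deriv_def)
  have BF: "B\<^sub>F \<ge> 0" using F_bounded[of 0] by simp
  have F_mult: "integrable unit_leb (\<lambda>y. F y * k y)" if "continuous_on {0..1} k" for k
    by (rule L2_fun_integrable_mult[OF F_measurable F_bounded L2_fun_continuous[OF that]])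
  show "integrable unit_leb (\<lambda>y. F y * v y)" by (rule F_mult[OF v_cont])
  have nodes0: "\<And>j. j \<in> {1..m} \<Longrightarrow> 0 \<le> x j" using nodes by simp
  obtain \<psi> B where \<psi>: "\<And>n::nat. smooth_bump (\<psi> n)" "\<And>n y. \<bar>\<psi> n y\<bar> \<le> B"
    "\<And>y. y \<in> {0<..<1} \<Longrightarrow> (\<lambda>n. \<psi> n y) \<longlonglongrightarrow> V y"
    using smooth_bump_approximation[OF momentum_continuous finite_atLeastAtMost nodes0 velocity'] by blast
  \<comment> \<open>The approximation controls the weak derivative w supplied by membership in
    \<open>H1_0\<close>, whereas the claim concerns an arbitrary \<open>v'\<close>; against V the
    two are interchangeable.\<close>
  have "(\<integral>y. V y * v' y \<partial>unit_leb) = (\<integral>y. V y * w y \<partial>unit_leb)"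
    by (rule weak_deriv_tested_unique[OF v' w smooth_bump_test_function[OF \<psi>(1)] \<psi>(2,3) V_measurable])
  moreover have lim_w: "(\<lambda>n. \<integral>y. V y * deriv (\<phi> n) y \<partial>unit_leb) \<longlonglongrightarrow> (\<integral>y. V y * w y \<partial>unit_leb)"
  proof (rule LIM_zero_cancel, rule Lim_null_comparison)
    show "(\<lambda>n. BV * e n) \<longlonglongrightarrow> 0" using tendsto_mult[OF tendsto_const[of BV] e] by simp
    show "\<forall>\<^sub>F n in sequentially. norm ((\<integral>y. V y * deriv (\<phi> n) y \<partial>unit_leb) - (\<integral>y. V y * w y \<partial>unit_leb)) \<le> BV * e n"
    proof (rule always_eventually, rule allI)
      fix n
      have dL2: "L2_fun (\<lambda>y. w y - deriv (\<phi> n) y)"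
        by (intro L2_fun_diff wL2 L2_fun_continuous test_function_continuous_deriv \<phi>)
      have int: "integrable unit_leb (\<lambda>y. V y * k y)" if "L2_fun k" for k
        by (rule L2_fun_integrable_mult[OF V_measurable BV(2) that])
      have "(\<integral>y. V y * w y \<partial>unit_leb) - (\<integral>y. V y * deriv (\<phi> n) y \<partial>unit_leb) = (\<integral>y. V y * (w y - deriv (\<phi> n) y) \<partial>unit_leb)"
        unfolding right_diff_distrib
        by (intro Bochner_Integration.integral_diff[symmetric] int wL2 L2_fun_continuous test_function_continuous_deriv \<phi>)
      also have "\<bar>\<dots>\<bar> \<le> (\<integral>y. BV * \<bar>w y - deriv (\<phi> n) y\<bar> \<partial>unit_leb)"
      proof (rule order_trans[OF integral_abs_bound], rule integral_mono_AE)
        show "integrable unit_leb (\<lambda>y. \<bar>V y * (w y - deriv (\<phi> n) y)\<bar>)" using int[OF dL2] by simp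
        show "integrable unit_leb (\<lambda>y. BV * \<bar>w y - deriv (\<phi> n) y\<bar>)" using L2_fun_integrable[OF dL2] by simp
        show "AE y in unit_leb. \<bar>V y * (w y - deriv (\<phi> n) y)\<bar> \<le> BV * \<bar>w y - deriv (\<phi> n) y\<bar>"
          by (rule unit_leb_AE) (use BV in \<open>auto simp: abs_mult intro!: mult_right_mono\<close>)
      qed
      also have "\<dots> \<le> BV * e n" using w_\<phi>[of n] BV(1) by (simp add: mult_left_mono)
      finally show "norm ((\<integral>y. V y * deriv (\<phi> n) y \<partial>unit_leb) - (\<integral>y. V y * w y \<partial>unit_leb)) \<le> BV * e n"
        by (simp add: abs_minus_commute)
    qed
  qed
  moreover have lim_v: "(\<lambda>n. \<integral>y. V y * deriv (\<phi> n) y \<partial>unit_leb) \<longlonglongrightarrow> (\<integral>y. F y * v y \<partial>unit_leb) + (\<Sum>j=1..m. b j * v (x j))"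
    unfolding weak_form_test_function[OF \<phi>]
  proof (intro tendsto_add tendsto_sum tendsto_mult tendsto_const)
    show "(\<lambda>n. \<integral>y. F y * \<phi> n y \<partial>unit_leb) \<longlonglongrightarrow> (\<integral>y. F y * v y \<partial>unit_leb)"
    proof (rule LIM_zero_cancel, rule Lim_null_comparison)
      show "(\<lambda>n. B\<^sub>F * e n) \<longlonglongrightarrow> 0" using tendsto_mult[OF tendsto_const[of B\<^sub>F] e] by simp
      show "\<forall>\<^sub>F n in sequentially. norm ((\<integral>y. F y * \<phi> n y \<partial>unit_leb) - (\<integral>y. F y * v y \<partial>unit_leb)) \<le> B\<^sub>F * e n"
      proof (rule always_eventually, rule allI)
        fix n
        interpret finite_measure unit_leb by (rule unit_leb_finite)
        have "(\<integral>y. F y * v y \<partial>unit_leb) - (\<integral>y. F y * \<phi> n y \<partial>unit_leb) = (\<integral>y. F y * (v y - \<phi> n y) \<partial>unit_leb)"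
          unfolding right_diff_distrib
          by (intro Bochner_Integration.integral_diff[symmetric] F_mult v_cont test_function_continuous \<phi>)
        also have "\<bar>\<dots>\<bar> \<le> (\<integral>y. B\<^sub>F * e n \<partial>unit_leb)"
        proof (rule order_trans[OF integral_abs_bound], rule integral_mono_AE)
          show "integrable unit_leb (\<lambda>y. \<bar>F y * (v y - \<phi> n y)\<bar>)"
            by (intro Bochner_Integration.integrable_abs F_mult continuous_intros v_cont test_function_continuous \<phi>)
          show "AE y in unit_leb. \<bar>F y * (v y - \<phi> n y)\<bar> \<le> B\<^sub>F * e n"
          proof (rule unit_leb_AE)
            fix y :: real assume "y \<in> {0<..<1}"
            then have "y \<in> {0..1}" by simp
            then show "\<bar>F y * (v y - \<phi> n y)\<bar> \<le> B\<^sub>F * e n"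
              unfolding abs_mult using F_bounded[of y] v_\<phi>[of y n] BF by (intro mult_mono) auto
          qed
        qed simp
        also have "\<dots> = B\<^sub>F * e n" by (simp add: measure_restrict_space space_restrict_space)
        finally show "norm ((\<integral>y. F y * \<phi> n y \<partial>unit_leb) - (\<integral>y. F y * v y \<partial>unit_leb)) \<le> B\<^sub>F * e n"
          by (simp add: abs_minus_commute)
      qed
    qed
    show "(\<lambda>n. \<phi> n (x j)) \<longlonglongrightarrow> v (x j)" if "j \<in> {1..m}" for j
    proof (rule LIM_zero_cancel, rule Lim_null_comparison[OF _ e])
      show "\<forall>\<^sub>F n in sequentially. norm (\<phi> n (x j) - v (x j)) \<le> e n"
        using v_\<phi>[OF nodes[OF that]] by (intro always_eventually) (simp add: abs_minus_commute)
    qed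
  qed
  ultimately show "(\<integral>y. V y * v' y \<partial>unit_leb) = (\<integral>y. F y * v y \<partial>unit_leb) + (\<Sum>j=1..m. b j * v (x j))"
    using LIMSEQ_unique[OF lim_w lim_v] by simp
qed

end

subsection \<open>Existence of a solution\<close>

lemma powr_le_affine:
  fixes t r :: real
  assumes "1 < r" "r < 2" shows "\<bar>t\<bar> powr (r - 1) \<le> \<bar>t\<bar> + 1"
proof (cases "\<bar>t\<bar> \<ge> 1")
  case True
  then have "\<bar>t\<bar> powr (r - 1) \<le> \<bar>t\<bar> powr 1" using assms by (intro powr_mono) auto
  then show ?thesis using True by simp
next
  case False
  then have "\<bar>t\<bar> powr (r - 1) \<le> 1" using assms by (intro powr_le1) auto
  then show ?thesis by simp
qed

lemma sum_subinterval_indicators: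
  fixes x a :: "nat \<Rightarrow> real"
  assumes step: "\<And>j. j \<le> m \<Longrightarrow> x j < x (Suc j)" and j: "j \<le> m" and y: "y \<in> {x j<..<x (Suc j)}"
  shows "(\<Sum>i=1..Suc m. a i * indicat_real {x (i - 1)<..<x i} y * t) = a (Suc j) * t"
proof -
  have mono: "x i \<le> x k" if "i \<le> k" "k \<le> Suc m" for i k
    using partition_mono[of m x i k] step that by blast
  have "(\<Sum>i=1..Suc m. a i * indicat_real {x (i - 1)<..<x i} y * t)
      = (\<Sum>i=1..Suc m. if i = Suc j then a (Suc j) * t else 0)"
  proof (rule sum.cong)
    fix i assume i: "i \<in> {1..Suc m}"
    show "a i * indicat_real {x (i - 1)<..<x i} y * t = (if i = Suc j then a (Suc j) * t else 0)"
    proof (cases "i = Suc j")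
      case True
      then show ?thesis using y by simp
    next
      case False
      have "y \<notin> {x (i - 1)<..<x i}"
      proof (cases "i \<le> j")
        case True
        then show ?thesis using mono[of i j] j y by auto
      next
        case False
        then have "Suc j \<le> i - 1" "i - 1 \<le> Suc m" using \<open>i \<noteq> Suc j\<close> i by auto
        then have "x (Suc j) \<le> x (i - 1)" by (rule mono)
        then show ?thesis using y by auto
      qed
      then show ?thesis using False by simp
    qed
  qed simp
  also have "\<dots> = a (Suc j) * t" using j by (simp add: sum.delta)
  finally show ?thesis .
qed

theorem theorem2p1:
  fixes m :: nat and x :: "nat \<Rightarrow> real" and f g :: "real \<Rightarrow> real \<Rightarrow> real"
    and \<iota> :: "nat \<Rightarrow> real \<Rightarrow> real" and a :: "nat \<Rightarrow> real" and r C \<mu> c C' :: real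
  assumes "m \<ge> 1"
    and "x 0 = 0" and "x (m + 1) = 1" and "\<And>j. j \<le> m \<Longrightarrow> x j < x (j + 1)"
    and "caratheodory f"
    and "\<And>j. j \<in> {1..m} \<Longrightarrow> continuous_on UNIV (\<iota> j)"
    and "\<And>y t. y \<in> {0<..<1} \<Longrightarrow>
           f y t = (\<Sum>j=1..m+1. a j * indicat_real {x (j - 1)<..<x j} y * t) + g y t"
    and "1 < r" and "r < 2" and "C > 0"
    and "AE y in unit_leb. \<forall>t. \<bar>g y t\<bar> \<le> C * (\<bar>t\<bar> powr (r - 1) + 1)"
    and "\<mu> > 2" and "c > 0" and "C' > 0"
    and "\<And>j t. j \<in> {1..m} \<Longrightarrow> t * \<iota> j t \<ge> c * \<bar>t\<bar> powr \<mu> - C'"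
    and "\<And>j. j \<in> {1..m+1} \<Longrightarrow> a j \<notin> dirichlet_spectrum x j"
  shows "\<exists>u. weak_solution m x f \<iota> u"
proof -
  note step = assms(4)[unfolded Suc_eq_plus1[symmetric]]
  define \<alpha> where "\<alpha> y = (\<Sum>j=1..Suc m. a j * indicat_real {x (j - 1)<..<x j} y)" for y
  \<comment> \<open>The points at which both almost-everywhere hypotheses hold; its complement in
    (0,1) is a null set.\<close>
  define good where "good = {y \<in> {0<..<1}. continuous_on UNIV (f y) \<and> (\<forall>t. \<bar>g y t\<bar> \<le> C * (\<bar>t\<bar> powr (r - 1) + 1))}"
  have good_sub: "good \<subseteq> {0<..<1}" by (auto simp: good_def)
  have bad_null: "{0<..<1} - good \<in> null_sets lebesgue"
  proof -
    have "AE y in unit_leb. continuous_on UNIV (f y) \<and> (\<forall>t. \<bar>g y t\<bar> \<le> C * (\<bar>t\<bar> powr (r - 1) + 1))"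
      using assms(5,11) by (auto simp: caratheodory_def)
    then obtain N where N: "N \<in> null_sets unit_leb"
      "{y \<in> space unit_leb. \<not> (continuous_on UNIV (f y) \<and> (\<forall>t. \<bar>g y t\<bar> \<le> C * (\<bar>t\<bar> powr (r - 1) + 1)))} \<subseteq> N"
      unfolding eventually_ae_filter by blast
    then have "N \<in> null_sets lebesgue" by (simp add: null_sets_restrict_space)
    moreover have "{0<..<1} - good \<subseteq> N" using N(2) by (auto simp: good_def space_restrict_space)
    ultimately show ?thesis using null_sets_completion_subset by blast
  qed
  have good_sets: "good \<in> sets lebesgue"
  proof -
    have "good = {0<..<1} - ({0<..<1} - good)" using good_sub by blast
    moreover have "{0<..<1::real} \<in> sets lebesgue" by simp
    ultimately show ?thesis using null_setsD2[OF bad_null] by (metis sets.Diff)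
  qed
  \<comment> \<open>Off the good set only the linear part is kept, so continuity and growth hold at
    every point, while on the good set f is unchanged.\<close>
  define f0 where "f0 y t = \<alpha> y * t + (if y \<in> good then g y t else 0)" for y t
  have \<alpha>_times: "\<alpha> y * t = (\<Sum>j=1..m+1. a j * indicat_real {x (j - 1)<..<x j} y * t)" for y t
    unfolding \<alpha>_def Suc_eq_plus1[symmetric] by (rule sum_distrib_right)
  have f0_f: "f0 y t = f y t" if "y \<in> good" for y t
    using that good_sub assms(7)[of y t] unfolding f0_def \<alpha>_times by auto
  have g_le: "\<bar>f0 y t - \<alpha> y * t\<bar> \<le> C * (\<bar>t\<bar> powr (r - 1) + 1)" for y t
    using assms(10) by (auto simp: f0_def good_def)
  define A where "A = (\<Sum>j=1..Suc m. \<bar>a j\<bar>)"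
  have A: "\<bar>\<alpha> y\<bar> \<le> A" for y
    unfolding \<alpha>_def A_def
    by (rule order_trans[OF sum_abs sum_mono]) (auto simp: indicator_def)
  have A_nonneg: "A \<ge> 0" unfolding A_def by (intro sum_nonneg) auto
  have \<alpha>_eq: "\<alpha> y * t = a (Suc j) * t" if "j \<le> m" "y \<in> {x j<..<x (Suc j)}" for j y t
    unfolding \<alpha>_times Suc_eq_plus1[symmetric] by (rule sum_subinterval_indicators[OF step that])
  have x01: "x j \<in> {0..1}" if "j \<in> {1..m}" for j
    using partition_mono[of m x 0 j] partition_mono[of m x j "Suc m"] step that assms(2,3) by auto
  \<comment> \<open>The growth constants come from |t|^(r-1) <= |t| + 1: the remainder is at most C
    (|t| + 2), and A bounds the coefficient of the linear part.\<close>
  interpret superlinear_impulses f0 m x \<iota> "A + C" "2 * C" a C r \<mu> c C'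
  proof
    show "(\<lambda>y. f0 y t) \<in> borel_measurable (lebesgue_on {0..1})" for t
    proof -
      have \<alpha>_meas: "\<alpha> \<in> borel_measurable lebesgue"
        unfolding \<alpha>_def by (intro borel_measurable_sum borel_measurable_times borel_measurable_indicator) auto
      have "(\<lambda>y. f y t) \<in> borel_measurable (lebesgue_on good)"
        using assms(5) by (auto simp: caratheodory_def intro: measurable_restrict_mono[OF _ good_sub])
      then have "(\<lambda>y. f y t - \<alpha> y * t) \<in> borel_measurable (lebesgue_on good)"
        using measurable_restrict_space1[OF \<alpha>_meas, of good] by measurable
      then have "(\<lambda>y. if y \<in> good then f y t - \<alpha> y * t else 0) \<in> borel_measurable lebesgue"
        by (rule borel_measurable_if_I[OF _ good_sets])
      with \<alpha>_meas have "(\<lambda>y. \<alpha> y * t + (if y \<in> good then f y t - \<alpha> y * t else 0)) \<in> borel_measurable lebesgue"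
        by (intro borel_measurable_add borel_measurable_times) auto
      also have "(\<lambda>y. \<alpha> y * t + (if y \<in> good then f y t - \<alpha> y * t else 0)) = (\<lambda>y. f0 y t)"
      proof
        fix y
        show "\<alpha> y * t + (if y \<in> good then f y t - \<alpha> y * t else 0) = f0 y t"
          using f0_f[of y t] by (cases "y \<in> good") (auto simp: f0_def)
      qed
      finally show ?thesis by (rule measurable_restrict_space1)
    qed
    show "continuous_on UNIV (f0 y)" for y
    proof (cases "y \<in> good")
      case True
      then have "f0 y = f y" using f0_f by blast
      then show ?thesis using True by (simp add: good_def)
    next
      case False
      then have "f0 y = (\<lambda>t. \<alpha> y * t)" by (auto simp: f0_def)
      then show ?thesis by (simp add: continuous_on_mult_left)
    qed
    show "\<bar>f0 y t\<bar> \<le> (A + C) * \<bar>t\<bar> + 2 * C" for y t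
    proof -
      have lin: "\<bar>\<alpha> y * t\<bar> \<le> A * \<bar>t\<bar>" unfolding abs_mult using A[of y] by (rule mult_right_mono) simp
      have "C * (\<bar>t\<bar> powr (r - 1) + 1) \<le> C * (\<bar>t\<bar> + 1 + 1)"
        using powr_le_affine[OF assms(8,9), of t] assms(10) by (intro mult_left_mono) auto
      then have sub: "\<bar>f0 y t - \<alpha> y * t\<bar> \<le> C * (\<bar>t\<bar> + 1 + 1)" by (rule order_trans[OF g_le])
      have "\<bar>f0 y t\<bar> \<le> \<bar>\<alpha> y * t\<bar> + \<bar>f0 y t - \<alpha> y * t\<bar>"
        using abs_triangle_ineq[of "\<alpha> y * t" "f0 y t - \<alpha> y * t"] by simp
      also have "\<dots> \<le> A * \<bar>t\<bar> + C * (\<bar>t\<bar> + 1 + 1)" by (rule add_mono[OF lin sub])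
      also have "\<dots> = (A + C) * \<bar>t\<bar> + 2 * C" by (simp add: distrib_left distrib_right)
      finally show ?thesis .
    qed
    show "\<bar>f0 y t - a (Suc j) * t\<bar> \<le> C * (\<bar>t\<bar> powr (r - 1) + 1)" if "j \<le> m" "y \<in> {x j<..<x (Suc j)}" for j y t
      using g_le[of y t] unfolding \<alpha>_eq[OF that] .
    show "x (Suc m) = 1" using assms(3) by simp
    show "x j < x (Suc j)" if "j \<le> m" for j using step[OF that] .
    show "a (Suc j) \<notin> dirichlet_spectrum x (Suc j)" if "j \<le> m" for j using assms(16)[of "Suc j"] that by simp
    show "A + C \<ge> 0" "2 * C \<ge> 0" using A_nonneg assms(10) by auto
    show "x j \<in> {0..1}" if "j \<in> {1..m}" for j by (rule x01[OF that])
  qed (use assms in auto)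
  obtain p u where u: "continuous_on {0..1} u" "u 1 = 0" "\<And>y. y \<in> {0..1} \<Longrightarrow> u y = pos p u y"
    using exists_shooting_solution by blast
  obtain B where B: "B \<ge> 0" "\<And>y. y \<in> {0..1} \<Longrightarrow> \<bar>u y\<bar> \<le> B" using bounded_on_Icc[OF u(1)] by blast
  define F where "F y = f0 y (u y)" for y
  define V where "V = vel p u"
  interpret sol: impulsive_bvp_solution F p "(A + C) * B + 2 * C" m x "\<lambda>j. \<iota> j (u (x j))" u V
  proof
    show "F \<in> borel_measurable (lebesgue_on {0..1})"
      unfolding F_def by (rule nemytskii_measurable[OF u(1)])
    show "\<bar>F y\<bar> \<le> (A + C) * B + 2 * C" if "y \<in> {0..1}" for y
      unfolding F_def by (rule nemytskii_bound[where w = u, OF B(2)[OF that] that])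
    show "V y = p - integral {0..y} F - (\<Sum>j=1..m. if x j < y then \<iota> j (u (x j)) else 0)" for y
      unfolding V_def vel_def F_def by simp
    show "u y = integral {0..y} V" if "y \<in> {0..1}" for y
      using u(3)[OF that] by (simp add: pos_def V_def)
  qed (use u x01 in auto)
  have "integrable unit_leb (\<lambda>y. f y (u y) * v y) \<and>
      (\<integral>y. V y * v' y \<partial>unit_leb) = (\<integral>y. f y (u y) * v y \<partial>unit_leb) + (\<Sum>j=1..m. \<iota> j (u (x j)) * v (x j))"
    if v: "v \<in> H1_0" "has_weak_deriv v v'" for v v'
  proof -
    \<comment> \<open>The weak identity is available for the modified right-hand side
      \<open>F\<close>. It carries over to f because the two integrands agree off a null set, and
      this transfers integrability as well.\<close>
    have eq: "f y (u y) * v y = F y * v y" if "y \<in> {0<..<1} - ({0<..<1} - good)" for y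
      using that f0_f[of y] by (auto simp: F_def)
    have neg: "negligible ({0<..<1} - good)" using bad_null by (simp add: negligible_iff_null_sets)
    have abs_iff: "integrable unit_leb k \<longleftrightarrow> k absolutely_integrable_on {0<..<1}" for k :: "real \<Rightarrow> real"
      by (simp add: integrable_restrict_space set_integrable_def)
    have F_int: "integrable unit_leb (\<lambda>y. F y * v y)" by (rule sol.weak_form(1)[OF v])
    then have int: "integrable unit_leb (\<lambda>y. f y (u y) * v y)"
      unfolding abs_iff by (rule absolutely_integrable_spike[OF _ neg eq])
    have "(\<integral>y. f y (u y) * v y \<partial>unit_leb) = integral {0<..<1} (\<lambda>y. f y (u y) * v y)"
      by (rule lebesgue_integral_eq_integral[OF int]) simp
    also have "\<dots> = integral {0<..<1} (\<lambda>y. F y * v y)"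
      by (rule integral_spike[OF neg]) (rule eq[symmetric])
    also have "\<dots> = (\<integral>y. F y * v y \<partial>unit_leb)"
      by (rule lebesgue_integral_eq_integral[OF F_int, symmetric]) simp
    finally show ?thesis using int sol.weak_form(2)[OF v] by simp
  qed
  then have "weak_solution m x f \<iota> u"
    unfolding weak_solution_def using sol.u_in_H1_0 sol.weak_deriv by blast
  then show ?thesis by blast
qed

end
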